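(* Let $\theta\in\,]-\pi/2,\pi/2[$ and $\sigma\in\overline{BS}^{(m_1,m_2),1}_{1,0;\theta}$ be fixed ($m_1,m_2\in\mathbb R$). Let $\tau\in S^t_{1,0}$ be a linear pseudodifferential symbol of order $t$. Then the operator $$T(f,g):=\tau(x,D)\,T_\sigma(f,g)$$ corresponds to $T_m$ with the bilinear symbol $m\in\overline{BS}^{(m_1+t,m_2),1}_{1,0;\theta}$ given by $$m(x,\xi,\eta)=(2\pi)^{-1}\int_{\mathbb R^2}e^{i(x-y)(\xi+\eta-\alpha)}\sigma(y,\xi,\eta)\,\tau(x,\alpha)\,dy\,d\alpha .$$ This symbol satisfies the asymptotic formula: for all integers $N\ge0$, $$m(x,\xi,\eta)-\sum_{k=0}^{N-1}\frac{i^k}{k!}\,\partial_\xi^k\tau(x,\xi+\eta)\,\partial_x^k\sigma(x,\xi,\eta)\in\overline{BS}^{(m_1+t-N,m_2-N),1}_{1,0;\theta} .$$ There are similar results for the class $\overline{BS}^{(m_1,m_2),2}_{1,0;\theta}$.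
   Context: $\widehat f$ denotes the Fourier transform of $f$. For $\sigma\in C^\infty(\mathbb R^3)$ the bilinear operator $T_\sigma$ is defined for $f,g\in\mathcal S(\mathbb R)$ by $$T_\sigma(f,g)(x)=\iint_{\mathbb R^2}e^{ix(\alpha+\beta)}\sigma(x,\alpha,\beta)\widehat f(\alpha)\widehat g(\beta)\,d\alpha\,d\beta .$$ For $t\in\mathbb R$, $S^t_{1,0}$ is the set of $\tau\in C^\infty(\mathbb R^2)$ with $|\partial_x^a\partial_\xi^b\tau(x,\xi)|\lesssim(1+|\xi|)^{t-b}$ for all integers $a,b\ge0$, and $\tau(x,D)f(x)=\int_{\mathbb R}e^{ix\xi}\widehat f(\xi)\tau(x,\xi)\,d\xi$. The integral defining $m$ is understood as an oscillatory integral. Symbol classes ($\sigma\in C^\infty(\mathbb R^3)$; $\lesssim$ means $\le$ up to a constant independent of $(x,\alpha,\beta)$; $\partial_{\beta-\alpha}=\partial_\beta-\partial_\alpha$ and $\partial_{\alpha-\beta}=\partial_\alpha-\partial_\beta$): $\sigma\in\overline{BS}^{(m_1,m_2),1}_{1,0;\theta}$ iff for all integers $a,b,c\ge0$, $|\partial_x^a\partial_\alpha^b\partial_{\beta-\alpha}^c\sigma(x,\alpha,\beta)|\lesssim(1+|\alpha+\beta|)^{m_1}(1+|\beta|)^{m_2}(1+\min\{|\alpha+\beta|,|\beta-\tan(\theta)\alpha|\})^{-b}(1+\min\{|\beta|,|\beta-\tan(\theta)\alpha|\})^{-c}$. $\sigma\in\overline{BS}^{(m_1,m_2),2}_{1,0;\theta}$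 iff for all integers $a,b,c\ge0$, $|\partial_x^a\partial_{\alpha-\beta}^b\partial_\beta^c\sigma(x,\alpha,\beta)|\lesssim(1+|\alpha|)^{m_1}(1+|\alpha+\beta|)^{m_2}(1+\min\{|\alpha|,|\beta-\tan(\theta)\alpha|\})^{-b}(1+\min\{|\alpha+\beta|,|\beta-\tan(\theta)\alpha|\})^{-c}$.
   Formalization: The remainder is proved in the class of order (m1+t-N, m2), not (m1+t-N, m2-N), and m has phase (x-y)(alpha-xi-eta) with coefficients (-i)^k instead of i^k; as printed both fail for sigma=e^{ix}, tau=xi, where m=e^{ix}(xi+eta+1). *)

theory Defs
  imports "HOL-Analysis.Analysis"
begin

definition dir_deriv ::
    "'a::real_normed_vector \<Rightarrow> ('a \<Rightarrow> complex) \<Rightarrow> 'a \<Rightarrow> complex" where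
  "dir_deriv v f = (\<lambda>p. vector_derivative (\<lambda>h::real. f (p + h *\<^sub>R v)) (at 0))"

(* All iterated partial derivatives (in any order) exist and are Frechet differentiable, hence
   continuous: this is C^infinity on the whole space. *)
definition smooth :: "('a::euclidean_space \<Rightarrow> complex) \<Rightarrow> bool" where
  "smooth f \<longleftrightarrow> (\<forall>vs. set vs \<subseteq> Basis \<longrightarrow> foldr dir_deriv vs f differentiable_on UNIV)"

definition schwartz :: "('a::euclidean_space \<Rightarrow> complex) set" where
  "schwartz = {f. smooth f \<and>
     (\<forall>vs (k::nat). set vs \<subseteq> Basis \<longrightarrow>
        (\<exists>C. \<forall>p. (1 + norm p) ^ k * cmod (foldr dir_deriv vs f p) \<le> C))}"

(* This normalization is the one for which f(x) is the integral of exp(i x xi) (fourier f xi) d xi,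
   so that the symbol 1 gives the identity, and for which the factor 1/(2 pi) appears in
   the symbol of a composition. *)
definition fourier :: "(real \<Rightarrow> complex) \<Rightarrow> real \<Rightarrow> complex" where
  "fourier f \<xi> = complex_of_real (1 / (2 * pi)) * (LINT x|lborel. cis (- (x * \<xi>)) * f x)"


(* Linear symbols are functions of (x, xi). *)

definition lin_dx :: "(real \<times> real \<Rightarrow> complex) \<Rightarrow> real \<times> real \<Rightarrow> complex" where
  "lin_dx = dir_deriv (1, 0)"

definition lin_dxi :: "(real \<times> real \<Rightarrow> complex) \<Rightarrow> real \<times> real \<Rightarrow> complex" where
  "lin_dxi = dir_deriv (0, 1)"

definition S_class :: "real \<Rightarrow> (real \<times> real \<Rightarrow> complex) set" where
  "S_class t = {\<tau>. smooth \<tau> \<and>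
     (\<forall>a b. \<exists>C. \<forall>x \<xi>.
        cmod ((lin_dx ^^ a) ((lin_dxi ^^ b) \<tau>) (x, \<xi>)) \<le> C * (1 + \<bar>\<xi>\<bar>) powr (t - real b))}"

definition psdo ::
    "(real \<times> real \<Rightarrow> complex) \<Rightarrow> (real \<Rightarrow> complex) \<Rightarrow> real \<Rightarrow> complex" where
  "psdo \<tau> f x = (LINT \<xi>|lborel. cis (x * \<xi>) * fourier f \<xi> * \<tau> (x, \<xi>))"


(* Bilinear symbols are functions of (x, alpha, beta). *)

definition bil_dx ::
    "(real \<times> real \<times> real \<Rightarrow> complex) \<Rightarrow> real \<times> real \<times> real \<Rightarrow> complex" where
  "bil_dx = dir_deriv (1, 0, 0)"

definition bil_da ::
    "(real \<times> real \<times> real \<Rightarrow> complex) \<Rightarrow> real \<times> real \<times> real \<Rightarrow> complex" where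
  "bil_da = dir_deriv (0, 1, 0)"

definition bil_db ::
    "(real \<times> real \<times> real \<Rightarrow> complex) \<Rightarrow> real \<times> real \<times> real \<Rightarrow> complex" where
  "bil_db = dir_deriv (0, 0, 1)"

definition bil_dba ::
    "(real \<times> real \<times> real \<Rightarrow> complex) \<Rightarrow> real \<times> real \<times> real \<Rightarrow> complex" where
  "bil_dba \<sigma> = (\<lambda>p. bil_db \<sigma> p - bil_da \<sigma> p)"

definition bil_dab ::
    "(real \<times> real \<times> real \<Rightarrow> complex) \<Rightarrow> real \<times> real \<times> real \<Rightarrow> complex" where
  "bil_dab \<sigma> = (\<lambda>p. bil_da \<sigma> p - bil_db \<sigma> p)"

definition BS1 :: "real \<Rightarrow> real \<Rightarrow> real \<Rightarrow> (real \<times> real \<times> real \<Rightarrow> complex) set" where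
  "BS1 m1 m2 \<theta> = {\<sigma>. smooth \<sigma> \<and>
     (\<forall>a b c. \<exists>C. \<forall>x \<alpha> \<beta>.
        cmod ((bil_dx ^^ a) ((bil_da ^^ b) ((bil_dba ^^ c) \<sigma>)) (x, \<alpha>, \<beta>))
          \<le> C * (1 + \<bar>\<alpha> + \<beta>\<bar>) powr m1 * (1 + \<bar>\<beta>\<bar>) powr m2
              * (1 + min \<bar>\<alpha> + \<beta>\<bar> \<bar>\<beta> - tan \<theta> * \<alpha>\<bar>) powr (- real b)
              * (1 + min \<bar>\<beta>\<bar> \<bar>\<beta> - tan \<theta> * \<alpha>\<bar>) powr (- real c))}"

definition BS2 :: "real \<Rightarrow> real \<Rightarrow> real \<Rightarrow> (real \<times> real \<times> real \<Rightarrow> complex) set" where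
  "BS2 m1 m2 \<theta> = {\<sigma>. smooth \<sigma> \<and>
     (\<forall>a b c. \<exists>C. \<forall>x \<alpha> \<beta>.
        cmod ((bil_dx ^^ a) ((bil_dab ^^ b) ((bil_db ^^ c) \<sigma>)) (x, \<alpha>, \<beta>))
          \<le> C * (1 + \<bar>\<alpha>\<bar>) powr m1 * (1 + \<bar>\<alpha> + \<beta>\<bar>) powr m2
              * (1 + min \<bar>\<alpha>\<bar> \<bar>\<beta> - tan \<theta> * \<alpha>\<bar>) powr (- real b)
              * (1 + min \<bar>\<alpha> + \<beta>\<bar> \<bar>\<beta> - tan \<theta> * \<alpha>\<bar>) powr (- real c))}"

definition bilinear_op ::
    "(real \<times> real \<times> real \<Rightarrow> complex) \<Rightarrow> (real \<Rightarrow> complex) \<Rightarrow> (real \<Rightarrow> complex) \<Rightarrow> real \<Rightarrow> complex"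
  where
  "bilinear_op \<sigma> f g x =
     (LINT (\<alpha>, \<beta>)|lborel. cis (x * (\<alpha> + \<beta>)) * \<sigma> (x, \<alpha>, \<beta>) * fourier f \<alpha> * fourier g \<beta>)"


(* Oscillatory integral over R^2 by regularization: the limit has to exist and be the same for
   every Schwartz cutoff phi with phi(0) = 1. *)
definition has_osc_integral :: "(real \<times> real \<Rightarrow> complex) \<Rightarrow> complex \<Rightarrow> bool" where
  "has_osc_integral F I \<longleftrightarrow>
     (\<forall>\<phi>\<in>schwartz. \<phi> 0 = 1 \<longrightarrow>
        (\<forall>\<epsilon>>0. integrable lborel (\<lambda>p. \<phi> (\<epsilon> *\<^sub>R p) * F p)) \<and>
        ((\<lambda>\<epsilon>. (LINT p|lborel. \<phi> (\<epsilon> *\<^sub>R p) * F p)) \<longlongrightarrow> I) (at_right 0))"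

definition osc_integral :: "(real \<times> real \<Rightarrow> complex) \<Rightarrow> complex" where
  "osc_integral F = (THE I. has_osc_integral F I)"

(* Integrand, in the variables (y, alpha), of the symbol of the composition. The sign of the phase
   is forced by the conventions above: composing psdo tau with bilinear_op sigma produces
   exp(i x alpha) * exp(- i y alpha) * exp(i y (xi + eta)), which is exp(i x (xi + eta)) times
   exp(i (x - y) (alpha - xi - eta)). *)
definition comp_integrand ::
    "(real \<times> real \<Rightarrow> complex) \<Rightarrow> (real \<times> real \<times> real \<Rightarrow> complex) \<Rightarrow> real \<times> real \<times> real \<Rightarrow>
     real \<times> real \<Rightarrow> complex" where
  "comp_integrand \<tau> \<sigma> = (\<lambda>(x, \<xi>, \<eta>) (y, \<alpha>).
     cis ((x - y) * (\<alpha> - (\<xi> + \<eta>))) * \<sigma> (y, \<xi>, \<eta>) * \<tau> (x, \<alpha>))"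

definition comp_symbol ::
    "(real \<times> real \<Rightarrow> complex) \<Rightarrow> (real \<times> real \<times> real \<Rightarrow> complex) \<Rightarrow> real \<times> real \<times> real \<Rightarrow> complex"
  where
  "comp_symbol \<tau> \<sigma> p = complex_of_real (1 / (2 * pi)) * osc_integral (comp_integrand \<tau> \<sigma> p)"

(* The factor (-i)^k, rather than i^k, goes with the above sign of the phase. *)
definition comp_expansion ::
    "nat \<Rightarrow> (real \<times> real \<Rightarrow> complex) \<Rightarrow> (real \<times> real \<times> real \<Rightarrow> complex) \<Rightarrow>
     real \<times> real \<times> real \<Rightarrow> complex" where
  "comp_expansion N \<tau> \<sigma> = (\<lambda>(x, \<xi>, \<eta>).
     \<Sum>k<N. (- \<i>) ^ k / fact k * (lin_dxi ^^ k) \<tau> (x, \<xi> + \<eta>) * (bil_dx ^^ k) \<sigma> (x, \<xi>, \<eta>))"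

(* Pitfall on remainders: derivatives of sigma in x gain nothing, and those of tau in xi gain
   only powers of 1 + |xi + eta|. Hence the N-th remainder gains N only in the order attached to
   |alpha + beta| (the first one in BS1, the second one in BS2), and the other order is unchanged. *)

end

theory Submission
  imports Defs "HOL-Probability.Probability"
begin

text \<open>
  With \<open>z = y - x\<close>, \<open>s = \<xi> + \<eta>\<close> and \<open>\<omega> = \<alpha> - s\<close> the symbol of the composition is the oscillatory
  integral of \<open>exp (- \<i> z \<omega>) \<sigma> (x + z, \<xi>, \<eta>) \<tau> (x, s + \<omega>)\<close> over \<open>(z, \<omega>)\<close>, divided by \<open>2 \<pi>\<close>.
  Integrating by parts in both variables turns it into an absolutely convergent average of products of
  translates of derivatives of \<open>\<sigma>\<close> and \<open>\<tau>\<close>, with arbitrarily fast decay in \<open>\<omega>\<close>. The symbol weights do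
  not depend on \<open>x\<close> and change under \<open>s \<mapsto> s + \<omega>\<close> by a power of \<open>1 + \<bar>\<omega>\<bar>\<close> only, so such an average satisfies the
  estimates of the pointwise product, and Leibniz' rule handles all derivatives. Expanding \<open>\<sigma> (x + z, \<xi>, \<eta>)\<close> in
  powers of \<open>z\<close> and trading each \<open>z\<close> for a derivative of \<open>\<tau>\<close> gives the asymptotic formula: the powers of \<open>z\<close>
  contribute the terms of the expansion by Fourier inversion, and the remainder is again such an average.
\<close>

section \<open>Directional derivatives and amplitude classes\<close>

text \<open>The obstacle is that \<tau> is evaluated at s + \<omega> while the estimate is wanted at
  s. Every derivative that falls on \<tau> costs a factor 1 + |\<omega>| when its gain is moved back
  to s, so no single regularization serves derivatives of all orders. The number M of integrations
  by parts in z, which produce the decay in \<omega>, is therefore chosen after the derivative to be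
  estimated; this is legitimate because the value of the oscillatory integral does not depend on M.
  For decay in z, two integrations by parts in \<omega> always suffice, because \<sigma> is bounded
  in x and powers of z are removed before estimating. Of the two frequency directions in each class,
  one leaves alpha + beta fixed and annihilates \<tau>; the other moves it at unit speed, and its
  gain is never stronger than the 1 / (1 + |alpha + beta|) that \<tau> delivers. Derivatives of
  \<sigma> in x gain nothing, so all N orders gained by the remainder come from \<tau> and lower
  only the order attached to alpha + beta. The regularized limits, once known not to depend on the
  cutoff, are evaluated with a Gaussian.\<close>

abbreviation iter_deriv ::
    "'a list \<Rightarrow> ('a::real_normed_vector \<Rightarrow> complex) \<Rightarrow> 'a \<Rightarrow> complex" where
  "iter_deriv w f \<equiv> foldr dir_deriv w f"

section \<open>Calculus of directional derivatives\<close>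

lemma dir_deriv_eq:
  assumes "(f has_derivative f') (at p)"
  shows "dir_deriv v f p = f' v"
proof -
  interpret bounded_linear f' using assms by (rule has_derivative_bounded_linear)
  have "((\<lambda>h::real. p + h *\<^sub>R v) has_derivative (\<lambda>h. h *\<^sub>R v)) (at 0)"
    by (auto intro!: derivative_eq_intros)
  from has_derivative_compose[OF this, of f f'] assms
  have "((\<lambda>h. f (p + h *\<^sub>R v)) has_derivative (\<lambda>h. f' (h *\<^sub>R v))) (at 0)" by simp
  then have "((\<lambda>h. f (p + h *\<^sub>R v)) has_vector_derivative f' v) (at 0)"
    by (simp add: has_vector_derivative_def scale)
  then show ?thesis unfolding dir_deriv_def by (rule vector_derivative_at)
qed

lemma has_derivative_dir_deriv:
  assumes "f differentiable_on UNIV"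
  shows "(f has_derivative (\<lambda>v. dir_deriv v f p)) (at p)"
proof -
  obtain f' where f': "(f has_derivative f') (at p)"
    using assms by (auto simp: differentiable_on_def differentiable_def)
  then show ?thesis by (simp add: dir_deriv_eq[OF f'])
qed

lemma dir_deriv_zero [simp]: "dir_deriv v (\<lambda>_. c) = (\<lambda>_. 0)"
  by (rule ext, rule dir_deriv_eq) (rule has_derivative_const)

lemma dir_deriv_add:
  assumes "f differentiable_on UNIV" "g differentiable_on UNIV"
  shows "dir_deriv v (\<lambda>p. f p + g p) = (\<lambda>p. dir_deriv v f p + dir_deriv v g p)"
  by (rule ext, rule dir_deriv_eq)
     (intro has_derivative_add has_derivative_dir_deriv assms)

lemma dir_deriv_cmult:
  assumes "f differentiable_on UNIV"
  shows "dir_deriv v (\<lambda>p. c * f p) = (\<lambda>p. c * dir_deriv v f p)"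
  by (rule ext, rule dir_deriv_eq)
     (intro has_derivative_mult_right has_derivative_dir_deriv assms)

lemma dir_deriv_mult:
  assumes "f differentiable_on UNIV" "g differentiable_on UNIV"
  shows "dir_deriv v (\<lambda>p. f p * g p) = (\<lambda>p. dir_deriv v f p * g p + f p * dir_deriv v g p)"
proof (rule ext)
  fix p
  have "((\<lambda>p. f p * g p) has_derivative (\<lambda>v. f p * dir_deriv v g p + dir_deriv v f p * g p)) (at p)"
    by (intro has_derivative_mult has_derivative_dir_deriv assms)
  from dir_deriv_eq[OF this]
  show "dir_deriv v (\<lambda>p. f p * g p) p = dir_deriv v f p * g p + f p * dir_deriv v g p"
    by (simp add: add.commute)
qed

lemma dir_deriv_affine:
  assumes "f differentiable_on UNIV" "bounded_linear L"
  shows "dir_deriv v (\<lambda>p. f (L p + c)) = (\<lambda>p. dir_deriv (L v) f (L p + c))"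
proof (rule ext)
  fix p
  have "((\<lambda>p. L p + c) has_derivative L) (at p)"
    using bounded_linear_imp_has_derivative[OF assms(2)]
    by (auto intro!: derivative_eq_intros)
  from has_derivative_compose[OF this has_derivative_dir_deriv[OF assms(1)]]
  show "dir_deriv v (\<lambda>p. f (L p + c)) p = dir_deriv (L v) f (L p + c)"
    by (rule dir_deriv_eq)
qed

lemma differentiable_on_affine:
  fixes f :: "'a::real_normed_vector \<Rightarrow> complex"
  assumes "f differentiable_on UNIV" "bounded_linear L"
  shows "(\<lambda>p. f (L p + c)) differentiable_on UNIV"
proof -
  have "((\<lambda>p. f (L p + c)) has_derivative (\<lambda>v. dir_deriv (L v) f (L p + c))) (at p)" for p
  proof -
    have "((\<lambda>p. L p + c) has_derivative L) (at p)"
      using bounded_linear_imp_has_derivative[OF assms(2)]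
      by (auto intro!: derivative_eq_intros)
    from has_derivative_compose[OF this has_derivative_dir_deriv[OF assms(1)]]
    show ?thesis .
  qed
  then show ?thesis by (auto simp: differentiable_on_def differentiable_def)
qed

lemma dir_deriv_lin:
  assumes "f differentiable_on UNIV"
  shows "dir_deriv (a *\<^sub>R u + v) f = (\<lambda>p. of_real a * dir_deriv u f p + dir_deriv v f p)"
proof (rule ext)
  fix p
  interpret bounded_linear "\<lambda>v. dir_deriv v f p"
    using has_derivative_dir_deriv[OF assms] by (rule has_derivative_bounded_linear)
  show "dir_deriv (a *\<^sub>R u + v) f p = of_real a * dir_deriv u f p + dir_deriv v f p"
    by (simp add: add scale scaleR_conv_of_real)
qed

lemma dir_deriv_zero_vec [simp]: "dir_deriv 0 f = (\<lambda>_. 0)"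
  by (simp add: dir_deriv_def)

text \<open>Complex linear combinations, built one summand at a time. If the derivatives of the
  generators stay in the span, all iterated derivatives do; this replaces explicit formulas for
  higher derivatives.\<close>

inductive_set lin_span :: "('a \<Rightarrow> complex) set \<Rightarrow> ('a \<Rightarrow> complex) set" for X where
  zero: "(\<lambda>_. 0) \<in> lin_span X"
| step: "h \<in> X \<Longrightarrow> g \<in> lin_span X \<Longrightarrow> (\<lambda>p. c * h p + g p) \<in> lin_span X"

lemma lin_span_base: "h \<in> X \<Longrightarrow> h \<in> lin_span X"
  using lin_span.step[of h X "\<lambda>_. 0" 1] by (simp add: lin_span.zero)

lemma lin_span_add: "f \<in> lin_span X \<Longrightarrow> g \<in> lin_span X \<Longrightarrow> (\<lambda>p. f p + g p) \<in> lin_span X"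
  by (induction rule: lin_span.induct) (auto simp: add.assoc intro: lin_span.step)

lemma lin_span_cmult: "f \<in> lin_span X \<Longrightarrow> (\<lambda>p. c * f p) \<in> lin_span X"
proof (induction rule: lin_span.induct)
  case (step h g d)
  then show ?case using lin_span.step[of h X "\<lambda>p. c * g p" "c * d"] by (simp add: algebra_simps)
qed (auto intro: lin_span.zero)

text \<open>The span of \<open>X\<close> is stable under differentiation as soon as the derivatives
  of its generators lie in it, so a property preserved by linear combinations reaches every iterated
  derivative. \<open>Q\<close> has to include differentiability, since only then does the derivative
  of a combination split.\<close>

lemma iter_deriv_coinduct:
  assumes f: "f \<in> lin_span X" and w: "set w \<subseteq> Basis"
    and zero: "Q (\<lambda>_. 0)"
    and comb: "\<And>c h g. Q h \<Longrightarrow> Q g \<Longrightarrow> Q (\<lambda>p. c * h p + g p)"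
    and diff: "\<And>g. Q g \<Longrightarrow> g differentiable_on UNIV"
    and X: "\<And>g. g \<in> X \<Longrightarrow> Q g"
    and D: "\<And>g b. g \<in> X \<Longrightarrow> b \<in> Basis \<Longrightarrow> dir_deriv b g \<in> lin_span X"
  shows "Q (iter_deriv w f)"
proof -
  have Q: "Q g" if "g \<in> lin_span X" for g
    using that by (induction rule: lin_span.induct) (auto intro: zero comb X)
  have step: "dir_deriv b g \<in> lin_span X" if "g \<in> lin_span X" "b \<in> Basis" for g b
    using that
  proof (induction rule: lin_span.induct)
    case zero
    then show ?case by (auto intro: lin_span.zero)
  next
    case (step h g c)
    have dh: "h differentiable_on UNIV" using step.hyps(1) X diff by blast
    have "dir_deriv b (\<lambda>p. c * h p + g p) = (\<lambda>p. c * dir_deriv b h p + dir_deriv b g p)"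
      using dh diff[OF Q[OF step.hyps(2)]]
      by (subst dir_deriv_add) (auto intro!: derivative_intros differentiable_on_mult simp: dir_deriv_cmult)
    then show ?case
      using lin_span_add[OF lin_span_cmult[OF D[OF step.hyps(1) step.prems]] step.IH[OF step.prems]]
      by simp
  qed
  have "iter_deriv w f \<in> lin_span X" using w by (induction w) (auto simp: f step)
  then show ?thesis by (rule Q)
qed

lemma smooth_coinduct:
  assumes "f \<in> lin_span X" "\<And>g. g \<in> X \<Longrightarrow> g differentiable_on UNIV"
    and "\<And>g b. g \<in> X \<Longrightarrow> b \<in> Basis \<Longrightarrow> dir_deriv b g \<in> lin_span X"
  shows "smooth f"
  unfolding smooth_def
proof (intro allI impI)
  fix w :: "'a list" assume "set w \<subseteq> Basis"
  then show "iter_deriv w f differentiable_on UNIV"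
    by (rule iter_deriv_coinduct[where Q="\<lambda>g. g differentiable_on UNIV", OF assms(1)])
       (use assms in \<open>auto intro!: derivative_intros\<close>)
qed

section \<open>Closure properties of smooth functions\<close>

lemma smooth_differentiable: "smooth f \<Longrightarrow> f differentiable_on UNIV"
  unfolding smooth_def by (erule allE[of _ "[]"]) auto

lemma smooth_continuous: "smooth f \<Longrightarrow> continuous_on S f"
  using continuous_on_subset differentiable_imp_continuous_on smooth_differentiable by blast

lemma smooth_borel [measurable_dest]: "smooth f \<Longrightarrow> f \<in> borel_measurable borel"
  by (intro borel_measurable_continuous_onI smooth_continuous)

lemma smooth_has_derivative: "smooth f \<Longrightarrow> (f has_derivative (\<lambda>v. dir_deriv v f p)) (at p)"
  by (rule has_derivative_dir_deriv[OF smooth_differentiable])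

lemma smooth_dir_deriv_Basis:
  assumes "smooth f" "b \<in> Basis" shows "smooth (dir_deriv b f)"
  unfolding smooth_def
proof (intro allI impI)
  fix w :: "'a list" assume "set w \<subseteq> Basis"
  then have "iter_deriv (w @ [b]) f differentiable_on UNIV"
    using assms(2) by (intro assms(1)[unfolded smooth_def, rule_format]) simp
  then show "iter_deriv w (dir_deriv b f) differentiable_on UNIV" by simp
qed

lemma smooth_lin_span: "f \<in> lin_span (Collect smooth) \<Longrightarrow> smooth f"
  by (erule smooth_coinduct)
     (simp_all add: smooth_differentiable lin_span_base smooth_dir_deriv_Basis)

lemma smooth_add: "smooth f \<Longrightarrow> smooth g \<Longrightarrow> smooth (\<lambda>p. f p + g p)"
  by (intro smooth_lin_span lin_span_add lin_span_base) auto

lemma smooth_cmult: "smooth f \<Longrightarrow> smooth (\<lambda>p. c * f p)"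
  by (intro smooth_lin_span lin_span_cmult lin_span_base) auto

lemma smooth_const: "smooth (\<lambda>_. c)"
proof (rule smooth_coinduct[where X="{\<lambda>_. c}"])
  show "(\<lambda>_. c) \<in> lin_span {\<lambda>_::'a. c}" by (rule lin_span_base) simp
qed (simp_all add: lin_span.zero)

text \<open>By Leibniz, the products of two smooth functions form a set of generators whose
  derivatives are sums of two generators.\<close>

lemma smooth_mult: assumes "smooth f" "smooth g" shows "smooth (\<lambda>p. f p * g p)"
proof (rule smooth_coinduct[where X="{\<lambda>p. f p * g p |f g. smooth f \<and> smooth g}"])
  show "(\<lambda>p. f p * g p) \<in> lin_span {\<lambda>p. f p * g p |f g. smooth f \<and> smooth g}"
    using assms by (intro lin_span_base) auto
  show "h differentiable_on UNIV" if "h \<in> {\<lambda>p. f p * g p |f g. smooth f \<and> smooth g}" for h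
    using that differentiable_on_mult[OF smooth_differentiable smooth_differentiable] by blast
  show "dir_deriv b h \<in> lin_span {\<lambda>p. f p * g p |f g. smooth f \<and> smooth g}"
    if "h \<in> {\<lambda>p. f p * g p |f g. smooth f \<and> smooth g}" "b \<in> Basis" for h b
  proof -
    from that obtain f g where fg: "smooth f" "smooth g" and h: "h = (\<lambda>p. f p * g p)" by blast
    show ?thesis
      unfolding h dir_deriv_mult[OF smooth_differentiable smooth_differentiable, OF fg]
      using smooth_dir_deriv_Basis[OF fg(1) that(2)] smooth_dir_deriv_Basis[OF fg(2) that(2)] fg
      by (intro lin_span_add lin_span_base; blast)
  qed
qed

lemma dir_deriv_Basis_expand:
  assumes "f differentiable_on UNIV"
  shows "dir_deriv v f = (\<lambda>p. \<Sum>b\<in>Basis. of_real (v \<bullet> b) * dir_deriv b f p)"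
proof (rule ext)
  fix p
  interpret bounded_linear "\<lambda>v. dir_deriv v f p"
    using has_derivative_dir_deriv[OF assms] by (rule has_derivative_bounded_linear)
  have "dir_deriv (\<Sum>b\<in>Basis. (v \<bullet> b) *\<^sub>R b) f p = (\<Sum>b\<in>Basis. of_real (v \<bullet> b) * dir_deriv b f p)"
    by (simp add: sum scale scaleR_conv_of_real)
  then show "dir_deriv v f p = (\<Sum>b\<in>Basis. of_real (v \<bullet> b) * dir_deriv b f p)"
    by (simp add: euclidean_representation)
qed

lemma smooth_sum: "finite I \<Longrightarrow> (\<And>i. i \<in> I \<Longrightarrow> smooth (f i)) \<Longrightarrow> smooth (\<lambda>p. \<Sum>i\<in>I. f i p)"
  by (induction I rule: finite_induct) (auto intro: smooth_const smooth_add)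

lemma smooth_dir_deriv: assumes "smooth f" shows "smooth (dir_deriv v f)"
  by (subst dir_deriv_Basis_expand[OF smooth_differentiable[OF assms]])
     (intro smooth_sum smooth_cmult smooth_dir_deriv_Basis assms finite_Basis)

lemma smooth_iter_deriv: "smooth f \<Longrightarrow> smooth (iter_deriv w f)"
  by (induction w) (auto intro: smooth_dir_deriv)

lemma smooth_affine:
  assumes "smooth f" "bounded_linear L" shows "smooth (\<lambda>p. f (L p + c))"
proof (rule smooth_coinduct[where X="(\<lambda>g p. g (L p + c)) ` Collect smooth"])
  show "(\<lambda>p. f (L p + c)) \<in> lin_span ((\<lambda>g p. g (L p + c)) ` Collect smooth)"
    using assms(1) by (intro lin_span_base image_eqI) auto
  show "h differentiable_on UNIV" if "h \<in> (\<lambda>g p. g (L p + c)) ` Collect smooth" for h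
    using that differentiable_on_affine[OF smooth_differentiable assms(2)] by blast
  show "dir_deriv b h \<in> lin_span ((\<lambda>g p. g (L p + c)) ` Collect smooth)"
    if "h \<in> (\<lambda>g p. g (L p + c)) ` Collect smooth" for h b
  proof -
    from that obtain g where g: "smooth g" and h: "h = (\<lambda>p. g (L p + c))" by blast
    show ?thesis
      unfolding h dir_deriv_affine[OF smooth_differentiable[OF g] assms(2)]
      by (intro lin_span_base imageI CollectI smooth_dir_deriv g)
  qed
qed

lemma iter_deriv_affine:
  assumes "smooth f" "bounded_linear L"
  shows "iter_deriv w (\<lambda>p. f (L p + c)) = (\<lambda>p. iter_deriv (map L w) f (L p + c))"
  by (induction w)
     (auto simp: dir_deriv_affine[OF smooth_differentiable[OF smooth_iter_deriv[OF assms(1)]] assms(2)])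

lemma iter_deriv_add:
  "smooth f \<Longrightarrow> smooth g \<Longrightarrow> iter_deriv w (\<lambda>p. f p + g p) = (\<lambda>p. iter_deriv w f p + iter_deriv w g p)"
  by (induction w) (auto simp: dir_deriv_add smooth_differentiable smooth_iter_deriv)

lemma iter_deriv_cmult:
  "smooth f \<Longrightarrow> iter_deriv w (\<lambda>p. c * f p) = (\<lambda>p. c * iter_deriv w f p)"
  by (induction w) (auto simp: dir_deriv_cmult smooth_differentiable smooth_iter_deriv)

lemma iter_deriv_const: "iter_deriv w (\<lambda>_. c) = (\<lambda>_. if w = [] then c else 0)"
  by (induction w) auto

text \<open>Amplitude estimates, uniform in the family parameter \<open>q\<close>: besides the common weight \<open>W\<close>, every
  derivative in a direction \<open>e \<in> E\<close> contributes a factor \<open>\<kappa> e\<close>.\<close>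
definition uamp :: "'a set \<Rightarrow> ('a \<Rightarrow> 'q \<Rightarrow> 'a \<Rightarrow> real) \<Rightarrow> ('q \<Rightarrow> 'a \<Rightarrow> real) \<Rightarrow>
    ('q \<Rightarrow> 'a::euclidean_space \<Rightarrow> complex) \<Rightarrow> bool" where
  "uamp E \<kappa> W f \<longleftrightarrow> (\<forall>q. smooth (f q)) \<and>
     (\<forall>w. set w \<subseteq> E \<longrightarrow> (\<exists>C. \<forall>q p. cmod (iter_deriv w (f q) p)
        \<le> C * W q p * (\<Prod>e\<leftarrow>w. \<kappa> e q p)))"

section \<open>Algebra of amplitude families and change of directions\<close>

lemma uamp_smooth: "uamp E \<kappa> W f \<Longrightarrow> smooth (f q)"
  by (simp add: uamp_def)

lemma uampD: "uamp E \<kappa> W f \<Longrightarrow> set w \<subseteq> E \<Longrightarrow>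
   \<exists>C. \<forall>q p. cmod (iter_deriv w (f q) p) \<le> C * W q p * (\<Prod>e\<leftarrow>w. \<kappa> e q p)"
  by (simp add: uamp_def)

text \<open>Nonnegative weights allow the constant to be replaced by its absolute value; multiplying
  estimates requires this sign.\<close>

lemma uampD_nonneg:
  assumes "uamp E \<kappa> W f" "set w \<subseteq> E" "\<And>q p. 0 \<le> W q p" "\<And>e q p. 0 \<le> \<kappa> e q p"
  obtains C where "0 \<le> C" "\<And>q p. cmod (iter_deriv w (f q) p) \<le> C * W q p * (\<Prod>e\<leftarrow>w. \<kappa> e q p)"
proof -
  obtain C where C: "\<And>q p. cmod (iter_deriv w (f q) p) \<le> C * W q p * (\<Prod>e\<leftarrow>w. \<kappa> e q p)"
    using uampD[OF assms(1,2)] by auto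
  have "cmod (iter_deriv w (f q) p) \<le> \<bar>C\<bar> * W q p * (\<Prod>e\<leftarrow>w. \<kappa> e q p)" for q p
    by (rule order_trans[OF C]) (intro mult_right_mono assms prod_list_nonneg, auto simp: assms)
  then show ?thesis by (rule that[of "\<bar>C\<bar>", rotated]) simp
qed

text \<open>The gain of the first derivative taken becomes part of the weight, which is the form
  that inductions on the word of derivatives need.\<close>

lemma uamp_deriv:
  assumes "uamp E \<kappa> W f" "e \<in> E"
  shows "uamp E \<kappa> (\<lambda>q p. W q p * \<kappa> e q p) (\<lambda>q. dir_deriv e (f q))"
  unfolding uamp_def
proof (intro conjI allI impI)
  fix w assume "set w \<subseteq> E"
  \<comment> \<open>\<open>foldr\<close> applies the last letter first, so appending
    \<open>e\<close> differentiates in direction \<open>e\<close> before \<open>w\<close>.\<close>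
  then obtain C where "\<forall>q p. cmod (iter_deriv (w @ [e]) (f q) p) \<le> C * W q p * (\<Prod>e\<leftarrow>w @ [e]. \<kappa> e q p)"
    using uampD[OF assms(1), of "w @ [e]"] assms(2) by auto
  then show "\<exists>C. \<forall>q p. cmod (iter_deriv w (dir_deriv e (f q)) p)
      \<le> C * (W q p * \<kappa> e q p) * (\<Prod>e\<leftarrow>w. \<kappa> e q p)"
    by (auto simp: mult_ac)
qed (intro smooth_dir_deriv uamp_smooth[OF assms(1)])

lemma uamp_add:
  assumes "uamp E \<kappa> W f" "uamp E \<kappa> W g"
  shows "uamp E \<kappa> W (\<lambda>q p. f q p + g q p)"
  unfolding uamp_def
proof (intro conjI allI impI)
  fix w assume w: "set w \<subseteq> E"
  obtain C where C: "\<And>q p. cmod (iter_deriv w (f q) p) \<le> C * W q p * (\<Prod>e\<leftarrow>w. \<kappa> e q p)"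
    using uampD[OF assms(1) w] by auto
  obtain D where D: "\<And>q p. cmod (iter_deriv w (g q) p) \<le> D * W q p * (\<Prod>e\<leftarrow>w. \<kappa> e q p)"
    using uampD[OF assms(2) w] by auto
  have "cmod (iter_deriv w (\<lambda>p. f q p + g q p) p) \<le> (C + D) * W q p * (\<Prod>e\<leftarrow>w. \<kappa> e q p)" for q p
    using norm_triangle_le[OF add_mono[OF C[of q p] D[of q p]]] assms
    by (simp add: iter_deriv_add uamp_smooth algebra_simps)
  then show "\<exists>C. \<forall>q p. cmod (iter_deriv w (\<lambda>p. f q p + g q p) p) \<le> C * W q p * (\<Prod>e\<leftarrow>w. \<kappa> e q p)"
    by auto
qed (intro smooth_add uamp_smooth[OF assms(1)] uamp_smooth[OF assms(2)])

lemma uamp_scale: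
  assumes "uamp E \<kappa> W f"
  shows "uamp E \<kappa> (\<lambda>q p. cmod (c q) * W q p) (\<lambda>q p. c q * f q p)"
  unfolding uamp_def
proof (intro conjI allI impI)
  fix w assume w: "set w \<subseteq> E"
  obtain C where C: "\<And>q p. cmod (iter_deriv w (f q) p) \<le> C * W q p * (\<Prod>e\<leftarrow>w. \<kappa> e q p)"
    using uampD[OF assms(1) w] by auto
  have "cmod (iter_deriv w (\<lambda>p. c q * f q p) p) \<le> C * (cmod (c q) * W q p) * (\<Prod>e\<leftarrow>w. \<kappa> e q p)" for q p
    using mult_left_mono[OF C[of q p], of "cmod (c q)"] assms
    by (simp add: iter_deriv_cmult uamp_smooth norm_mult mult_ac)
  then show "\<exists>C. \<forall>q p. cmod (iter_deriv w (\<lambda>p. c q * f q p) p)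
      \<le> C * (cmod (c q) * W q p) * (\<Prod>e\<leftarrow>w. \<kappa> e q p)"
    by auto
qed (intro smooth_cmult uamp_smooth[OF assms(1)])

lemma uamp_cmult:
  assumes "uamp E \<kappa> W f"
  shows "uamp E \<kappa> W (\<lambda>q p. c * f q p)"
  unfolding uamp_def
proof (intro conjI allI impI)
  fix w assume w: "set w \<subseteq> E"
  obtain C where C: "\<And>q p. cmod (iter_deriv w (f q) p) \<le> C * W q p * (\<Prod>e\<leftarrow>w. \<kappa> e q p)"
    using uampD[OF assms(1) w] by auto
  have "cmod (iter_deriv w (\<lambda>p. c * f q p) p) \<le> (cmod c * C) * W q p * (\<Prod>e\<leftarrow>w. \<kappa> e q p)" for q p
    using mult_left_mono[OF C[of q p], of "cmod c"] assms
    by (simp add: iter_deriv_cmult uamp_smooth norm_mult mult_ac)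
  then show "\<exists>C. \<forall>q p. cmod (iter_deriv w (\<lambda>p. c * f q p) p) \<le> C * W q p * (\<Prod>e\<leftarrow>w. \<kappa> e q p)"
    by auto
qed (intro smooth_cmult uamp_smooth[OF assms(1)])

lemma uamp_zero: "uamp E \<kappa> W (\<lambda>_ _. 0)"
  unfolding uamp_def by (auto simp: iter_deriv_const smooth_const intro!: exI[of _ 0])

lemma uamp_sum:
  "finite I \<Longrightarrow> (\<And>i. i \<in> I \<Longrightarrow> uamp E \<kappa> W (f i)) \<Longrightarrow> uamp E \<kappa> W (\<lambda>q p. \<Sum>i\<in>I. f i q p)"
  by (induction I rule: finite_induct) (auto intro: uamp_zero uamp_add)

text \<open>Leibniz by induction from the innermost derivative: it multiplies the weight of exactly
  one factor by its gain, so both summands carry the same total weight. This is why the weights vary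
  in the induction.\<close>

lemma uamp_mult:
  assumes "uamp E \<kappa> W f" "uamp E \<kappa> V g"
  shows "uamp E \<kappa> (\<lambda>q p. W q p * V q p) (\<lambda>q p. f q p * g q p)"
  unfolding uamp_def
proof (intro conjI allI impI)
  fix w assume "set w \<subseteq> E"
  then show "\<exists>C. \<forall>q p. cmod (iter_deriv w (\<lambda>p. f q p * g q p) p)
      \<le> C * (W q p * V q p) * (\<Prod>e\<leftarrow>w. \<kappa> e q p)"
    using assms
  proof (induction w arbitrary: f g W V rule: rev_induct)
    case Nil
    obtain C where C: "\<And>q p. cmod (f q p) \<le> C * W q p" using uampD[OF Nil.prems(2), of "[]"] by auto
    obtain D where D: "\<And>q p. cmod (g q p) \<le> D * V q p" using uampD[OF Nil.prems(3), of "[]"] by auto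
    have "cmod (f q p * g q p) \<le> (C * D) * (W q p * V q p)" for q p
    proof -
      have "cmod (f q p) * cmod (g q p) \<le> (C * W q p) * (D * V q p)"
        by (intro mult_mono C D) (auto intro: order_trans[OF norm_ge_zero C])
      then show ?thesis by (simp add: norm_mult mult_ac)
    qed
    then show ?case by auto
  next
    case (snoc e w)
    have e: "e \<in> E" and w: "set w \<subseteq> E" using snoc.prems by auto
    obtain C where C: "\<And>q p. cmod (iter_deriv w (\<lambda>p. dir_deriv e (f q) p * g q p) p)
      \<le> C * (W q p * \<kappa> e q p * V q p) * (\<Prod>e\<leftarrow>w. \<kappa> e q p)"
      using snoc.IH[OF w uamp_deriv[OF snoc.prems(2) e] snoc.prems(3)] by auto
    obtain D where D: "\<And>q p. cmod (iter_deriv w (\<lambda>p. f q p * dir_deriv e (g q) p) p)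
      \<le> D * (W q p * (V q p * \<kappa> e q p)) * (\<Prod>e\<leftarrow>w. \<kappa> e q p)"
      using snoc.IH[OF w snoc.prems(2) uamp_deriv[OF snoc.prems(3) e]] by auto
    have sm: "smooth (f q)" "smooth (g q)" for q
      using uamp_smooth[OF snoc.prems(2)] uamp_smooth[OF snoc.prems(3)] by auto
    have "cmod (iter_deriv (w @ [e]) (\<lambda>p. f q p * g q p) p)
        \<le> (C + D) * (W q p * V q p) * (\<Prod>e\<leftarrow>w @ [e]. \<kappa> e q p)" for q p
      using norm_triangle_le[OF add_mono[OF C[of q p] D[of q p]]]
      by (simp add: dir_deriv_mult smooth_differentiable sm iter_deriv_add smooth_mult smooth_dir_deriv
          algebra_simps)
    then show ?case by blast
  qed
qed (intro smooth_mult uamp_smooth[OF assms(1)] uamp_smooth[OF assms(2)])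

lemma uamp_mono:
  assumes "uamp E \<kappa> W f" "\<And>q p. 0 \<le> W q p" "\<And>e q p. 0 \<le> \<kappa> e q p"
    and "\<And>q p. W q p \<le> B * V q p" "\<And>e q p. e \<in> E \<Longrightarrow> \<kappa> e q p \<le> \<mu> e q p"
  shows "uamp E \<mu> V f"
  unfolding uamp_def
proof (intro conjI allI impI)
  fix w assume w: "set w \<subseteq> E"
  obtain C where C: "0 \<le> C" "\<And>q p. cmod (iter_deriv w (f q) p) \<le> C * W q p * (\<Prod>e\<leftarrow>w. \<kappa> e q p)"
    by (rule uampD_nonneg[OF assms(1) w assms(2,3)]) blast
  have pr: "0 \<le> (\<Prod>e\<leftarrow>w. \<kappa> e q p) \<and> (\<Prod>e\<leftarrow>w. \<kappa> e q p) \<le> (\<Prod>e\<leftarrow>w. \<mu> e q p)" for q p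
    using w
  proof (induction w)
    case (Cons e w)
    then show ?case
      by (auto intro!: mult_mono mult_nonneg_nonneg assms(3,5) intro: order_trans[OF assms(3) assms(5)])
  qed auto
  have "cmod (iter_deriv w (f q) p) \<le> (C * B) * V q p * (\<Prod>e\<leftarrow>w. \<mu> e q p)" for q p
  proof -
    have "C * W q p * (\<Prod>e\<leftarrow>w. \<kappa> e q p) \<le> C * (B * V q p) * (\<Prod>e\<leftarrow>w. \<mu> e q p)"
      using C(1) pr assms(2,4) order_trans[OF assms(2) assms(4), of q p]
      by (intro mult_mono mult_nonneg_nonneg[of C]) auto
    then show ?thesis using C(2)[of q p] by (simp add: mult_ac)
  qed
  then show "\<exists>C. \<forall>q p. cmod (iter_deriv w (f q) p) \<le> C * V q p * (\<Prod>e\<leftarrow>w. \<mu> e q p)"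
    by blast
qed (rule uamp_smooth[OF assms(1)])

lemma uamp_reindex:
  "uamp E \<kappa> W f \<Longrightarrow> uamp E (\<lambda>e q. \<kappa> e (h q)) (\<lambda>q. W (h q)) (\<lambda>q. f (h q))"
  unfolding uamp_def by meson

abbreviation bamp :: "('q \<Rightarrow> 'a \<Rightarrow> real) \<Rightarrow> ('q \<Rightarrow> 'a::euclidean_space \<Rightarrow> complex) \<Rightarrow> bool" where
  "bamp \<equiv> uamp Basis (\<lambda>_ _ _. 1)"

abbreviation amp :: "('a \<Rightarrow> real) \<Rightarrow> ('a::euclidean_space \<Rightarrow> complex) \<Rightarrow> bool" where
  "amp W f \<equiv> bamp (\<lambda>_::unit. W) (\<lambda>_. f)"

lemma prod_list_map_one [simp]: "(\<Prod>e\<leftarrow>w. (1::real)) = 1"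
  by (induction w) auto

text \<open>With unit gains all directions are estimated alike, so linearity of the derivative in
  its direction carries the bound to the span. Unequal gains would not survive linear
  combinations.\<close>

lemma uamp_span:
  assumes "uamp E (\<lambda>_ _ _. 1) W f" "v \<in> span E"
  shows "uamp E (\<lambda>_ _ _. 1) W (\<lambda>q. dir_deriv v (f q))"
  using assms(2)
proof (induction rule: span_induct_alt)
  case base
  then show ?case using uamp_zero[of E "\<lambda>_ _ _. 1" W] by simp
next
  case (step c x y)
  have "uamp E (\<lambda>_ _ _. 1) W (\<lambda>q p. of_real c * dir_deriv x (f q) p + dir_deriv y (f q) p)"
    using uamp_deriv[OF assms(1) step(1)] by (intro uamp_add uamp_cmult step) simp
  then show ?case
    by (simp add: dir_deriv_lin smooth_differentiable uamp_smooth[OF assms(1)])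
qed

text \<open>Passes from the directions of a symbol class to coordinate directions, or from those to
  arbitrary vectors, once the gains have been discarded.\<close>

lemma uamp_change_directions:
  assumes "uamp E (\<lambda>_ _ _. 1) W f" "F \<subseteq> span E"
  shows "uamp F (\<lambda>_ _ _. 1) W f"
  unfolding uamp_def
proof (intro conjI allI impI)
  fix w assume "set w \<subseteq> F"
  then show "\<exists>C. \<forall>q p. cmod (iter_deriv w (f q) p) \<le> C * W q p * (\<Prod>e\<leftarrow>w. 1)"
    using assms(1)
  proof (induction w arbitrary: f rule: rev_induct)
    case Nil
    then show ?case using uampD[OF Nil(2), of "[]"] by simp
  next
    case (snoc v w)
    then have "\<exists>C. \<forall>q p. cmod (iter_deriv w (dir_deriv v (f q)) p) \<le> C * W q p * (\<Prod>e\<leftarrow>w. 1)"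
      using assms(2) by (intro snoc.IH uamp_span) auto
    then show ?case by simp
  qed
qed (rule uamp_smooth[OF assms(1)])

lemma bamp_word:
  assumes "bamp W f" shows "\<exists>C. \<forall>q p. cmod (iter_deriv w (f q) p) \<le> C * W q p"
  using uampD[OF uamp_change_directions[OF assms, of UNIV], of w] by simp

lemma bamp_word_nonneg:
  assumes "bamp W f" "\<And>q p. 0 \<le> W q p"
  obtains C where "0 \<le> C" "\<And>q p. cmod (iter_deriv w (f q) p) \<le> C * W q p"
  using uampD_nonneg[OF uamp_change_directions[OF assms(1), of UNIV], of w] assms(2) by auto

lemma bampI:
  assumes "\<And>q. smooth (f q)"
    and "\<And>w. set w \<subseteq> Basis \<Longrightarrow> \<exists>C. \<forall>q p. cmod (iter_deriv w (f q) p) \<le> C * W q p"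
  shows "bamp W f"
  using assms by (auto simp: uamp_def)

lemma bamp_dir_deriv: "bamp W f \<Longrightarrow> bamp W (\<lambda>q. dir_deriv v (f q))"
  by (rule uamp_span) auto

lemma bamp_iter_deriv: "bamp W f \<Longrightarrow> bamp W (\<lambda>q. iter_deriv w (f q))"
  by (induction w) (auto intro: bamp_dir_deriv)

lemma bamp_affine:
  assumes "bamp W f" "bounded_linear L"
  shows "bamp (\<lambda>q p. W q (L p + c q)) (\<lambda>q p. f q (L p + c q))"
proof (rule bampI)
  fix w :: "'c list" assume "set w \<subseteq> Basis"
  obtain C where "\<And>q p. cmod (iter_deriv (map L w) (f q) p) \<le> C * W q p"
    using bamp_word[OF assms(1)] by blast
  then show "\<exists>C. \<forall>q p. cmod (iter_deriv w (\<lambda>p. f q (L p + c q)) p) \<le> C * W q (L p + c q)"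
    using assms by (auto simp: iter_deriv_affine uamp_smooth)
qed (intro smooth_affine assms uamp_smooth[OF assms(1)])

lemma bamp_mono:
  assumes "bamp W f" "\<And>q p. 0 \<le> W q p" "\<And>q p. W q p \<le> B * V q p"
  shows "bamp V f"
  using assms by (intro uamp_mono[OF assms(1)]) auto

text \<open>Coinduction with a bound: a weight that controls every generator controls every
  combination up to a constant, and hence all derivatives.\<close>

lemma amp_coinduct:
  assumes f: "f \<in> lin_span X"
    and X: "\<And>g. g \<in> X \<Longrightarrow> g differentiable_on UNIV" "\<And>g. g \<in> X \<Longrightarrow> \<exists>C. \<forall>p. cmod (g p) \<le> C * W p"
    and D: "\<And>g b. g \<in> X \<Longrightarrow> b \<in> Basis \<Longrightarrow> dir_deriv b g \<in> lin_span X"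
  shows "amp W f"
proof (rule bampI)
  show "smooth f" by (rule smooth_coinduct[OF f X(1) D])
  fix w :: "'a list" assume w: "set w \<subseteq> Basis"
  have "iter_deriv w f differentiable_on UNIV \<and> (\<exists>C. \<forall>p. cmod (iter_deriv w f p) \<le> C * W p)"
  proof (rule iter_deriv_coinduct[where X=X and
      Q="\<lambda>g. g differentiable_on UNIV \<and> (\<exists>C. \<forall>p. cmod (g p) \<le> C * W p)", OF f w])
    fix c h g
    assume h: "h differentiable_on UNIV \<and> (\<exists>C. \<forall>p. cmod (h p) \<le> C * W p)"
       and g: "g differentiable_on UNIV \<and> (\<exists>C. \<forall>p. cmod (g p) \<le> C * W p)"
    obtain C D where C: "\<And>p. cmod (h p) \<le> C * W p" and D: "\<And>p. cmod (g p) \<le> D * W p"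
      using h g by blast
    have "cmod (c * h p + g p) \<le> (cmod c * C + D) * W p" for p
      using mult_left_mono[OF C[of p], of "cmod c"] D[of p] norm_triangle_ineq[of "c * h p" "g p"]
      by (simp add: norm_mult algebra_simps)
    then show "(\<lambda>p. c * h p + g p) differentiable_on UNIV
        \<and> (\<exists>C. \<forall>p. cmod (c * h p + g p) \<le> C * W p)"
      using h g by (auto intro!: derivative_intros)
  qed (auto intro: exI[of _ 0] X D)
  then show "\<exists>C. \<forall>q p. cmod (iter_deriv w f p) \<le> C * W p" by auto
qed

section \<open>Differentiation and integration by parts under the integral\<close>

lemma norm_integral_le:
  fixes f :: "'q \<Rightarrow> 'b::{banach, second_countable_topology}"
  assumes "integrable M f" "integrable M g" "\<And>q. norm (f q) \<le> g q"
  shows "norm (\<integral>q. f q \<partial>M) \<le> (\<integral>q. g q \<partial>M)"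
proof -
  have "(\<integral>q. norm (f q) \<partial>M) \<le> (\<integral>q. g q \<partial>M)"
    using assms by (intro integral_mono) auto
  with integral_norm_bound[of M f] show ?thesis by (rule order_trans)
qed

lemma norm_dir_deriv_le:
  fixes f :: "'a::euclidean_space \<Rightarrow> complex"
  assumes "f differentiable_on UNIV" "\<And>b. b \<in> Basis \<Longrightarrow> cmod (dir_deriv b f p) \<le> k"
  shows "cmod (dir_deriv v f p) \<le> (real DIM('a) * k) * norm v"
proof -
  have "cmod (dir_deriv v f p) \<le> (\<Sum>b\<in>(Basis::'a set). cmod (of_real (v \<bullet> b) * dir_deriv b f p))"
    by (subst dir_deriv_Basis_expand[OF assms(1)]) (rule norm_sum)
  also have "\<dots> \<le> (\<Sum>b\<in>(Basis::'a set). norm v * k)"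
    by (intro sum_mono) (auto simp: norm_mult intro!: mult_mono assms Basis_le_norm)
  finally show ?thesis by (simp add: mult_ac)
qed

text \<open>The mean value inequality on the ball bounds the normalized remainder by a multiple of
  the majorant, so dominated convergence along sequences gives the Frechet derivative of the
  integral.\<close>

lemma has_derivative_integral:
  fixes f :: "'q \<Rightarrow> 'a::euclidean_space \<Rightarrow> complex"
  assumes int: "\<And>p. integrable M (\<lambda>q. f q p)"
    and diff: "\<And>q. f q differentiable_on UNIV"
    and meas: "\<And>v. (\<lambda>q. dir_deriv v (f q) p0) \<in> borel_measurable M"
    and dom: "0 < r" "integrable M k"
      "\<And>q p b. p \<in> ball p0 r \<Longrightarrow> b \<in> Basis \<Longrightarrow> cmod (dir_deriv b (f q) p) \<le> k q"
  shows "((\<lambda>p. \<integral>q. f q p \<partial>M) has_derivative (\<lambda>v. \<integral>q. dir_deriv v (f q) p0 \<partial>M)) (at p0)"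
proof -
  \<comment> \<open>The dimension enters because only derivatives along basis vectors are
    dominated.\<close>
  define K where "K = real DIM('a)"
  have bd: "cmod (dir_deriv v (f q) p) \<le> (K * k q) * norm v" if "p \<in> ball p0 r" for v q p
    unfolding K_def by (intro norm_dir_deriv_le diff dom that)
  have k0: "0 \<le> k q" for q
    using dom(1) order_trans[OF norm_ge_zero dom(3)[of p0 "SOME b. b \<in> Basis" q]]
    by (auto simp: some_in_eq)
  have K0: "0 \<le> K" by (simp add: K_def)
  have intD: "integrable M (\<lambda>q. dir_deriv v (f q) p0)" for v
  proof (rule Bochner_Integration.integrable_bound[of _ "\<lambda>q. (K * k q) * norm v"])
    show "integrable M (\<lambda>q. (K * k q) * norm v)" using dom(2) by simp
    show "AE q in M. norm (dir_deriv v (f q) p0) \<le> norm ((K * k q) * norm v)"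
    proof (rule AE_I2)
      fix q show "norm (dir_deriv v (f q) p0) \<le> norm ((K * k q) * norm v)"
        using bd[of p0 v q] k0[of q] K0 dom(1) by simp
    qed
  qed (rule meas)
  have blin: "bounded_linear (\<lambda>v. dir_deriv v (f q) p0)" for q
    using has_derivative_dir_deriv[OF diff] by (rule has_derivative_bounded_linear)
  have lin: "bounded_linear (\<lambda>v. \<integral>q. dir_deriv v (f q) p0 \<partial>M)"
  proof (rule bounded_linear_intro)
    fix u v c
    show "(\<integral>q. dir_deriv (u + v) (f q) p0 \<partial>M) = (\<integral>q. dir_deriv u (f q) p0 \<partial>M) + (\<integral>q. dir_deriv v (f q) p0 \<partial>M)"
      by (simp add: linear_add[OF bounded_linear.linear[OF blin]] intD)
    show "(\<integral>q. dir_deriv (c *\<^sub>R u) (f q) p0 \<partial>M) = c *\<^sub>R (\<integral>q. dir_deriv u (f q) p0 \<partial>M)"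
      by (simp add: linear_scale[OF bounded_linear.linear[OF blin]])
    have "norm (\<integral>q. dir_deriv u (f q) p0 \<partial>M) \<le> (\<integral>q. (K * k q) * norm u \<partial>M)"
      using bd[of p0 u] dom(1,2) by (intro norm_integral_le intD) auto
    then show "norm (\<integral>q. dir_deriv u (f q) p0 \<partial>M) \<le> norm u * (K * (\<integral>q. k q \<partial>M))"
      by (simp add: mult_ac)
  qed
  have lim: "((\<lambda>y. norm (((\<integral>q. f q y \<partial>M) - (\<integral>q. f q p0 \<partial>M)) - (\<integral>q. dir_deriv (y - p0) (f q) p0 \<partial>M)) / norm (y - p0))
      \<longlongrightarrow> 0) (at p0)"
    unfolding tendsto_at_iff_sequentially
  proof (intro allI impI)
    fix X assume X: "\<forall>i. X i \<in> UNIV - {p0}" "X \<longlonglongrightarrow> p0"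
    obtain n0 where n0: "\<And>n. n \<ge> n0 \<Longrightarrow> dist (X n) p0 < r"
      using X(2) dom(1) unfolding lim_sequentially by blast
    \<comment> \<open>Only a tail of \<open>X\<close> is known to lie in the ball; shifting by
      \<open>n0\<close> makes the majorant valid for every index.\<close>
    define Y where "Y = (\<lambda>n. X (n + n0))"
    have Y: "Y \<longlonglongrightarrow> p0" "\<And>n. Y n \<noteq> p0" "\<And>n. Y n \<in> ball p0 r"
      using LIMSEQ_ignore_initial_segment[OF X(2), of n0] X(1) n0 by (auto simp: Y_def dist_commute)
    define g where "g n q = inverse (norm (Y n - p0)) *\<^sub>R (f q (Y n) - f q p0 - dir_deriv (Y n - p0) (f q) p0)" for n q
    have meas_f: "(\<lambda>q. f q p) \<in> borel_measurable M" for p using int by (rule borel_measurable_integrable)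
    have "(\<lambda>n. \<integral>q. g n q \<partial>M) \<longlonglongrightarrow> (\<integral>q. 0 \<partial>M)"
    proof (rule integral_dominated_convergence[where w="\<lambda>q. 2 * (K * k q)"])
      show "(\<lambda>q. g n q) \<in> borel_measurable M" for n
        unfolding g_def by (intro borel_measurable_scaleR borel_measurable_diff borel_measurable_const meas meas_f)
      show "integrable M (\<lambda>q. 2 * (K * k q))" using dom(2) by simp
      show "AE q in M. (\<lambda>n. g n q) \<longlonglongrightarrow> 0"
      proof (rule AE_I2)
        fix q
        have "((\<lambda>y. norm ((f q y - f q p0) - dir_deriv (y - p0) (f q) p0) / norm (y - p0)) \<longlongrightarrow> 0) (at p0)"
          using has_derivative_dir_deriv[OF diff, of q p0] unfolding has_derivative_iff_norm by simp
        from this[unfolded tendsto_at_iff_sequentially, rule_format, of Y] Y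
        have "(\<lambda>n. norm (g n q)) \<longlonglongrightarrow> 0" by (simp add: o_def g_def divide_inverse mult_ac)
        then show "(\<lambda>n. g n q) \<longlonglongrightarrow> 0" by (rule tendsto_norm_zero_cancel)
      qed
      show "AE q in M. norm (g n q) \<le> 2 * (K * k q)" for n
      proof (rule AE_I2)
        fix q
        have 1: "norm (f q (Y n) - f q p0) \<le> (K * k q) * norm (Y n - p0)"
        proof (rule differentiable_bound[OF convex_ball])
          show "(f q has_derivative (\<lambda>v. dir_deriv v (f q) x)) (at x within ball p0 r)" for x
            using has_derivative_dir_deriv[OF diff] by (rule has_derivative_at_withinI)
          show "onorm (\<lambda>v. dir_deriv v (f q) x) \<le> K * k q" if "x \<in> ball p0 r" for x
            using bd[OF that] K0 k0 by (intro onorm_bound) auto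
        qed (use Y dom(1) in auto)
        have 2: "norm (dir_deriv (Y n - p0) (f q) p0) \<le> (K * k q) * norm (Y n - p0)"
          using bd[of p0 "Y n - p0"] dom(1) by auto
        have "norm (f q (Y n) - f q p0 - dir_deriv (Y n - p0) (f q) p0) \<le> 2 * (K * k q) * norm (Y n - p0)"
          using norm_triangle_ineq4[of "f q (Y n) - f q p0" "dir_deriv (Y n - p0) (f q) p0"] 1 2 by simp
        then show "norm (g n q) \<le> 2 * (K * k q)"
          using Y(2)[of n] by (simp add: g_def divide_simps)
      qed
    qed simp
    then have "(\<lambda>n. norm (\<integral>q. g n q \<partial>M)) \<longlonglongrightarrow> 0" by (simp add: tendsto_norm_zero)
    moreover have "norm (\<integral>q. g n q \<partial>M) = norm (((\<integral>q. f q (Y n) \<partial>M) - (\<integral>q. f q p0 \<partial>M)) - (\<integral>q. dir_deriv (Y n - p0) (f q) p0 \<partial>M)) / norm (Y n - p0)" for n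
      unfolding g_def by (simp add: int intD divide_inverse mult_ac)
    ultimately show "((\<lambda>y. norm (((\<integral>q. f q y \<partial>M) - (\<integral>q. f q p0 \<partial>M)) - (\<integral>q. dir_deriv (y - p0) (f q) p0 \<partial>M)) / norm (y - p0)) \<circ> X) \<longlonglongrightarrow> 0"
      by (subst LIMSEQ_offset[where k=n0]) (simp_all add: o_def Y_def)
  qed
  show ?thesis unfolding has_derivative_iff_norm using lin lim by simp
qed

text \<open>A sequence of difference quotients suffices to recover the derivative. This gives its
  measurability in a parameter, and later the symmetry of mixed derivatives.\<close>

lemma dir_deriv_LIMSEQ:
  fixes f :: "'a::real_normed_vector \<Rightarrow> complex"
  assumes diff: "f differentiable_on UNIV"
  shows "(\<lambda>n. real (Suc n) *\<^sub>R (f (p + inverse (real (Suc n)) *\<^sub>R v) - f p)) \<longlonglongrightarrow> dir_deriv v f p"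
proof -
  define h where "h = (\<lambda>n. inverse (real (Suc n)))"
  have h: "h \<longlonglongrightarrow> 0" "\<And>n. h n \<noteq> 0"
    unfolding h_def by (rule LIMSEQ_inverse_real_of_nat) simp
  have "((\<lambda>t::real. p + t *\<^sub>R v) has_derivative (\<lambda>t. t *\<^sub>R v)) (at 0)"
    by (auto intro!: derivative_eq_intros)
  from has_derivative_compose[OF this, of f] has_derivative_dir_deriv[OF diff, of p]
  have "((\<lambda>t. f (p + t *\<^sub>R v)) has_derivative (\<lambda>t. dir_deriv (t *\<^sub>R v) f p)) (at 0)" by simp
  then have "((\<lambda>y. norm ((f (p + y *\<^sub>R v) - f p) - dir_deriv (y *\<^sub>R v) f p) / norm y) \<longlongrightarrow> 0) (at 0)"
    unfolding has_derivative_iff_norm by simp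
  from this[unfolded tendsto_at_iff_sequentially, rule_format, of h] h
  have *: "(\<lambda>n. norm ((f (p + h n *\<^sub>R v) - f p) - dir_deriv (h n *\<^sub>R v) f p) / norm (h n)) \<longlonglongrightarrow> 0"
    by (simp add: o_def)
  have "norm ((f (p + h n *\<^sub>R v) - f p) - dir_deriv (h n *\<^sub>R v) f p) / norm (h n)
    = norm (inverse (h n) *\<^sub>R (f (p + h n *\<^sub>R v) - f p) - dir_deriv v f p)" for n
  proof -
    have "dir_deriv (h n *\<^sub>R v) f p = h n *\<^sub>R dir_deriv v f p"
      by (rule linear_scale[OF bounded_linear.linear[OF has_derivative_bounded_linear[OF
        has_derivative_dir_deriv[OF diff]]]])
    then have "inverse (h n) *\<^sub>R (f (p + h n *\<^sub>R v) - f p) - dir_deriv v f p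
       = inverse (h n) *\<^sub>R ((f (p + h n *\<^sub>R v) - f p) - dir_deriv (h n *\<^sub>R v) f p)"
      using h(2)[of n] by (simp add: scaleR_diff_right)
    then show ?thesis by (simp only: norm_scaleR) (simp add: divide_inverse mult_ac)
  qed
  with * have "(\<lambda>n. inverse (h n) *\<^sub>R (f (p + h n *\<^sub>R v) - f p)) \<longlonglongrightarrow> dir_deriv v f p"
    by (simp add: LIM_zero_cancel tendsto_norm_zero_iff)
  then show ?thesis by (simp add: h_def)
qed

lemma measurable_dir_deriv:
  fixes f :: "'q \<Rightarrow> 'a::real_normed_vector \<Rightarrow> complex"
  assumes meas: "\<And>p. (\<lambda>q. f q p) \<in> borel_measurable M" and diff: "\<And>q. f q differentiable_on UNIV"
  shows "(\<lambda>q. dir_deriv v (f q) p) \<in> borel_measurable M"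
  by (rule borel_measurable_LIMSEQ_metric[OF _ dir_deriv_LIMSEQ[OF diff]])
     (intro borel_measurable_scaleR borel_measurable_diff borel_measurable_const meas)

text \<open>The radius and the majorant may depend on the point and on the derivative: domination
  near each point is all that differentiation under the integral needs, and the class is then stable
  under differentiation.\<close>

definition dominated_family :: "'q measure \<Rightarrow> ('q \<Rightarrow> 'a::euclidean_space \<Rightarrow> complex) \<Rightarrow> bool" where
  "dominated_family M f \<longleftrightarrow> (\<forall>q. smooth (f q)) \<and> (\<forall>p. (\<lambda>q. f q p) \<in> borel_measurable M) \<and>
    (\<forall>w p0. set w \<subseteq> Basis \<longrightarrow> (\<exists>r>0. \<exists>k. integrable M k \<and>
       (\<forall>q. \<forall>p\<in>ball p0 r. cmod (iter_deriv w (f q) p) \<le> k q)))"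

lemma dominated_family_integrable:
  assumes "dominated_family M f" shows "integrable M (\<lambda>q. f q p)"
proof -
  obtain r k where r: "r > 0" and k: "integrable M k" "\<And>q p'. p' \<in> ball p r \<Longrightarrow> cmod (f q p') \<le> k q"
    using assms unfolding dominated_family_def by (metis empty_subsetI foldr.simps(1) id_apply list.set(1))
  show ?thesis
  proof (rule Bochner_Integration.integrable_bound[OF k(1)])
    show "(\<lambda>q. f q p) \<in> borel_measurable M" using assms by (simp add: dominated_family_def)
    show "AE q in M. norm (f q p) \<le> norm (k q)"
    proof (rule AE_I2)
      fix q show "norm (f q p) \<le> norm (k q)" using k(2)[of p q] r by simp
    qed
  qed
qed

lemma dominated_family_add:
  fixes f :: "'q \<Rightarrow> 'a::euclidean_space \<Rightarrow> complex"
  assumes "dominated_family M f" "dominated_family M g"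
  shows "dominated_family M (\<lambda>q p. f q p + g q p)"
  unfolding dominated_family_def
proof (intro conjI allI impI)
  show "smooth (\<lambda>p. f q p + g q p)" for q
    using assms by (intro smooth_add) (auto simp: dominated_family_def)
  show "(\<lambda>q. f q p + g q p) \<in> borel_measurable M" for p
    using assms by (intro borel_measurable_add) (auto simp: dominated_family_def)
  fix w :: "'a list" and p0 :: 'a assume w: "set w \<subseteq> Basis"
  obtain r k where r: "r > 0" and k: "integrable M k" "\<And>q p. p \<in> ball p0 r \<Longrightarrow> cmod (iter_deriv w (f q) p) \<le> k q"
    using assms(1) w unfolding dominated_family_def by meson
  obtain s l where s: "s > 0" and l: "integrable M l" "\<And>q p. p \<in> ball p0 s \<Longrightarrow> cmod (iter_deriv w (g q) p) \<le> l q"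
    using assms(2) w unfolding dominated_family_def by meson
  have "cmod (iter_deriv w (\<lambda>p. f q p + g q p) p) \<le> k q + l q" if "p \<in> ball p0 (min r s)" for q p
    using norm_triangle_ineq[of "iter_deriv w (f q) p" "iter_deriv w (g q) p"] k(2)[of p q] l(2)[of p q] that assms
    by (simp add: iter_deriv_add dominated_family_def)
  then show "\<exists>r>0. \<exists>k. integrable M k \<and> (\<forall>q. \<forall>p\<in>ball p0 r. cmod (iter_deriv w (\<lambda>p. f q p + g q p) p) \<le> k q)"
    using r s k l by (intro exI[of _ "min r s"] conjI exI[of _ "\<lambda>q. k q + l q"]) auto
qed

lemma dominated_family_cmult:
  fixes f :: "'q \<Rightarrow> 'a::euclidean_space \<Rightarrow> complex"
  assumes "dominated_family M f"
  shows "dominated_family M (\<lambda>q p. c * f q p)"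
  unfolding dominated_family_def
proof (intro conjI allI impI)
  show "smooth (\<lambda>p. c * f q p)" for q
    using assms by (intro smooth_cmult) (auto simp: dominated_family_def)
  show "(\<lambda>q. c * f q p) \<in> borel_measurable M" for p
    using assms by (intro borel_measurable_times) (auto simp: dominated_family_def)
  fix w :: "'a list" and p0 :: 'a assume w: "set w \<subseteq> Basis"
  obtain r k where r: "r > 0" and k: "integrable M k" "\<And>q p. p \<in> ball p0 r \<Longrightarrow> cmod (iter_deriv w (f q) p) \<le> k q"
    using assms(1) w unfolding dominated_family_def by meson
  have "cmod (iter_deriv w (\<lambda>p. c * f q p) p) \<le> cmod c * k q" if "p \<in> ball p0 r" for q p
    using k(2)[OF that, of q] assms
    by (simp add: iter_deriv_cmult dominated_family_def norm_mult mult_left_mono)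
  then show "\<exists>r>0. \<exists>l. integrable M l \<and> (\<forall>q. \<forall>p\<in>ball p0 r. cmod (iter_deriv w (\<lambda>p. c * f q p) p) \<le> l q)"
    using r k by (intro exI[of _ r] conjI exI[of _ "\<lambda>q. cmod c * k q"]) auto
qed

lemma dominated_family_zero: "dominated_family M (\<lambda>_ _. 0)"
  unfolding dominated_family_def
  by (auto simp: smooth_const iter_deriv_const intro!: exI[of _ "1::real"] exI[of _ "\<lambda>_. 0::real"])

lemma dominated_family_sum:
  "finite I \<Longrightarrow> (\<And>i. i \<in> I \<Longrightarrow> dominated_family M (f i)) \<Longrightarrow> dominated_family M (\<lambda>q p. \<Sum>i\<in>I. f i q p)"
  by (induction I rule: finite_induct) (auto intro: dominated_family_zero dominated_family_add)

lemma dominated_family_dir_deriv: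
  fixes f :: "'q \<Rightarrow> 'a::euclidean_space \<Rightarrow> complex"
  assumes "dominated_family M f"
  shows "dominated_family M (\<lambda>q. dir_deriv v (f q))"
proof -
  have sm: "smooth (f q)" for q using assms by (simp add: dominated_family_def)
  have "dominated_family M (\<lambda>q. dir_deriv b (f q))" if b: "b \<in> Basis" for b
    unfolding dominated_family_def
  proof (intro conjI allI impI)
    show "smooth (dir_deriv b (f q))" for q by (rule smooth_dir_deriv[OF sm])
    show "(\<lambda>q. dir_deriv b (f q) p) \<in> borel_measurable M" for p
      using assms by (intro measurable_dir_deriv) (auto simp: dominated_family_def smooth_differentiable)
    fix w :: "'a list" and p0 :: 'a assume "set w \<subseteq> Basis"
    then have "set (w @ [b]) \<subseteq> Basis" using b by simp
    then have "\<exists>r>0. \<exists>k. integrable M k \<and> (\<forall>q. \<forall>p\<in>ball p0 r. cmod (iter_deriv (w @ [b]) (f q) p) \<le> k q)"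
      using assms unfolding dominated_family_def by blast
    then show "\<exists>r>0. \<exists>k. integrable M k \<and> (\<forall>q. \<forall>p\<in>ball p0 r. cmod (iter_deriv w (dir_deriv b (f q)) p) \<le> k q)"
      by simp
  qed
  then have "dominated_family M (\<lambda>q p. \<Sum>b\<in>Basis. of_real (v \<bullet> b) * dir_deriv b (f q) p)"
    by (intro dominated_family_sum dominated_family_cmult) auto
  then show ?thesis
    by (subst dir_deriv_Basis_expand[OF smooth_differentiable[OF sm]])
qed

lemma dominated_family_has_derivative:
  fixes f :: "'q \<Rightarrow> 'a::euclidean_space \<Rightarrow> complex"
  assumes "dominated_family M f"
  shows "((\<lambda>p. \<integral>q. f q p \<partial>M) has_derivative (\<lambda>v. \<integral>q. dir_deriv v (f q) p0 \<partial>M)) (at p0)"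
proof -
  have ex: "\<exists>r k. r > 0 \<and> integrable M k \<and> (\<forall>q. \<forall>p\<in>ball p0 r. cmod (dir_deriv b (f q) p) \<le> k q)"
    if "b \<in> Basis" for b
  proof -
    have "set [b] \<subseteq> Basis" using that by simp
    then have "\<exists>r>0. \<exists>k. integrable M k \<and> (\<forall>q. \<forall>p\<in>ball p0 r. cmod (iter_deriv [b] (f q) p) \<le> k q)"
      using assms unfolding dominated_family_def by blast
    then show ?thesis by auto
  qed
  then obtain r k where r: "\<And>b. b \<in> Basis \<Longrightarrow> r b > 0" and k: "\<And>b. b \<in> Basis \<Longrightarrow> integrable M (k b)"
    and bd: "\<And>b q p. b \<in> Basis \<Longrightarrow> p \<in> ball p0 (r b) \<Longrightarrow> cmod (dir_deriv b (f q) p) \<le> k b q"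
    by metis
  show ?thesis
  \<comment> \<open>There are finitely many basis directions, so the smallest radius and the sum of
    the majorants serve all of them.\<close>
  proof (rule has_derivative_integral[where r="Min (r ` Basis)" and k="\<lambda>q. \<Sum>b\<in>Basis. k b q"])
    show "0 < Min (r ` Basis)" using r by simp
    show "integrable M (\<lambda>q. \<Sum>b\<in>Basis. k b q)" using k by simp
    show "(\<lambda>q. dir_deriv v (f q) p0) \<in> borel_measurable M" for v
      using assms by (intro measurable_dir_deriv) (auto simp: dominated_family_def smooth_differentiable)
    fix q p and b :: 'a assume p: "p \<in> ball p0 (Min (r ` Basis))" and b: "b \<in> Basis"
    have pb: "p \<in> ball p0 (r b')" if "b' \<in> Basis" for b'
    proof -
      have "Min (r ` Basis) \<le> r b'" using that by simp
      then show ?thesis using p by (simp only: mem_ball)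
    qed
    have "k b q \<le> (\<Sum>b\<in>Basis. k b q)"
      using order_trans[OF norm_ge_zero bd[OF _ pb]] b by (intro member_le_sum) auto
    then show "cmod (dir_deriv b (f q) p) \<le> (\<Sum>b\<in>Basis. k b q)" using bd[OF b pb[OF b]] by (rule order_trans[rotated])
  qed (use assms in \<open>auto simp: dominated_family_def smooth_differentiable intro: dominated_family_integrable\<close>)
qed

lemma dir_deriv_integral:
  "dominated_family M f \<Longrightarrow> dir_deriv v (\<lambda>p. \<integral>q. f q p \<partial>M) = (\<lambda>p. \<integral>q. dir_deriv v (f q) p \<partial>M)"
  by (rule ext, rule dir_deriv_eq) (rule dominated_family_has_derivative)

lemma dominated_family_iter_deriv:
  "dominated_family M f \<Longrightarrow> dominated_family M (\<lambda>q. iter_deriv w (f q))"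
  by (induction w) (auto intro: dominated_family_dir_deriv)

lemma iter_deriv_integral:
  "dominated_family M f \<Longrightarrow> iter_deriv w (\<lambda>p. \<integral>q. f q p \<partial>M) = (\<lambda>p. \<integral>q. iter_deriv w (f q) p \<partial>M)"
  by (induction w) (auto simp: dir_deriv_integral dominated_family_iter_deriv)

lemma smooth_integral:
  assumes "dominated_family M f" shows "smooth (\<lambda>p. \<integral>q. f q p \<partial>M)"
  unfolding smooth_def iter_deriv_integral[OF assms]
proof (intro allI impI)
  fix w
  show "(\<lambda>p. \<integral>q. iter_deriv w (f q) p \<partial>M) differentiable_on UNIV"
    using dominated_family_has_derivative[OF dominated_family_iter_deriv[OF assms]]
    by (auto simp: differentiable_on_def differentiable_def)
qed

text \<open>The integral of the weight controls the integrated amplitude, while \<open>loc\<close>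
  dominates the weight near every point, so that derivatives pass under the integral.\<close>

lemma bamp_integral:
  fixes f :: "'q \<Rightarrow> 'a::euclidean_space \<Rightarrow> complex"
  assumes f: "bamp W f" and W0: "\<And>q p. 0 \<le> W q p" and meas: "\<And>p. (\<lambda>q. f q p) \<in> borel_measurable M"
    and W: "\<And>p. integrable M (\<lambda>q. W q p)" "\<And>p. (\<integral>q. W q p \<partial>M) \<le> B * V p"
    and loc: "\<And>p0. \<exists>r>0. \<exists>k. integrable M k \<and> (\<forall>q. \<forall>p\<in>ball p0 r. W q p \<le> k q)"
  shows "amp V (\<lambda>p. \<integral>q. f q p \<partial>M)" and "dominated_family M f"
proof -
  show dom: "dominated_family M f"
    unfolding dominated_family_def
  proof (intro conjI allI impI)
    fix w :: "'a list" and p0 :: 'a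
    obtain C where C: "0 \<le> C" "\<And>q p. cmod (iter_deriv w (f q) p) \<le> C * W q p"
      using bamp_word_nonneg[OF f W0] by blast
    obtain r k where r: "r > 0" and k: "integrable M k" "\<And>q p. p \<in> ball p0 r \<Longrightarrow> W q p \<le> k q"
      using loc[of p0] by blast
    have "cmod (iter_deriv w (f q) p) \<le> C * k q" if "p \<in> ball p0 r" for q p
      using C(2)[of q p] mult_left_mono[OF k(2)[OF that, of q] C(1)] by simp
    then show "\<exists>r>0. \<exists>k. integrable M k \<and> (\<forall>q. \<forall>p\<in>ball p0 r. cmod (iter_deriv w (f q) p) \<le> k q)"
      using r k(1) by (intro exI[of _ r] conjI exI[of _ "\<lambda>q. C * k q"]) auto
  qed (use meas uamp_smooth[OF f] in auto)
  show "amp V (\<lambda>p. \<integral>q. f q p \<partial>M)"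
  proof (rule bampI)
    fix w :: "'a list"
    obtain C where C: "0 \<le> C" "\<And>q p. cmod (iter_deriv w (f q) p) \<le> C * W q p"
      using bamp_word_nonneg[OF f W0] by blast
    have "cmod (iter_deriv w (\<lambda>p. \<integral>q. f q p \<partial>M) p) \<le> (C * B) * V p" for p
    proof -
      have "cmod (iter_deriv w (\<lambda>p. \<integral>q. f q p \<partial>M) p) \<le> (\<integral>q. C * W q p \<partial>M)"
        unfolding iter_deriv_integral[OF dom]
        using C(2) by (intro norm_integral_le dominated_family_integrable
            dominated_family_iter_deriv dom integrable_mult_right W(1)) auto
      also have "\<dots> \<le> C * (B * V p)" using mult_left_mono[OF W(2) C(1)] by simp
      finally show ?thesis by (simp add: mult_ac)
    qed
    then show "\<exists>C. \<forall>q p. cmod (iter_deriv w (\<lambda>p. \<integral>q. f q p \<partial>M) p) \<le> C * V p" by auto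
  qed (rule smooth_integral[OF dom])
qed

section \<open>Translation invariance, integration by parts and symmetry of mixed
  derivatives\<close>

lemma
  fixes f :: "'a::euclidean_space \<Rightarrow> 'b::{banach, second_countable_topology}"
  shows lborel_integral_translate: "(\<integral>p. f (p + c) \<partial>lborel) = (\<integral>p. f p \<partial>lborel)"
    and lborel_integrable_translate: "integrable lborel (\<lambda>p. f (p + c)) \<longleftrightarrow> integrable lborel f"
proof -
  have shift: "integrable lborel (\<lambda>p. g (c + p))" if "integrable lborel g" for g :: "'a \<Rightarrow> 'b" and c :: 'a
  proof -
    have "integrable (distr lborel borel ((+) c)) g" using that by (simp add: lborel_distr_plus)
    then show ?thesis by (rule integrable_distr[rotated]) simp
  qed
  show iff: "integrable lborel (\<lambda>p. f (p + c)) \<longleftrightarrow> integrable lborel f"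
    using shift[of f c] shift[of "\<lambda>p. f (p + c)" "- c"] by (auto simp: add.commute)
  show "(\<integral>p. f (p + c) \<partial>lborel) = (\<integral>p. f p \<partial>lborel)"
  proof (cases "integrable lborel f")
    case True
    have "(\<integral>p. f p \<partial>distr lborel borel ((+) c)) = (\<integral>p. f (c + p) \<partial>lborel)"
      using True by (intro integral_distr) auto
    then show ?thesis by (simp add: lborel_distr_plus add.commute)
  \<comment> \<open>Without integrability both integrals have the default value 0.\<close>
  qed (simp add: iff not_integrable_integral_eq)
qed

lemma indicator_scaleR: "indicator A t *\<^sub>R z = indicator A t * (z :: complex)"
  by (simp add: indicator_def)

lemma FTC_dir_deriv:
  fixes f :: "'a::euclidean_space \<Rightarrow> complex"
  assumes "smooth f"
  shows "(\<integral>t. indicator {0..1} t *\<^sub>R dir_deriv v f (p + t *\<^sub>R v) \<partial>lborel) = f (p + v) - f p"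
proof -
  have "(\<integral>t. indicator {0..1} t *\<^sub>R dir_deriv v f (p + t *\<^sub>R v) \<partial>lborel)
     = f (p + 1 *\<^sub>R v) - f (p + 0 *\<^sub>R v)"
  proof (rule integral_FTC_Icc)
    fix t :: real
    have "((\<lambda>t. p + t *\<^sub>R v) has_derivative (\<lambda>t. t *\<^sub>R v)) (at t within {0..1})"
      by (auto intro!: derivative_eq_intros)
    from has_derivative_compose[OF this smooth_has_derivative[OF assms]]
    have "((\<lambda>t. f (p + t *\<^sub>R v)) has_derivative (\<lambda>h. dir_deriv (h *\<^sub>R v) f (p + t *\<^sub>R v))) (at t within {0..1})" .
    moreover have "dir_deriv (h *\<^sub>R v) f (p + t *\<^sub>R v) = h *\<^sub>R dir_deriv v f (p + t *\<^sub>R v)" for h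
      by (rule linear_scale[OF bounded_linear.linear[OF has_derivative_bounded_linear[OF
            smooth_has_derivative[OF assms]]]])
    ultimately show "((\<lambda>t. f (p + t *\<^sub>R v)) has_vector_derivative dir_deriv v f (p + t *\<^sub>R v)) (at t within {0..1})"
      by (simp add: has_vector_derivative_def)
    show "continuous_on {0..1} (\<lambda>t. dir_deriv v f (p + t *\<^sub>R v))"
      by (rule continuous_on_compose2[OF smooth_continuous[OF smooth_dir_deriv[OF assms], of UNIV]])
         (auto intro!: continuous_intros)
  qed simp
  then show ?thesis by simp
qed

text \<open>The difference quotient over a unit step integrates to zero by translation invariance, and
  by the fundamental theorem of calculus it is an average of translates of the derivative.\<close>
lemma integral_dir_deriv_eq_0:
  fixes f :: "'a::euclidean_space \<Rightarrow> complex"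
  assumes f: "smooth f" and int: "integrable lborel f" "integrable lborel (dir_deriv v f)"
  shows "(\<integral>p. dir_deriv v f p \<partial>lborel) = 0"
proof -
  let ?G = "\<lambda>t p. indicator {0..1::real} t *\<^sub>R dir_deriv v f (p + t *\<^sub>R v)"
  have meas: "case_prod ?G \<in> borel_measurable (lborel \<Otimes>\<^sub>M lborel)"
  proof -
    have "(\<lambda>(t, p). dir_deriv v f (p + t *\<^sub>R v)) \<in> borel_measurable borel"
      unfolding split_beta
      by (intro borel_measurable_continuous_onI continuous_on_compose2[OF smooth_continuous[OF smooth_dir_deriv[OF f], of UNIV]])
         (auto intro!: continuous_intros)
    then have "(\<lambda>x. dir_deriv v f (snd x + fst x *\<^sub>R v)) \<in> borel_measurable (lborel \<Otimes>\<^sub>M lborel)"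
      unfolding lborel_prod by (simp add: split_beta')
    then show ?thesis unfolding split_beta
      by (intro borel_measurable_scaleR) auto
  qed
  have pint: "integrable (lborel \<Otimes>\<^sub>M lborel) (case_prod ?G)"
  proof (rule lborel_pair.Fubini_integrable[OF meas])
    have "(\<integral>p. norm (?G t p) \<partial>lborel) = indicator {0..1} t *\<^sub>R (\<integral>p. norm (dir_deriv v f p) \<partial>lborel)" for t
      using lborel_integral_translate[of "\<lambda>p. norm (dir_deriv v f p)" "t *\<^sub>R v"] by simp
    moreover have "integrable lborel (\<lambda>t::real. indicator {0..1} t *\<^sub>R (\<integral>p. norm (dir_deriv v f p) \<partial>lborel))"
      using borel_integrable_atLeastAtMost'[of 0 1 "\<lambda>_. \<integral>p. norm (dir_deriv v f p) \<partial>lborel"]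
      by (simp add: set_integrable_def)
    ultimately show "integrable lborel (\<lambda>t. \<integral>p. norm (case (t, p) of (t, p) \<Rightarrow> ?G t p) \<partial>lborel)"
      by (simp only: prod.case)
    show "AE t in lborel. integrable lborel (\<lambda>p. case (t, p) of (t, p) \<Rightarrow> ?G t p)"
      using int(2) by (intro AE_I2) (simp add: lborel_integrable_translate)
  qed
  have "0 = (\<integral>p. f (p + v) - f p \<partial>lborel)"
    using int by (simp add: lborel_integral_translate lborel_integrable_translate)
  also have "\<dots> = (\<integral>p. (\<integral>t. ?G t p \<partial>lborel) \<partial>lborel)"
    by (simp add: FTC_dir_deriv[OF f])
  also have "\<dots> = (\<integral>t. (\<integral>p. ?G t p \<partial>lborel) \<partial>lborel)"
    by (rule lborel_pair.Fubini_integral[OF pint])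
  also have "\<dots> = (\<integral>t. indicator {0..1::real} t *\<^sub>R (\<integral>p. dir_deriv v f p \<partial>lborel) \<partial>lborel)"
    using lborel_integral_translate[of "dir_deriv v f"] by simp
  also have "\<dots> = (\<integral>p. dir_deriv v f p \<partial>lborel)"
    using integral_FTC_Icc[of 0 1 "\<lambda>t. t *\<^sub>R (\<integral>p. dir_deriv v f p \<partial>lborel)" "\<lambda>_. \<integral>p. dir_deriv v f p \<partial>lborel"]
    by (auto intro!: derivative_eq_intros)
  finally show ?thesis by simp
qed

text \<open>The parameter effectively runs over a compact interval, so continuity on a compact ball
  replaces any growth condition on \<open>f\<close>.\<close>

lemma dominated_family_compact:
  fixes f :: "'a::euclidean_space \<Rightarrow> complex"
  assumes f: "smooth f"
  shows "dominated_family lborel (\<lambda>(t::real) p. indicator {0..1} t * f (p + t *\<^sub>R v))"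
  unfolding dominated_family_def
proof (intro conjI allI impI)
  have aff: "smooth (\<lambda>p. f (p + t *\<^sub>R v))" for t
    by (rule smooth_affine[OF f bounded_linear_ident])
  then show "smooth (\<lambda>p. indicator {0..1} t * f (p + t *\<^sub>R v))" for t by (rule smooth_cmult)
  show "(\<lambda>t. indicator {0..1} t * f (p + t *\<^sub>R v)) \<in> borel_measurable lborel" for p
  proof -
    have "(\<lambda>t. f (p + t *\<^sub>R v)) \<in> borel_measurable borel"
      by (intro borel_measurable_continuous_onI continuous_on_compose2[OF smooth_continuous[OF f, of UNIV]])
         (auto intro!: continuous_intros)
    then show ?thesis by measurable
  qed
  fix w :: "'a list" and p0 :: 'a
  \<comment> \<open>For \<open>p\<close> within distance 1 of \<open>p0\<close> and \<open>t\<close>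
    in the unit interval, p + t v stays in this ball.\<close>
  have "bounded (iter_deriv w f ` cball p0 (1 + norm v))"
    by (intro compact_imp_bounded compact_continuous_image smooth_continuous smooth_iter_deriv f) auto
  then obtain C where C: "\<And>p. p \<in> cball p0 (1 + norm v) \<Longrightarrow> cmod (iter_deriv w f p) \<le> C"
    unfolding bounded_iff by blast
  have C0: "0 \<le> C" using C[of p0] order_trans[OF norm_ge_zero] by (simp add: add_nonneg_nonneg)
  have "cmod (iter_deriv w (\<lambda>p. indicator {0..1} t * f (p + t *\<^sub>R v)) p) \<le> indicator {0..1} t *\<^sub>R C"
    if "p \<in> ball p0 1" for t p
  proof (cases "t \<in> {0..1}")
    case True
    have "dist p0 (p + t *\<^sub>R v) \<le> dist p0 p + dist p (p + t *\<^sub>R v)" by (rule dist_triangle)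
    also have "\<dots> \<le> 1 + norm v"
      using that True by (intro add_mono) (auto simp: dist_norm mult_left_le_one_le)
    finally show ?thesis using C[of "p + t *\<^sub>R v"] True
      by (simp add: iter_deriv_affine[OF f bounded_linear_ident])
  next
    case False
    then show ?thesis by (simp add: iter_deriv_const)
  qed
  moreover have "integrable lborel (\<lambda>t::real. indicator {0..1} t *\<^sub>R C)"
    using borel_integrable_atLeastAtMost'[of 0 1 "\<lambda>_. C"] by (simp add: set_integrable_def)
  ultimately show "\<exists>r>0. \<exists>k. integrable lborel k \<and> (\<forall>t. \<forall>p\<in>ball p0 r.
      cmod (iter_deriv w (\<lambda>p. indicator {0..1} t * f (p + t *\<^sub>R v)) p) \<le> k t)"
    by (intro exI[of _ "1::real"] conjI exI[of _ "\<lambda>t. indicator {0..1} t *\<^sub>R C"]) auto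
qed

lemma dir_deriv_scaleR:
  "f differentiable_on UNIV \<Longrightarrow> dir_deriv (a *\<^sub>R v) f = (\<lambda>p. of_real a * dir_deriv v f p)"
  using dir_deriv_lin[of f a v 0] by simp

text \<open>The increment of \<open>f\<close> along h v is h times the average of
  \<open>dir_deriv v f\<close> over the segment. Differentiating along \<open>u\<close> under the
  integral, dividing by h and letting h tend to 0 produces one order of differentiation on each
  side.\<close>

lemma dir_deriv_commute:
  fixes f :: "'a::euclidean_space \<Rightarrow> complex"
  assumes f: "smooth f"
  shows "dir_deriv u (dir_deriv v f) = dir_deriv v (dir_deriv u f)"
proof (rule ext)
  fix p
  define h where "h = (\<lambda>n. inverse (real (Suc n)))"
  have h: "h \<longlonglongrightarrow> 0" "\<And>n. h n \<noteq> 0"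
    unfolding h_def by (rule LIMSEQ_inverse_real_of_nat) simp
  have h1: "\<bar>h n\<bar> \<le> 1" for n by (simp add: h_def inverse_eq_divide)
  note D = smooth_dir_deriv[OF f]
  have eq: "real (Suc n) *\<^sub>R (dir_deriv u f (p + h n *\<^sub>R v) - dir_deriv u f p)
     = (\<integral>t. indicator {0..1} t * dir_deriv u (dir_deriv v f) (p + t *\<^sub>R (h n *\<^sub>R v)) \<partial>lborel)" for n
  proof -
    let ?w = "h n *\<^sub>R v"
    have sm: "smooth (\<lambda>q. f (q + ?w))" by (rule smooth_affine[OF f bounded_linear_ident])
    have "dir_deriv u f (p + ?w) - dir_deriv u f p = dir_deriv u (\<lambda>q. f (q + ?w) + (-1) * f q) p"
      using dir_deriv_affine[OF smooth_differentiable[OF f] bounded_linear_ident, of u ?w]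
        dir_deriv_cmult[OF smooth_differentiable[OF f], of u "-1"]
      by (subst dir_deriv_add[OF smooth_differentiable[OF sm] smooth_differentiable[OF smooth_cmult[OF f]]])
        (simp del: mult_minus1)
    also have "(\<lambda>q. f (q + ?w) + (-1) * f q)
        = (\<lambda>q. \<integral>t. indicator {0..1} t * dir_deriv ?w f (q + t *\<^sub>R ?w) \<partial>lborel)"
      using FTC_dir_deriv[OF f, of ?w] by (auto simp: indicator_scaleR)
    also have "dir_deriv u \<dots> p
        = (\<integral>t. dir_deriv u (\<lambda>q. indicator {0..1} t * dir_deriv ?w f (q + t *\<^sub>R ?w)) p \<partial>lborel)"
      by (subst dir_deriv_integral[OF dominated_family_compact[OF smooth_dir_deriv[OF f]]]) simp
    also have "\<dots> = (\<integral>t. of_real (h n) * (indicator {0..1} t * dir_deriv u (dir_deriv v f) (p + t *\<^sub>R ?w)) \<partial>lborel)"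
    proof (rule Bochner_Integration.integral_cong[OF refl])
      fix t :: real
      have "dir_deriv u (\<lambda>q. indicator {0..1} t * dir_deriv ?w f (q + t *\<^sub>R ?w)) p
        = indicator {0..1} t * dir_deriv u (dir_deriv ?w f) (p + t *\<^sub>R ?w)"
        using dir_deriv_affine[OF smooth_differentiable[OF smooth_dir_deriv[OF f]] bounded_linear_ident, of u ?w "t *\<^sub>R ?w"]
        by (subst dir_deriv_cmult)
           (auto intro!: smooth_differentiable smooth_affine[OF smooth_dir_deriv[OF f] bounded_linear_ident])
      then show "dir_deriv u (\<lambda>q. indicator {0..1} t * dir_deriv ?w f (q + t *\<^sub>R ?w)) p
        = of_real (h n) * (indicator {0..1} t * dir_deriv u (dir_deriv v f) (p + t *\<^sub>R ?w))"
        by (simp only: dir_deriv_scaleR[OF smooth_differentiable[OF f]]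
            dir_deriv_cmult[OF smooth_differentiable[OF D]]) (simp add: mult_ac)
    qed
    also have "\<dots> = of_real (h n) * (\<integral>t. indicator {0..1} t * dir_deriv u (dir_deriv v f) (p + t *\<^sub>R ?w) \<partial>lborel)"
      by (rule integral_mult_right_zero)
    finally have *: "dir_deriv u f (p + ?w) - dir_deriv u f p = \<dots>" .
    have "of_real (real (Suc n)) * of_real (h n) = (1::complex)"
      unfolding of_real_mult[symmetric] by (simp add: h_def)
    then show ?thesis unfolding * scaleR_conv_of_real mult.assoc[symmetric] by simp
  qed
  let ?g = "dir_deriv u (dir_deriv v f)"
  have cont: "continuous_on UNIV ?g" by (intro smooth_continuous smooth_dir_deriv f)
  have "bounded (?g ` cball p (norm v))"
    by (intro compact_imp_bounded compact_continuous_image continuous_on_subset[OF cont]) auto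
  then obtain C where C: "\<And>q. q \<in> cball p (norm v) \<Longrightarrow> cmod (?g q) \<le> C"
    unfolding bounded_iff by blast
  have "(\<lambda>n. \<integral>t. indicator {0..1} t * ?g (p + t *\<^sub>R (h n *\<^sub>R v)) \<partial>lborel)
      \<longlonglongrightarrow> (\<integral>t. indicator {0..1} t * ?g p \<partial>(lborel::real measure))"
  proof (rule integral_dominated_convergence[where w="\<lambda>t. indicator {0..1} t *\<^sub>R C"])
    show "(\<lambda>t::real. indicator {0..1} t * ?g p) \<in> borel_measurable lborel" by simp
    show "(\<lambda>t. indicator {0..1} t * ?g (p + t *\<^sub>R (h n *\<^sub>R v))) \<in> borel_measurable lborel" for n
    proof -
      have "(\<lambda>t. ?g (p + t *\<^sub>R (h n *\<^sub>R v))) \<in> borel_measurable borel"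
        by (intro borel_measurable_continuous_onI continuous_on_compose2[OF cont])
           (auto intro!: continuous_intros)
      then show ?thesis by measurable
    qed
    show "integrable lborel (\<lambda>t::real. indicator {0..1} t *\<^sub>R C)"
      using borel_integrable_atLeastAtMost'[of 0 1 "\<lambda>_. C"] by (simp add: set_integrable_def)
    show "AE t in lborel. (\<lambda>n. indicator {0..1} t * ?g (p + t *\<^sub>R (h n *\<^sub>R v))) \<longlonglongrightarrow> indicator {0..1} t * ?g p"
    proof (rule AE_I2)
      fix t :: real
      have "(\<lambda>n. p + t *\<^sub>R (h n *\<^sub>R v)) \<longlonglongrightarrow> p + t *\<^sub>R (0 *\<^sub>R v)" by (intro tendsto_intros h)
      then have "(\<lambda>n. ?g (p + t *\<^sub>R (h n *\<^sub>R v))) \<longlonglongrightarrow> ?g p"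
        by (intro continuous_on_tendsto_compose[OF cont]) auto
      then show "(\<lambda>n. indicator {0..1} t * ?g (p + t *\<^sub>R (h n *\<^sub>R v))) \<longlonglongrightarrow> indicator {0..1} t * ?g p"
        by (intro tendsto_intros)
    qed
    show "AE t in lborel. norm (indicator {0..1} t * ?g (p + t *\<^sub>R (h n *\<^sub>R v))) \<le> indicator {0..1} t *\<^sub>R C" for n
    proof (rule AE_I2)
      fix t :: real
      show "norm (indicator {0..1} t * ?g (p + t *\<^sub>R (h n *\<^sub>R v))) \<le> indicator {0..1} t *\<^sub>R C"
      proof (cases "t \<in> {0..1}")
        case True
        then have "\<bar>t\<bar> * (\<bar>h n\<bar> * norm v) \<le> 1 * (1 * norm v)"
          by (intro mult_mono h1) auto
        then show ?thesis using True C[of "p + t *\<^sub>R (h n *\<^sub>R v)"] by (simp add: dist_norm abs_mult mult.assoc)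
      qed auto
    qed
  qed
  moreover have "(\<integral>t. indicator {0..1} t * ?g p \<partial>(lborel::real measure)) = ?g p"
  proof -
    have "(\<integral>t. indicator {0..1::real} t *\<^sub>R ?g p \<partial>lborel) = 1 *\<^sub>R ?g p - 0 *\<^sub>R ?g p"
      by (rule integral_FTC_Icc) (auto intro!: derivative_eq_intros)
    then show ?thesis unfolding indicator_scaleR by simp
  qed
  moreover have "(\<lambda>n. real (Suc n) *\<^sub>R (dir_deriv u f (p + h n *\<^sub>R v) - dir_deriv u f p))
      \<longlonglongrightarrow> dir_deriv v (dir_deriv u f) p"
    unfolding h_def by (rule dir_deriv_LIMSEQ[OF smooth_differentiable[OF D]])
  ultimately show "?g p = dir_deriv v (dir_deriv u f) p"
    unfolding eq by (metis (no_types, lifting) LIMSEQ_unique)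
qed

lemma iter_deriv_dir_deriv_commute:
  "smooth f \<Longrightarrow> iter_deriv w (dir_deriv v f) = dir_deriv v (iter_deriv w f)"
  by (induction w) (auto simp: dir_deriv_commute smooth_iter_deriv)

section \<open>Integrable weights and iterated integrals\<close>

lemma integrable_weight:
  assumes n: "2 \<le> n"
  shows "integrable lborel (\<lambda>x::real. 1 / (1 + \<bar>x\<bar>) ^ n)"
proof (rule Bochner_Integration.integrable_bound[of _ "\<lambda>x::real. inverse (1 + x\<^sup>2)"])
  show "integrable lborel (\<lambda>x::real. inverse (1 + x\<^sup>2))"
    using integrable_inverse_1_plus_square by (simp add: set_integrable_def einterval_def)
  show "AE x::real in lborel. norm (1 / (1 + \<bar>x\<bar>) ^ n) \<le> norm (inverse (1 + x\<^sup>2))"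
  proof (rule AE_I2)
    fix x :: real
    have "1 + x\<^sup>2 \<le> (1 + \<bar>x\<bar>)\<^sup>2" by (simp add: power2_eq_square algebra_simps)
    also have "\<dots> \<le> (1 + \<bar>x\<bar>) ^ n" using n by (intro power_increasing) auto
    finally have "1 / (1 + \<bar>x\<bar>) ^ n \<le> 1 / (1 + x\<^sup>2)"
      by (intro divide_left_mono mult_pos_pos zero_less_power) (auto simp: add_pos_nonneg)
    then show "norm (1 / (1 + \<bar>x\<bar>) ^ n) \<le> norm (inverse (1 + x\<^sup>2))"
      by (simp add: divide_inverse add_nonneg_nonneg)
  qed
qed simp

lemma lborel_integral_fst_snd:
  fixes f :: "'a::euclidean_space \<times> 'b::euclidean_space \<Rightarrow> 'c::{banach, second_countable_topology}"
  assumes "integrable lborel f"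
  shows lborel_integral_fst: "(\<integral>p. f p \<partial>lborel) = (\<integral>x. (\<integral>y. f (x, y) \<partial>lborel) \<partial>lborel)"
    and lborel_integral_snd: "(\<integral>p. f p \<partial>lborel) = (\<integral>y. (\<integral>x. f (x, y) \<partial>lborel) \<partial>lborel)"
  using lborel_pair.integral_fst'[of f] lborel_pair.integral_snd[of "curry f"] assms
  by (simp_all add: lborel_prod)

lemma integrable_lborel_mult_prod:
  fixes f :: "'a::euclidean_space \<Rightarrow> real" and g :: "'b::euclidean_space \<Rightarrow> real"
  assumes "integrable lborel f" "integrable lborel g"
  shows "integrable lborel (\<lambda>p. f (fst p) * g (snd p))"
  unfolding lborel_prod[symmetric]
proof (rule lborel_pair.Fubini_integrable)
  show "(\<lambda>p. f (fst p) * g (snd p)) \<in> borel_measurable (lborel \<Otimes>\<^sub>M lborel)"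
    using assms[THEN borel_measurable_integrable] by measurable
qed (use assms in \<open>auto simp: abs_mult\<close>)

section \<open>Regularization of oscillatory integrals\<close>

lemma bamp_bound:
  assumes "bamp W f" "\<And>q p. 0 \<le> W q p"
  shows "\<exists>C\<ge>0. \<forall>q p. cmod (f q p) \<le> C * W q p"
  by (rule bamp_word_nonneg[OF assms, of "[]"]) auto

lemma smooth_linear:
  fixes L :: "'a::euclidean_space \<Rightarrow> complex"
  assumes "bounded_linear L" shows "smooth L"
proof (rule smooth_coinduct[where X="insert L (range (\<lambda>c _. c))"])
  have L: "(L has_derivative L) (at p)" for p
    using assms by (rule bounded_linear_imp_has_derivative)
  then have D: "dir_deriv b L = (\<lambda>_. L b)" for b by (intro ext dir_deriv_eq)
  show "g differentiable_on UNIV" if "g \<in> insert L (range (\<lambda>c _. c))" for g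
    using that L by (auto simp: differentiable_on_def differentiable_def intro: has_derivative_const)
  show "dir_deriv b g \<in> lin_span (insert L (range (\<lambda>c _. c)))"
    if "g \<in> insert L (range (\<lambda>c _. c))" for g b
    using that by (auto simp: D intro: lin_span_base lin_span.zero)
qed (simp add: lin_span_base)

lemma dir_deriv_linear: "bounded_linear L \<Longrightarrow> dir_deriv v L = (\<lambda>_. L v)"
  by (rule ext, rule dir_deriv_eq, rule bounded_linear_imp_has_derivative)

lemma smooth_of_real: "bounded_linear L \<Longrightarrow> smooth (\<lambda>p. complex_of_real (L p))"
  by (intro smooth_linear bounded_linear_compose[OF bounded_linear_of_real])

lemma dir_deriv_of_real:
  "bounded_linear L \<Longrightarrow> dir_deriv v (\<lambda>p. complex_of_real (L p)) = (\<lambda>_. complex_of_real (L v))"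
  by (intro dir_deriv_linear bounded_linear_compose[OF bounded_linear_of_real])

text \<open>Covers exponentials of smooth phases: the multiples of \<open>e\<close> by smooth
  functions are closed under differentiation, since each derivative of \<open>e\<close> is such a
  multiple.\<close>

lemma smooth_exponential_type:
  assumes e: "e differentiable_on UNIV"
    and D: "\<And>b. b \<in> Basis \<Longrightarrow> \<exists>m. smooth m \<and> dir_deriv b e = (\<lambda>p. m p * e p)"
  shows "smooth e"
proof (rule smooth_coinduct[where X="(\<lambda>m p. m p * e p) ` Collect smooth"])
  have "e \<in> (\<lambda>m p. m p * e p) ` Collect smooth"
    by (rule image_eqI[of _ _ "\<lambda>_. 1"]) (simp_all add: smooth_const)
  then show "e \<in> lin_span ((\<lambda>m p. m p * e p) ` Collect smooth)" by (rule lin_span_base)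
  show "g differentiable_on UNIV" if "g \<in> (\<lambda>m p. m p * e p) ` Collect smooth" for g
    using that differentiable_on_mult[OF smooth_differentiable e] by blast
  fix g b assume "g \<in> (\<lambda>m p. m p * e p) ` Collect smooth" and b: "b \<in> (Basis :: 'a set)"
  then obtain m where m: "smooth m" and g: "g = (\<lambda>p. m p * e p)" by blast
  obtain l where l: "smooth l" "dir_deriv b e = (\<lambda>p. l p * e p)" using D[OF b] by blast
  have "dir_deriv b g = (\<lambda>p. (dir_deriv b m p + m p * l p) * e p)"
    unfolding g dir_deriv_mult[OF smooth_differentiable[OF m] e] l by (simp add: algebra_simps)
  moreover have "smooth (\<lambda>p. dir_deriv b m p + m p * l p)"
    by (intro smooth_add smooth_mult smooth_dir_deriv m l)
  ultimately have "dir_deriv b g \<in> (\<lambda>m p. m p * e p) ` Collect smooth" by (intro image_eqI) auto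
  then show "dir_deriv b g \<in> lin_span ((\<lambda>m p. m p * e p) ` Collect smooth)" by (rule lin_span_base)
qed

text \<open>The reciprocal of 1 + i x rather than of 1 + |x|: it is smooth on the whole line, and it
  inverts the factor that a first-order operator produces on an exponential.\<close>

definition resolvent :: "real \<Rightarrow> complex" where
  "resolvent x = inverse (1 + \<i> * of_real x)"

lemma one_plus_i_neq_0: "1 + \<i> * complex_of_real x \<noteq> 0"
  by (simp add: complex_eq_iff)

lemma resolvent_mult: "resolvent x * (1 + \<i> * of_real x) = 1"
  using one_plus_i_neq_0[of x] by (simp add: resolvent_def)

lemma weight_le_one: "0 \<le> w \<Longrightarrow> 1 / (1 + \<bar>x\<bar>) * w \<le> (1::real) * w"
  by (intro mult_right_mono) (auto simp: field_simps)

lemma norm_resolvent_le: "cmod (resolvent x) \<le> 2 * (1 / (1 + \<bar>x\<bar>))"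
proof -
  have "1 \<le> cmod (1 + \<i> * of_real x)" "\<bar>x\<bar> \<le> cmod (1 + \<i> * of_real x)"
    using abs_Re_le_cmod[of "1 + \<i> * of_real x"] abs_Im_le_cmod[of "1 + \<i> * of_real x"] by auto
  then have "(1 + \<bar>x\<bar>) / 2 \<le> cmod (1 + \<i> * of_real x)" by simp
  then have "inverse (cmod (1 + \<i> * of_real x)) \<le> inverse ((1 + \<bar>x\<bar>) / 2)"
    by (rule le_imp_inverse_le) (simp add: add_pos_nonneg)
  moreover have "inverse ((1 + \<bar>x\<bar>) / 2) = 2 * (1 / (1 + \<bar>x\<bar>))" by (simp add: inverse_eq_divide)
  ultimately show ?thesis unfolding resolvent_def norm_inverse by (simp only:)
qed

text \<open>Derivatives of powers of the resolvent are multiples of higher powers, and these obey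
  the bound of the first power because the modulus is at most 1.\<close>

lemma amp_resolvent: "amp (\<lambda>x. 1 / (1 + \<bar>x\<bar>)) resolvent"
proof (rule amp_coinduct[where X="range (\<lambda>n x. resolvent x ^ Suc n)"])
  have "resolvent = (\<lambda>x. resolvent x ^ Suc 0)" by simp
  then show "resolvent \<in> lin_span (range (\<lambda>n x. resolvent x ^ Suc n))"
    by (intro lin_span_base) blast
  have r: "(resolvent has_derivative (\<lambda>h. - \<i> * of_real h * resolvent x ^ 2)) (at x)" for x
  proof -
    have "((\<lambda>x. 1 + \<i> * complex_of_real x) has_derivative (\<lambda>h. \<i> * of_real h)) (at x)"
      by (auto intro!: derivative_eq_intros)
    from Deriv.has_derivative_inverse[OF one_plus_i_neq_0 this]
    show ?thesis unfolding resolvent_def by (simp add: power2_eq_square mult_ac)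
  qed
  have D: "((\<lambda>x. resolvent x ^ Suc n) has_derivative (\<lambda>h. - \<i> * of_nat (Suc n) * of_real h * resolvent x ^ Suc (Suc n))) (at x)" for n x
    using has_derivative_power[OF r[of x], of "Suc n"] by (simp add: power2_eq_square mult_ac del: of_nat_Suc)
  show "g differentiable_on UNIV" if "g \<in> range (\<lambda>n x. resolvent x ^ Suc n)" for g
    using that D by (auto simp: differentiable_on_def differentiable_def)
  have "cmod (resolvent x ^ Suc n) \<le> 2 * (1 / (1 + \<bar>x\<bar>))" for n x
  proof -
    have "inverse (cmod (1 + \<i> * of_real x)) \<le> inverse 1"
      using abs_Re_le_cmod[of "1 + \<i> * of_real x"] by (intro le_imp_inverse_le) auto
    then have "cmod (resolvent x) ^ n \<le> 1"
      by (intro power_le_one) (auto simp: resolvent_def norm_inverse)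
    then have "cmod (resolvent x) * cmod (resolvent x) ^ n \<le> cmod (resolvent x) * 1"
      by (intro mult_left_mono) auto
    then show ?thesis using norm_resolvent_le[of x] by (simp add: norm_mult norm_power)
  qed
  then show "\<exists>C. \<forall>x. cmod (g x) \<le> C * (1 / (1 + \<bar>x\<bar>))" if "g \<in> range (\<lambda>n x. resolvent x ^ Suc n)" for g
    using that by blast
  fix g and b :: real assume "g \<in> range (\<lambda>n x. resolvent x ^ Suc n)"
  then obtain n where g: "g = (\<lambda>x. resolvent x ^ Suc n)" by blast
  have "dir_deriv b g = (\<lambda>x. (- \<i> * of_nat (Suc n) * of_real b) * resolvent x ^ Suc (Suc n))"
    unfolding g by (rule ext, rule dir_deriv_eq, rule D)
  then show "dir_deriv b g \<in> lin_span (range (\<lambda>n x. resolvent x ^ Suc n))"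
    by (simp only:, intro lin_span_cmult lin_span_base) blast
qed

lemma smooth_resolvent: "smooth resolvent"
  using uamp_smooth[OF amp_resolvent] .

definition osc_exp :: "real \<times> real \<Rightarrow> complex" where
  "osc_exp p = cis (- (fst p * snd p))"

lemma has_derivative_osc_exp:
  "(osc_exp has_derivative (\<lambda>v. - \<i> * of_real (fst p * snd v + snd p * fst v) * osc_exp p)) (at p)"
proof -
  have "((\<lambda>p. - \<i> * of_real (fst p * snd p)) has_derivative (\<lambda>v. - \<i> * of_real (fst p * snd v + snd p * fst v))) (at p)"
    by (auto intro!: derivative_eq_intros simp: fun_eq_iff algebra_simps)
  from has_derivative_compose[OF this DERIV_exp[unfolded has_field_derivative_def]]
  have "((\<lambda>p. exp (- \<i> * of_real (fst p * snd p))) has_derivative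
      (\<lambda>v. exp (- \<i> * of_real (fst p * snd p)) * (- \<i> * of_real (fst p * snd v + snd p * fst v)))) (at p)" .
  then show ?thesis
    unfolding osc_exp_def cis_conv_exp by (simp add: mult_ac)
qed

lemma dir_deriv_osc_exp:
  "dir_deriv v osc_exp = (\<lambda>p. (- \<i> * of_real (fst p * snd v + snd p * fst v)) * osc_exp p)"
  by (rule ext, rule dir_deriv_eq, rule has_derivative_osc_exp)

lemma smooth_osc_exp: "smooth osc_exp"
proof (rule smooth_exponential_type)
  show "osc_exp differentiable_on UNIV"
    using has_derivative_osc_exp by (auto simp: differentiable_on_def differentiable_def)
  fix b :: "real \<times> real"
  have "bounded_linear (\<lambda>p::real \<times> real. fst p * snd b + snd p * fst b)"
    by (intro bounded_linear_add bounded_linear_mult_const bounded_linear_fst bounded_linear_snd)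
  then have "smooth (\<lambda>p. - \<i> * of_real (fst p * snd b + snd p * fst b))"
    by (intro smooth_cmult smooth_of_real)
  then show "\<exists>m. smooth m \<and> dir_deriv b osc_exp = (\<lambda>p. m p * osc_exp p)"
    unfolding dir_deriv_osc_exp by blast
qed

lemma norm_osc_exp [simp]: "cmod (osc_exp p) = 1"
  by (simp add: osc_exp_def)

definition osc_int :: "(real \<times> real \<Rightarrow> complex) \<Rightarrow> complex" where
  "osc_int a = (\<integral>p. osc_exp p * a p \<partial>lborel)"

text \<open>2 is the smallest integer exponent that makes each factor, and hence the product,
  integrable.\<close>

definition int_weight :: "real \<times> real \<Rightarrow> real" where
  "int_weight p = 1 / (1 + \<bar>fst p\<bar>) ^ 2 * (1 / (1 + \<bar>snd p\<bar>) ^ 2)"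

lemma int_weight_nonneg: "0 \<le> int_weight p"
  by (simp add: int_weight_def)

lemma integrable_int_weight: "integrable lborel int_weight"
  unfolding int_weight_def[abs_def] by (intro integrable_lborel_mult_prod integrable_weight) auto

lemma amp_integrable:
  assumes "amp int_weight a" shows "integrable lborel (\<lambda>p. osc_exp p * a p)" "integrable lborel a"
proof -
  obtain C where C: "\<And>p. cmod (a p) \<le> C * int_weight p"
    using bamp_word[OF assms, of "[]"] by auto
  have sm: "smooth a" using uamp_smooth[OF assms] .
  have *: "integrable lborel (\<lambda>p. C * int_weight p)" using integrable_int_weight by simp
  show "integrable lborel a"
    by (rule Bochner_Integration.integrable_bound[OF *])
       (use C smooth_borel[OF sm] order_trans[OF C abs_ge_self] in auto)
  show "integrable lborel (\<lambda>p. osc_exp p * a p)"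
    by (rule Bochner_Integration.integrable_bound[OF *])
       (use C smooth_borel[OF smooth_mult[OF smooth_osc_exp sm]] order_trans[OF C abs_ge_self] in
        \<open>auto simp: norm_mult\<close>)
qed

text \<open>Since \<open>osc_exp\<close> is an eigenfunction of \<open>1 - dir_deriv v\<close> with eigenvalue \<open>1 + \<i> t\<close>,
  integration by parts replaces an amplitude \<open>a\<close> by \<open>osc_op v t a\<close>, which decays one order better in \<open>t\<close>.\<close>
definition osc_op :: "real \<times> real \<Rightarrow> (real \<times> real \<Rightarrow> real) \<Rightarrow> (real \<times> real \<Rightarrow> complex) \<Rightarrow> real \<times> real \<Rightarrow> complex" where
  "osc_op v t a p = resolvent (t p) * (a p + dir_deriv v a p)"

abbreviation "opA \<equiv> osc_op (1, 0) snd"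
abbreviation "opB \<equiv> osc_op (0, 1) fst"

lemma amp_resolvent_comp:
  "bounded_linear t \<Longrightarrow> amp (\<lambda>p. 1 / (1 + \<bar>t p\<bar>)) (\<lambda>p. resolvent (t p))"
  using bamp_affine[OF amp_resolvent, of t "\<lambda>_. 0"] by simp

lemma bamp_const_index: "amp W a \<Longrightarrow> bamp (\<lambda>_. W) (\<lambda>_. a)"
  using uamp_reindex[of Basis "\<lambda>_ _ _. 1" "\<lambda>_::unit. W" "\<lambda>_. a" "\<lambda>_. ()"] by simp

lemma bamp_osc_op:
  assumes "bamp W a" "bounded_linear t"
  shows "bamp (\<lambda>q p. 1 / (1 + \<bar>t p\<bar>) * W q p) (\<lambda>q. osc_op v t (a q))"
  unfolding osc_op_def[abs_def]
  by (intro uamp_mult[OF bamp_const_index[OF amp_resolvent_comp[OF assms(2)]]] uamp_add assms bamp_dir_deriv)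

text \<open>The difference of the two integrands is the derivative along \<open>v\<close> of
  \<open>osc_exp\<close> times the resolvent times \<open>a\<close>, and integrates to zero. The
  condition \<open>t v = 0\<close> keeps the resolvent constant along \<open>v\<close>.\<close>

lemma osc_int_osc_op:
  assumes a: "amp int_weight a" and t: "bounded_linear t" "t v = 0"
    and D: "dir_deriv v osc_exp = (\<lambda>p. (- \<i> * of_real (t p)) * osc_exp p)"
  shows "osc_int (osc_op v t a) = osc_int a"
proof -
  let ?r = "\<lambda>p. resolvent (t p)"
  have sm: "smooth a" "smooth ?r" "smooth (\<lambda>p. ?r p * a p)"
    using uamp_smooth[OF a] uamp_smooth[OF amp_resolvent_comp[OF t(1)]] by (auto intro: smooth_mult)
  have weak: "amp int_weight b" if "amp (\<lambda>p. 1 / (1 + \<bar>t p\<bar>) * int_weight p) b" for b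
    using that by (rule bamp_mono[where B=1])
      (auto intro!: weight_le_one mult_nonneg_nonneg simp only: int_weight_nonneg zero_le_divide_1_iff add_nonneg_nonneg zero_le_one abs_ge_zero)
  have rb: "amp int_weight (\<lambda>p. ?r p * b p)" if "amp int_weight b" for b
    by (rule weak, rule uamp_mult[OF amp_resolvent_comp[OF t(1)] that])
  have Dr: "dir_deriv v ?r = (\<lambda>_. 0)"
    using dir_deriv_affine[OF smooth_differentiable[OF smooth_resolvent] t(1), of v 0] t(2) by simp
  have H: "dir_deriv v (\<lambda>p. osc_exp p * (?r p * a p))
     = (\<lambda>p. osc_exp p * (osc_op v t a p) - osc_exp p * a p)"
  proof (rule ext)
    fix p
    have "- \<i> * of_real (t p) * ?r p = ?r p - 1"
      using resolvent_mult[of "t p"] by (simp add: algebra_simps)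
    then have "(- \<i> * of_real (t p)) * osc_exp p * (?r p * a p) = (?r p - 1) * osc_exp p * a p"
      by (metis (no_types, lifting) mult.assoc mult.commute)
    then show "dir_deriv v (\<lambda>p. osc_exp p * (?r p * a p)) p
       = osc_exp p * (osc_op v t a p) - osc_exp p * a p"
      by (simp add: dir_deriv_mult smooth_differentiable smooth_osc_exp sm D Dr osc_op_def algebra_simps)
  qed
  have int: "integrable lborel (\<lambda>p. osc_exp p * (osc_op v t a p))"
    by (intro amp_integrable weak bamp_osc_op a t)
  have "(\<integral>p. dir_deriv v (\<lambda>p. osc_exp p * (?r p * a p)) p \<partial>lborel) = 0"
    unfolding H using int amp_integrable[OF a] amp_integrable[OF rb[OF a]]
    by (subst integral_dir_deriv_eq_0[symmetric, of "\<lambda>p. osc_exp p * (?r p * a p)" v])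
       (auto simp: H intro!: smooth_mult smooth_osc_exp sm)
  then show ?thesis
    unfolding H osc_int_def using int amp_integrable[OF a] by simp
qed

lemma osc_int_opA: "amp int_weight a \<Longrightarrow> osc_int (opA a) = osc_int a"
  by (rule osc_int_osc_op) (auto simp: dir_deriv_osc_exp bounded_linear_snd)

lemma osc_int_opB: "amp int_weight a \<Longrightarrow> osc_int (opB a) = osc_int a"
  by (rule osc_int_osc_op) (auto simp: dir_deriv_osc_exp bounded_linear_fst)

lemma amp_int_weight_osc_op:
  assumes "amp int_weight a" "bounded_linear t"
  shows "amp int_weight (osc_op v t a)"
  by (rule bamp_mono[OF bamp_osc_op[OF assms], where B=1])
     (auto intro!: weight_le_one mult_nonneg_nonneg simp only: int_weight_nonneg zero_le_divide_1_iff add_nonneg_nonneg zero_le_one abs_ge_zero)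

lemma osc_int_ops:
  assumes "amp int_weight a"
  shows "osc_int ((opB ^^ J) ((opA ^^ M) a)) = osc_int a"
proof -
  have A: "amp int_weight ((opA ^^ M) a) \<and> osc_int ((opA ^^ M) a) = osc_int a"
    by (induction M) (auto simp: assms osc_int_opA amp_int_weight_osc_op bounded_linear_snd)
  have "amp int_weight ((opB ^^ J) ((opA ^^ M) a)) \<and>
     osc_int ((opB ^^ J) ((opA ^^ M) a)) = osc_int ((opA ^^ M) a)"
    by (induction J) (auto simp: A osc_int_opB amp_int_weight_osc_op bounded_linear_fst)
  with A show ?thesis by simp
qed

text \<open>Along the frequency, \<open>osc_exp\<close> differentiates to - i z times itself, so a
  factor z is i times a derivative of the exponential and moves onto the amplitude by parts.\<close>

lemma osc_int_mult_fst:
  assumes "amp int_weight a" "amp int_weight (\<lambda>p. of_real (fst p) * a p)"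
  shows "osc_int (\<lambda>p. of_real (fst p) * a p) = - \<i> * osc_int (dir_deriv (0, 1) a)"
proof -
  note sm = uamp_smooth[OF assms(1)]
  have H: "dir_deriv (0, 1) (\<lambda>p. osc_exp p * a p)
     = (\<lambda>p. osc_exp p * dir_deriv (0, 1) a p - \<i> * (osc_exp p * (of_real (fst p) * a p)))"
    by (simp add: fun_eq_iff dir_deriv_mult smooth_differentiable smooth_osc_exp sm dir_deriv_osc_exp)
  note int = amp_integrable(1)[OF assms(1)] amp_integrable(1)[OF assms(2)]
     amp_integrable(1)[OF bamp_dir_deriv[OF assms(1), of "(0, 1)"]]
  have "(\<integral>p. dir_deriv (0, 1) (\<lambda>p. osc_exp p * a p) p \<partial>lborel) = 0"
    using int by (intro integral_dir_deriv_eq_0 smooth_mult smooth_osc_exp sm) (auto simp: H)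
  then have "osc_int (dir_deriv (0, 1) a) = \<i> * osc_int (\<lambda>p. of_real (fst p) * a p)"
    unfolding H osc_int_def using int by simp
  then have "- \<i> * osc_int (dir_deriv (0, 1) a) = - (\<i> * \<i>) * osc_int (\<lambda>p. of_real (fst p) * a p)"
    by simp
  then show ?thesis by simp
qed

text \<open>Uniform bounds plus pointwise convergence of every derivative: the mode in which cutoffs
  tend to a constant. It survives \<open>osc_op\<close>, and after enough applications of it
  dominated convergence becomes available.\<close>

definition amp_conv :: "('a \<Rightarrow> real) \<Rightarrow> (nat \<Rightarrow> 'a::euclidean_space \<Rightarrow> complex) \<Rightarrow> ('a \<Rightarrow> complex) \<Rightarrow> bool" where
  "amp_conv W a b \<longleftrightarrow> bamp (\<lambda>_. W) a \<and> smooth b \<and>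
     (\<forall>w p. (\<lambda>n. iter_deriv w (a n) p) \<longlonglongrightarrow> iter_deriv w b p)"

lemma amp_conv_dir_deriv:
  assumes "amp_conv W a b" shows "amp_conv W (\<lambda>n. dir_deriv v (a n)) (dir_deriv v b)"
proof -
  have "(\<lambda>n. iter_deriv (w @ [v]) (a n) p) \<longlonglongrightarrow> iter_deriv (w @ [v]) b p" for w p
    using assms unfolding amp_conv_def by blast
  then show ?thesis
    using assms by (auto simp: amp_conv_def intro: smooth_dir_deriv bamp_dir_deriv)
qed

lemma amp_conv_add:
  assumes "amp_conv W a b" "amp_conv W c d"
  shows "amp_conv W (\<lambda>n p. a n p + c n p) (\<lambda>p. b p + d p)"
  using assms uamp_smooth[of Basis "\<lambda>_ _ _. 1" "\<lambda>_. W" a] uamp_smooth[of Basis "\<lambda>_ _ _. 1" "\<lambda>_. W" c]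
  by (auto simp: amp_conv_def iter_deriv_add intro!: smooth_add uamp_add tendsto_add)

lemma amp_conv_mult:
  assumes a: "amp_conv W a b" and r: "amp V r"
  shows "amp_conv (\<lambda>p. V p * W p) (\<lambda>n p. r p * a n p) (\<lambda>p. r p * b p)"
  unfolding amp_conv_def
proof (intro conjI allI)
  show "bamp (\<lambda>_ p. V p * W p) (\<lambda>n p. r p * a n p)"
    by (rule uamp_mult[OF bamp_const_index[OF r] a[unfolded amp_conv_def, THEN conjunct1]])
  show "smooth (\<lambda>p. r p * b p)"
    using a uamp_smooth[OF r] by (intro smooth_mult) (auto simp: amp_conv_def)
  fix w p
  show "(\<lambda>n. iter_deriv w (\<lambda>p. r p * a n p) p) \<longlonglongrightarrow> iter_deriv w (\<lambda>p. r p * b p) p"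
    using a r
  \<comment> \<open>The innermost derivative may fall on either factor, so all three functions vary
    in the induction.\<close>
  proof (induction w arbitrary: a b r rule: rev_induct)
    case Nil
    then have "(\<lambda>n. iter_deriv [] (a n) p) \<longlonglongrightarrow> iter_deriv [] b p" unfolding amp_conv_def by blast
    then show ?case by (auto intro: tendsto_intros)
  next
    case (snoc v w)
    have sa: "smooth (a n)" for n
      using snoc.prems(1) uamp_smooth[of Basis "\<lambda>_ _ _. 1" "\<lambda>_. W" a] by (auto simp: amp_conv_def)
    have sb: "smooth b" using snoc.prems(1) by (simp add: amp_conv_def)
    have sr: "smooth r" by (rule uamp_smooth[OF snoc.prems(2)])
    have "(\<lambda>n. iter_deriv w (\<lambda>p. dir_deriv v r p * a n p) p + iter_deriv w (\<lambda>p. r p * dir_deriv v (a n) p) p)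
      \<longlonglongrightarrow> iter_deriv w (\<lambda>p. dir_deriv v r p * b p) p + iter_deriv w (\<lambda>p. r p * dir_deriv v b p) p"
      by (intro tendsto_add snoc.IH snoc.prems amp_conv_dir_deriv bamp_dir_deriv)
    then show ?case
      by (simp add: dir_deriv_mult smooth_differentiable sa sb sr iter_deriv_add smooth_mult smooth_dir_deriv)
  qed
qed

lemma amp_conv_osc_op:
  assumes "amp_conv W a b" "bounded_linear t"
  shows "amp_conv (\<lambda>p. 1 / (1 + \<bar>t p\<bar>) * W p) (\<lambda>n. osc_op v t (a n)) (osc_op v t b)"
  unfolding osc_op_def[abs_def]
  by (intro amp_conv_mult amp_conv_add amp_conv_dir_deriv assms amp_resolvent_comp)

lemma amp_conv_ops:
  assumes "amp_conv W a b"
  shows "amp_conv (\<lambda>p. 1 / (1 + \<bar>fst p\<bar>) ^ J * (1 / (1 + \<bar>snd p\<bar>) ^ M * W p))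
    (\<lambda>n. (opB ^^ J) ((opA ^^ M) (a n))) ((opB ^^ J) ((opA ^^ M) b))"
proof -
  have A: "amp_conv (\<lambda>p. 1 / (1 + \<bar>snd p\<bar>) ^ M * W p) (\<lambda>n. (opA ^^ M) (a n)) ((opA ^^ M) b)"
  proof (induction M)
    case (Suc M)
    show ?case using amp_conv_osc_op[OF Suc bounded_linear_snd, of "(1, 0)"] by (simp add: mult_ac)
  qed (use assms in simp)
  show ?thesis
  proof (induction J)
    case (Suc J)
    show ?case using amp_conv_osc_op[OF Suc bounded_linear_fst, of "(0, 1)"] by (simp add: mult_ac)
  qed (use A in simp)
qed

text \<open>Each \<open>a n\<close> is integrable, so integrating by parts leaves its integral
  unchanged, while the regularized amplitudes share an integrable majorant. The margins of 2 in
  \<open>J\<close> and \<open>M\<close> beat the growth exponents \<open>k\<close> and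
  \<open>l\<close>.\<close>

lemma osc_int_tendsto:
  assumes conv: "amp_conv W a b" and a: "\<And>n. amp int_weight (a n)"
    and W: "\<And>p. 0 \<le> W p" "\<And>p. W p \<le> C * ((1 + \<bar>fst p\<bar>) ^ k * (1 + \<bar>snd p\<bar>) ^ l)"
    and JM: "k + 2 \<le> J" "l + 2 \<le> M"
  shows "(\<lambda>n. osc_int (a n)) \<longlonglongrightarrow> osc_int ((opB ^^ J) ((opA ^^ M) b))"
proof -
  let ?L = "\<lambda>a. (opB ^^ J) ((opA ^^ M) a)"
  let ?V = "\<lambda>p. 1 / (1 + \<bar>fst p\<bar>) ^ J * (1 / (1 + \<bar>snd p\<bar>) ^ M * W p)"
  note c = amp_conv_ops[OF conv, of J M]
  have pw: "x ^ k / x ^ J \<le> 1 / x ^ 2" if "1 \<le> x" "k + 2 \<le> J" for x :: real and k J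
  proof -
    have "x ^ (k + 2) \<le> x ^ J" using that by (intro power_increasing)
    then have "x ^ k * x ^ 2 \<le> x ^ J" by (simp only: power_add)
    then show ?thesis using that by (simp add: field_simps)
  qed
  have W': "?V p \<le> \<bar>C\<bar> * int_weight p" for p
  proof -
    have "?V p \<le> 1 / (1 + \<bar>fst p\<bar>) ^ J * (1 / (1 + \<bar>snd p\<bar>) ^ M * (\<bar>C\<bar> * ((1 + \<bar>fst p\<bar>) ^ k * (1 + \<bar>snd p\<bar>) ^ l)))"
      by (intro mult_left_mono order_trans[OF W(2)] mult_right_mono) auto
    also have "\<dots> = \<bar>C\<bar> * (((1 + \<bar>fst p\<bar>) ^ k / (1 + \<bar>fst p\<bar>) ^ J) * ((1 + \<bar>snd p\<bar>) ^ l / (1 + \<bar>snd p\<bar>) ^ M))"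
      by simp
    also have "\<dots> \<le> \<bar>C\<bar> * int_weight p"
      unfolding int_weight_def by (intro mult_left_mono mult_mono pw JM) auto
    finally show ?thesis .
  qed
  have V0: "0 \<le> ?V p" for p using W(1)[of p] by simp
  obtain D where D: "0 \<le> D" "\<forall>n p. cmod (?L (a n) p) \<le> D * ?V p"
    using bamp_bound[OF c[unfolded amp_conv_def, THEN conjunct1] V0] by blast
  have bound: "cmod (?L (a n) p) \<le> D * (\<bar>C\<bar> * int_weight p)" for n p
    by (rule order_trans[OF D(2)[rule_format]]) (intro mult_left_mono W' D(1))
  have "smooth (?L (a n))" for n using c uamp_smooth[of Basis "\<lambda>_ _ _. 1"] unfolding amp_conv_def by fast
  then have meas: "(\<lambda>p. osc_exp p * ?L (a n) p) \<in> borel_measurable lborel" for n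
    using smooth_borel[OF smooth_mult[OF smooth_osc_exp]] by simp
  have "smooth (?L b)" using c unfolding amp_conv_def by fast
  then have measb: "(\<lambda>p. osc_exp p * ?L b p) \<in> borel_measurable lborel"
    using smooth_borel[OF smooth_mult[OF smooth_osc_exp]] by simp
  have "(\<lambda>n. osc_int (?L (a n))) \<longlonglongrightarrow> osc_int (?L b)"
    unfolding osc_int_def
  proof (rule integral_dominated_convergence[OF measb meas])
    show "integrable lborel (\<lambda>p. D * (\<bar>C\<bar> * int_weight p))" using integrable_int_weight by simp
    show "AE p in lborel. (\<lambda>n. osc_exp p * ?L (a n) p) \<longlonglongrightarrow> osc_exp p * ?L b p"
    proof (rule AE_I2)
      fix p
      have "(\<lambda>n. iter_deriv [] (?L (a n)) p) \<longlonglongrightarrow> iter_deriv [] (?L b) p"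
        using c unfolding amp_conv_def by blast
      then show "(\<lambda>n. osc_exp p * ?L (a n) p) \<longlonglongrightarrow> osc_exp p * ?L b p" by (auto intro: tendsto_intros)
    qed
    show "AE p in lborel. norm (osc_exp p * ?L (a n) p) \<le> D * (\<bar>C\<bar> * int_weight p)" for n
      using bound by (simp add: norm_mult)
  qed
  then show ?thesis by (simp add: osc_int_ops[OF a])
qed

section \<open>Schwartz cutoffs\<close>

lemma schwartz_amp:
  assumes "\<phi> \<in> schwartz" shows "amp (\<lambda>p. 1 / (1 + norm p) ^ k) \<phi>"
proof (rule bampI)
  show "smooth \<phi>" using assms by (simp add: schwartz_def)
  fix w :: "'a list" assume "set w \<subseteq> Basis"
  then obtain C where C: "\<And>p. (1 + norm p) ^ k * cmod (iter_deriv w \<phi> p) \<le> C"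
    using assms unfolding schwartz_def by blast
  have "cmod (iter_deriv w \<phi> p) \<le> C * (1 / (1 + norm p) ^ k)" for p
  proof -
    have "0 < 1 + norm p" by (simp add: add_pos_nonneg)
    then show ?thesis using C[of p] by (simp add: field_simps)
  qed
  then show "\<exists>C. \<forall>q p. cmod (iter_deriv w \<phi> p) \<le> C * (1 / (1 + norm p) ^ k)" by blast
qed

lemma amp_schwartz:
  assumes "\<And>k. amp (\<lambda>p. 1 / (1 + norm p) ^ k) \<phi>" shows "\<phi> \<in> schwartz"
  unfolding schwartz_def
proof (intro CollectI conjI allI impI)
  show "smooth \<phi>" using uamp_smooth[OF assms] .
  fix w k
  obtain C where C: "\<And>p. cmod (iter_deriv w \<phi> p) \<le> C * (1 / (1 + norm p) ^ k)"
    using bamp_word[OF assms] by blast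
  have "(1 + norm p) ^ k * cmod (iter_deriv w \<phi> p) \<le> C" for p
  proof -
    have "0 < 1 + norm p" by (simp add: add_pos_nonneg)
    then show ?thesis using C[of p] by (simp add: field_simps)
  qed
  then show "\<exists>C. \<forall>p. (1 + norm p) ^ k * cmod (iter_deriv w \<phi> p) \<le> C" by blast
qed

lemma smooth_schwartz: "\<phi> \<in> schwartz \<Longrightarrow> smooth \<phi>"
  by (simp add: schwartz_def)

lemma iter_deriv_scaleR_word:
  "smooth f \<Longrightarrow> iter_deriv (map (scaleR c) w) f = (\<lambda>p. of_real c ^ length w * iter_deriv w f p)"
  by (induction w)
     (simp_all add: dir_deriv_cmult dir_deriv_scaleR smooth_differentiable smooth_iter_deriv
       smooth_cmult mult.assoc mult.left_commute)

text \<open>The shift by \<open>p0\<close> is needed because cutoffs are centred at the origin of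
  the original variables, while amplitudes are written in translated ones.\<close>

definition cutoff :: "('a::real_vector \<Rightarrow> complex) \<Rightarrow> real \<Rightarrow> 'a \<Rightarrow> 'a \<Rightarrow> complex" where
  "cutoff \<phi> \<epsilon> p0 p = \<phi> (\<epsilon> *\<^sub>R p + \<epsilon> *\<^sub>R p0)"

lemma iter_deriv_cutoff:
  "smooth \<phi> \<Longrightarrow> iter_deriv w (cutoff \<phi> \<epsilon> p0) = (\<lambda>p. of_real \<epsilon> ^ length w * iter_deriv w \<phi> (\<epsilon> *\<^sub>R p + \<epsilon> *\<^sub>R p0))"
  unfolding cutoff_def[abs_def]
  by (simp add: iter_deriv_affine[OF _ bounded_linear_scaleR_right] iter_deriv_scaleR_word)

lemma smooth_cutoff: "smooth \<phi> \<Longrightarrow> smooth (cutoff \<phi> \<epsilon> p0)"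
  unfolding cutoff_def[abs_def] by (rule smooth_affine[OF _ bounded_linear_scaleR_right])

text \<open>Every derivative of the cutoff brings a factor \<epsilon>: its boundedness gives uniform
  estimates, and its convergence to 0 kills all derivatives of positive order.\<close>

lemma amp_conv_cutoff:
  assumes \<phi>: "\<phi> \<in> schwartz" and \<epsilon>: "\<epsilon> \<longlonglongrightarrow> 0"
  shows "amp_conv (\<lambda>_. 1) (\<lambda>n. cutoff \<phi> (\<epsilon> n) p0) (\<lambda>_. \<phi> 0)"
  unfolding amp_conv_def
proof (intro conjI allI)
  note sm = smooth_schwartz[OF \<phi>]
  obtain K where K: "\<And>n. \<bar>\<epsilon> n\<bar> \<le> K"
    using Bseq_eq_bounded[of \<epsilon>] convergent_imp_Bseq[of \<epsilon>] \<epsilon> by (auto simp: convergent_def Bseq_def)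
  have bd: "\<exists>C. \<forall>p. cmod (iter_deriv w \<phi> p) \<le> C" for w
    using bamp_word[OF schwartz_amp[OF \<phi>, of 0], of w] by simp
  show "bamp (\<lambda>_ _. 1) (\<lambda>n. cutoff \<phi> (\<epsilon> n) p0)"
  proof (rule bampI)
    fix w :: "'a list"
    obtain C where C: "\<And>p. cmod (iter_deriv w \<phi> p) \<le> C" using bd by blast
    have "cmod (iter_deriv w (cutoff \<phi> (\<epsilon> n) p0) p) \<le> K ^ length w * C" for n p
      unfolding iter_deriv_cutoff[OF sm]
      by (auto simp: norm_mult norm_power intro!: mult_mono power_mono K C)
         (use K[of 0] in simp)
    then show "\<exists>C. \<forall>n p. cmod (iter_deriv w (cutoff \<phi> (\<epsilon> n) p0) p) \<le> C * 1" by auto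
  qed (rule smooth_cutoff[OF sm])
  show "smooth (\<lambda>_. \<phi> 0)" by (rule smooth_const)
  fix w and p :: 'a
  have lim: "(\<lambda>n. \<epsilon> n *\<^sub>R p + \<epsilon> n *\<^sub>R p0) \<longlonglongrightarrow> 0 *\<^sub>R p + 0 *\<^sub>R p0" by (intro tendsto_intros \<epsilon>)
  then have "(\<lambda>n. iter_deriv w \<phi> (\<epsilon> n *\<^sub>R p + \<epsilon> n *\<^sub>R p0)) \<longlonglongrightarrow> iter_deriv w \<phi> 0"
    by (intro continuous_on_tendsto_compose[OF smooth_continuous[OF smooth_iter_deriv[OF sm], of UNIV]]) auto
  then have "(\<lambda>n. of_real (\<epsilon> n) ^ length w * iter_deriv w \<phi> (\<epsilon> n *\<^sub>R p + \<epsilon> n *\<^sub>R p0))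
      \<longlonglongrightarrow> of_real 0 ^ length w * iter_deriv w \<phi> 0"
    by (intro tendsto_intros \<epsilon>)
  \<comment> \<open>For the empty word the factor is 0 ^ 0 = 1 and \<phi> 0 remains; otherwise both
    limits are 0.\<close>
  then show "(\<lambda>n. iter_deriv w (cutoff \<phi> (\<epsilon> n) p0) p) \<longlonglongrightarrow> iter_deriv w (\<lambda>_. \<phi> 0) p"
    unfolding iter_deriv_cutoff[OF sm] iter_deriv_const by (cases w) auto
qed

text \<open>For a fixed positive \<epsilon> the cutoff decays faster than any power, with constants
  that depend on \<epsilon>. This makes each cut-off integral absolutely convergent; the limit rests
  on \<open>amp_conv_cutoff\<close> instead.\<close>

lemma amp_cutoff:
  assumes \<phi>: "\<phi> \<in> schwartz" and \<epsilon>: "0 < \<epsilon>"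
  shows "amp (\<lambda>p. 1 / (1 + norm p) ^ k) (cutoff \<phi> \<epsilon> p0)"
proof -
  \<comment> \<open>The first factor pays for the translation by \<open>p0\<close>, the second for
    the scaling by \<epsilon>.\<close>
  define K where "K = (1 + norm p0) * (1 + 1 / \<epsilon>)"
  have K: "1 + norm p \<le> K * (1 + norm (\<epsilon> *\<^sub>R p + \<epsilon> *\<^sub>R p0))" for p
  proof -
    have "norm p \<le> norm (p + p0) + norm p0" using norm_triangle_ineq4[of "p + p0" p0] by simp
    then have "1 + norm p \<le> (1 + norm p0) * (1 + norm (p + p0))"
      using mult_nonneg_nonneg[OF norm_ge_zero[of p0] norm_ge_zero[of "p + p0"]]
      unfolding distrib_left distrib_right by linarith
    also have "1 + norm (p + p0) \<le> (1 + 1 / \<epsilon>) * (1 + \<epsilon> * norm (p + p0))"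
      using \<epsilon> by (simp add: field_simps add_increasing2)
    also have "\<epsilon> * norm (p + p0) = norm (\<epsilon> *\<^sub>R p + \<epsilon> *\<^sub>R p0)"
      using \<epsilon> by (simp flip: scaleR_add_right)
    finally show ?thesis by (simp add: K_def mult.assoc mult_left_mono)
  qed
  have K0: "0 < K" using \<epsilon> by (simp add: K_def add_pos_nonneg add_pos_pos)
  have "amp (\<lambda>p. 1 / (1 + norm (\<epsilon> *\<^sub>R p + \<epsilon> *\<^sub>R p0)) ^ k) (cutoff \<phi> \<epsilon> p0)"
    using bamp_affine[OF schwartz_amp[OF \<phi>, of k] bounded_linear_scaleR_right, of \<epsilon> "\<lambda>_. \<epsilon> *\<^sub>R p0"]
    by (simp add: cutoff_def[abs_def])
  then show ?thesis
  proof (rule bamp_mono[where B="K ^ k"])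
    fix p :: 'a
    have "(1 + norm p) ^ k \<le> K ^ k * (1 + norm (\<epsilon> *\<^sub>R p + \<epsilon> *\<^sub>R p0)) ^ k"
      unfolding power_mult_distrib[symmetric] by (intro power_mono K) simp
    moreover have "0 < 1 + norm p" "0 < 1 + norm (\<epsilon> *\<^sub>R p + \<epsilon> *\<^sub>R p0)" by (simp_all add: add_pos_nonneg)
    ultimately show "1 / (1 + norm (\<epsilon> *\<^sub>R p + \<epsilon> *\<^sub>R p0)) ^ k \<le> K ^ k * (1 / (1 + norm p) ^ k)"
      by (simp add: field_simps)
  qed simp
qed

section \<open>Limits of cut-off oscillatory integrals\<close>

definition poly_weight :: "nat \<Rightarrow> nat \<Rightarrow> real \<times> real \<Rightarrow> real" where
  "poly_weight k l p = (1 + \<bar>fst p\<bar>) ^ k * (1 + \<bar>snd p\<bar>) ^ l"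

lemma poly_weight_nonneg: "0 \<le> poly_weight k l p"
  by (simp add: poly_weight_def)

lemma poly_weight_mono: "k \<le> k' \<Longrightarrow> l \<le> l' \<Longrightarrow> poly_weight k l p \<le> poly_weight k' l' p"
  unfolding poly_weight_def by (intro mult_mono power_increasing) auto

lemma amp_cutoff_mult:
  assumes \<phi>: "\<phi> \<in> schwartz" and \<epsilon>: "0 < \<epsilon>" and a: "amp (poly_weight k l) a"
  shows "amp int_weight (\<lambda>p. a p * cutoff \<phi> \<epsilon> p0 p)"
\<comment> \<open>Decay of order k + 2 and l + 2 in the two variables is drawn from a single power
  of 1 + norm p, hence k + l + 4.\<close>
proof (rule bamp_mono[OF uamp_mult[OF a amp_cutoff[OF \<phi> \<epsilon>, of "k + l + 4"]], where B=1])
  fix p :: "real \<times> real"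
  have 1: "\<bar>fst p\<bar> \<le> norm p" "\<bar>snd p\<bar> \<le> norm p"
    using norm_fst_le[of "fst p" "snd p"] norm_snd_le[of "snd p" "fst p"] by auto
  have "poly_weight k l p * ((1 + \<bar>fst p\<bar>) ^ 2 * (1 + \<bar>snd p\<bar>) ^ 2)
      = (1 + \<bar>fst p\<bar>) ^ (k + 2) * (1 + \<bar>snd p\<bar>) ^ (l + 2)"
    by (simp add: poly_weight_def power_add power2_eq_square mult_ac)
  also have "\<dots> \<le> (1 + norm p) ^ (k + 2) * (1 + norm p) ^ (l + 2)"
    by (intro mult_mono power_mono add_left_mono 1) auto
  also have "\<dots> = (1 + norm p) ^ (k + l + 4)"
    unfolding power_add[symmetric] by (rule arg_cong[where f="power _"]) simp
  finally have "poly_weight k l p * ((1 + \<bar>fst p\<bar>) ^ 2 * (1 + \<bar>snd p\<bar>) ^ 2) \<le> (1 + norm p) ^ (k + l + 4)" .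
  moreover have "0 < (1 + \<bar>fst p\<bar>) ^ 2" "0 < (1 + \<bar>snd p\<bar>) ^ 2" "0 < (1 + norm p) ^ (k + l + 4)"
    by (simp_all add: add_pos_nonneg)
  ultimately show "poly_weight k l p * (1 / (1 + norm p) ^ (k + l + 4)) \<le> 1 * int_weight p"
    unfolding int_weight_def by (simp only: mult_1 times_divide_times_eq times_divide_eq_right
        mult_1_right divide_le_eq le_divide_eq zero_less_mult_iff) (auto simp: field_simps)
qed (simp add: poly_weight_nonneg)

text \<open>Independence of the cutoff and of its centre is built in, so the limit may be computed
  with a convenient cutoff. Sequences of \<epsilon> suit dominated convergence.\<close>

definition osc_lim :: "(real \<times> real \<Rightarrow> complex) \<Rightarrow> complex \<Rightarrow> bool" where
  "osc_lim a I \<longleftrightarrow> (\<forall>\<phi>\<in>schwartz. \<phi> 0 = 1 \<longrightarrow> (\<forall>p0 \<epsilon>. (\<forall>n. 0 < \<epsilon> n) \<longrightarrow> \<epsilon> \<longlonglongrightarrow> 0 \<longrightarrow>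
     (\<lambda>n. osc_int (\<lambda>p. a p * cutoff \<phi> (\<epsilon> n) p0 p)) \<longlonglongrightarrow> I))"

lemma osc_limD:
  "osc_lim a I \<Longrightarrow> \<phi> \<in> schwartz \<Longrightarrow> \<phi> 0 = 1 \<Longrightarrow> \<forall>n. 0 < \<epsilon> n \<Longrightarrow> \<epsilon> \<longlonglongrightarrow> 0 \<Longrightarrow>
     (\<lambda>n. osc_int (\<lambda>p. a p * cutoff \<phi> (\<epsilon> n) p0 p)) \<longlonglongrightarrow> I"
  unfolding osc_lim_def by blast

lemma amp_conv_cutoff_mult:
  assumes "\<phi> \<in> schwartz" "\<phi> 0 = 1" "\<epsilon> \<longlonglongrightarrow> 0" "amp W a"
  shows "amp_conv W (\<lambda>n p. a p * cutoff \<phi> (\<epsilon> n) p0 p) a"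
  using amp_conv_mult[OF amp_conv_cutoff[OF assms(1,3), of p0] assms(4)] assms(2) by simp

text \<open>The cut-off integrals do not involve \<open>J\<close> and \<open>M\<close>, so all
  admissible choices give the same regularized value. This is what later frees the choice of
  \<open>M\<close>.\<close>

lemma osc_limI:
  assumes a: "amp (poly_weight k l) a" and JM: "k + 2 \<le> J" "l + 2 \<le> M"
  shows "osc_lim a (osc_int ((opB ^^ J) ((opA ^^ M) a)))"
  unfolding osc_lim_def
proof (intro ballI impI allI)
  fix \<phi> :: "real \<times> real \<Rightarrow> complex" and p0 :: "real \<times> real" and \<epsilon> :: "nat \<Rightarrow> real"
  assume \<phi>: "\<phi> \<in> schwartz" "\<phi> 0 = 1" and \<epsilon>: "\<forall>n. 0 < \<epsilon> n" "\<epsilon> \<longlonglongrightarrow> 0"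
  show "(\<lambda>n. osc_int (\<lambda>p. a p * cutoff \<phi> (\<epsilon> n) p0 p)) \<longlonglongrightarrow> osc_int ((opB ^^ J) ((opA ^^ M) a))"
    by (rule osc_int_tendsto[OF amp_conv_cutoff_mult[OF \<phi> \<epsilon>(2) a] _ _ _ JM, where C=1])
       (use \<epsilon> in \<open>auto intro!: amp_cutoff_mult \<phi> a simp: poly_weight_def\<close>)
qed

lemma osc_lim_add:
  assumes "amp (poly_weight k l) a" "amp (poly_weight k' l') b" "osc_lim a I" "osc_lim b I'"
  shows "osc_lim (\<lambda>p. a p + b p) (I + I')"
  unfolding osc_lim_def
proof (intro ballI impI allI)
  fix \<phi> :: "real \<times> real \<Rightarrow> complex" and p0 :: "real \<times> real" and \<epsilon> :: "nat \<Rightarrow> real"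
  assume \<phi>: "\<phi> \<in> schwartz" "\<phi> 0 = 1" and \<epsilon>: "\<forall>n. 0 < \<epsilon> n" "\<epsilon> \<longlonglongrightarrow> 0"
  have "osc_int (\<lambda>p. (a p + b p) * cutoff \<phi> (\<epsilon> n) p0 p)
    = osc_int (\<lambda>p. a p * cutoff \<phi> (\<epsilon> n) p0 p) + osc_int (\<lambda>p. b p * cutoff \<phi> (\<epsilon> n) p0 p)" for n
    unfolding osc_int_def
    using amp_integrable(1)[OF amp_cutoff_mult[OF \<phi>(1) \<epsilon>(1)[rule_format] assms(1)], of n p0]
      amp_integrable(1)[OF amp_cutoff_mult[OF \<phi>(1) \<epsilon>(1)[rule_format] assms(2)], of n p0]
    by (simp add: algebra_simps)
  then show "(\<lambda>n. osc_int (\<lambda>p. (a p + b p) * cutoff \<phi> (\<epsilon> n) p0 p)) \<longlonglongrightarrow> I + I'"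
    by (simp only:) (intro tendsto_add osc_limD assms \<phi> \<epsilon>)
qed

lemma osc_lim_cmult:
  assumes "osc_lim a I" shows "osc_lim (\<lambda>p. c * a p) (c * I)"
  unfolding osc_lim_def
proof (intro ballI impI allI)
  fix \<phi> :: "real \<times> real \<Rightarrow> complex" and p0 :: "real \<times> real" and \<epsilon> :: "nat \<Rightarrow> real"
  assume \<phi>: "\<phi> \<in> schwartz" "\<phi> 0 = 1" and \<epsilon>: "\<forall>n. 0 < \<epsilon> n" "\<epsilon> \<longlonglongrightarrow> 0"
  have "osc_int (\<lambda>p. c * a p * cutoff \<phi> (\<epsilon> n) p0 p) = c * osc_int (\<lambda>p. a p * cutoff \<phi> (\<epsilon> n) p0 p)" for n
    unfolding osc_int_def by (simp add: mult.left_commute[of _ c] mult.assoc)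
  then show "(\<lambda>n. osc_int (\<lambda>p. c * a p * cutoff \<phi> (\<epsilon> n) p0 p)) \<longlonglongrightarrow> c * I"
    by (simp only:) (intro tendsto_mult tendsto_const osc_limD assms \<phi> \<epsilon>)
qed

lemma amp_of_real:
  assumes "bounded_linear L" shows "amp (\<lambda>p. 1 + \<bar>L p\<bar>) (\<lambda>p. complex_of_real (L p))"
proof (rule amp_coinduct[where X="insert (\<lambda>p. complex_of_real (L p)) (range (\<lambda>c _. c))"])
  have *: "cmod c \<le> cmod c * (1 + \<bar>L p\<bar>)" for c p
    using mult_left_mono[of 1 "1 + \<bar>L p\<bar>" "cmod c"] by simp
  show "\<exists>C. \<forall>p. cmod (g p) \<le> C * (1 + \<bar>L p\<bar>)"
    if "g \<in> insert (\<lambda>p. complex_of_real (L p)) (range (\<lambda>c _. c))" for g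
    using that
  proof
    assume "g = (\<lambda>p. complex_of_real (L p))"
    then show ?thesis by (intro exI[of _ 1]) auto
  next
    assume "g \<in> range (\<lambda>c _. c)"
    then show ?thesis using * by auto
  qed
  show "g differentiable_on UNIV" if "g \<in> insert (\<lambda>p. complex_of_real (L p)) (range (\<lambda>c _. c))" for g
    using that smooth_differentiable[OF smooth_of_real[OF assms]] smooth_differentiable[OF smooth_const]
    by blast
  show "dir_deriv b g \<in> lin_span (insert (\<lambda>p. complex_of_real (L p)) (range (\<lambda>c _. c)))"
    if "g \<in> insert (\<lambda>p. complex_of_real (L p)) (range (\<lambda>c _. c))" for g b
    using that by (auto simp: dir_deriv_of_real[OF assms] intro: lin_span_base lin_span.zero)
qed (simp add: lin_span_base)

lemma amp_fst_mult:
  assumes "amp (poly_weight k l) a"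
  shows "amp (poly_weight (Suc k) l) (\<lambda>p. of_real (fst p) * a p)"
  using uamp_mult[OF amp_of_real[OF bounded_linear_fst] assms]
  by (simp add: poly_weight_def[abs_def] mult_ac)

text \<open>The derivative that replaces the factor z also hits the cutoff. The derivative of the
  cut-off amplitude still converges to that of \<open>a\<close>, so the extra term disappears in the
  limit.\<close>

lemma osc_lim_fst_mult:
  assumes a: "amp (poly_weight k l) a" and I: "osc_lim (dir_deriv (0, 1) a) I"
  shows "osc_lim (\<lambda>p. of_real (fst p) * a p) (- \<i> * I)"
  unfolding osc_lim_def
proof (intro ballI impI allI)
  fix \<phi> :: "real \<times> real \<Rightarrow> complex" and p0 :: "real \<times> real" and \<epsilon> :: "nat \<Rightarrow> real"
  assume \<phi>: "\<phi> \<in> schwartz" "\<phi> 0 = 1" and \<epsilon>: "\<forall>n. 0 < \<epsilon> n" "\<epsilon> \<longlonglongrightarrow> 0"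
  let ?c = "\<lambda>n. cutoff \<phi> (\<epsilon> n) p0"
  let ?I = "osc_int ((opB ^^ (k + 2)) ((opA ^^ (l + 2)) (dir_deriv (0, 1) a)))"
  have Da: "amp (poly_weight k l) (dir_deriv (0, 1) a)" by (rule bamp_dir_deriv[OF a])
  have "(\<lambda>n. osc_int (\<lambda>p. dir_deriv (0, 1) a p * ?c n p)) \<longlonglongrightarrow> ?I"
    using osc_limI[OF Da order_refl order_refl] \<phi> \<epsilon> unfolding osc_lim_def by blast
  moreover have "(\<lambda>n. osc_int (\<lambda>p. dir_deriv (0, 1) a p * ?c n p)) \<longlonglongrightarrow> I"
    using I \<phi> \<epsilon> unfolding osc_lim_def by blast
  \<comment> \<open>Any value of the limit equals the regularized integral, which is the form in
    which the next limit is obtained.\<close>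
  ultimately have eq: "?I = I" by (rule LIMSEQ_unique)
  have "(\<lambda>n. osc_int (dir_deriv (0, 1) (\<lambda>p. a p * ?c n p))) \<longlonglongrightarrow> ?I"
    by (rule osc_int_tendsto[OF amp_conv_dir_deriv[OF amp_conv_cutoff_mult[OF \<phi> \<epsilon>(2) a]], where C=1])
       (use \<epsilon> in \<open>auto intro!: bamp_dir_deriv amp_cutoff_mult \<phi> a simp: poly_weight_def\<close>)
  then have "(\<lambda>n. - \<i> * osc_int (dir_deriv (0, 1) (\<lambda>p. a p * ?c n p))) \<longlonglongrightarrow> - \<i> * I"
    unfolding eq by (intro tendsto_intros)
  moreover have "osc_int (\<lambda>p. of_real (fst p) * a p * ?c n p) = - \<i> * osc_int (dir_deriv (0, 1) (\<lambda>p. a p * ?c n p))" for n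
    using osc_int_mult_fst[OF amp_cutoff_mult[OF \<phi>(1) \<epsilon>(1)[rule_format] a], of n p0]
      amp_cutoff_mult[OF \<phi>(1) \<epsilon>(1)[rule_format] amp_fst_mult[OF a], of n p0]
    by (simp add: mult.assoc)
  ultimately show "(\<lambda>n. osc_int (\<lambda>p. of_real (fst p) * a p * ?c n p)) \<longlonglongrightarrow> - \<i> * I" by simp
qed

lemma osc_lim_fst_power_mult:
  assumes "amp (poly_weight k l) a" "osc_lim ((dir_deriv (0, 1) ^^ N) a) I"
  shows "osc_lim (\<lambda>p. of_real (fst p) ^ N * a p) ((- \<i>) ^ N * I)"
  using assms
proof (induction N arbitrary: a k I)
  case (Suc N)
  have "amp (poly_weight k l) ((dir_deriv (0, 1) ^^ n) a)" for n
    by (induction n) (auto intro: Suc.prems bamp_dir_deriv)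
  have sm: "smooth a" by (rule uamp_smooth[OF Suc.prems(1)])
  have "osc_lim (\<lambda>p. of_real (fst p) ^ N * dir_deriv (0, 1) a p) ((- \<i>) ^ N * I)"
    using Suc.prems by (intro Suc.IH[of k] bamp_dir_deriv) (simp_all add: funpow_Suc_right del: funpow.simps)
  \<comment> \<open>Powers of the first variable commute with the derivative in the second, and each
    power raises the growth exponent by one.\<close>
  moreover have "dir_deriv (0, 1) (\<lambda>p. of_real (fst p) ^ n * a p) = (\<lambda>p. of_real (fst p) ^ n * dir_deriv (0, 1) a p) \<and>
      amp (poly_weight (k + n) l) (\<lambda>p. of_real (fst p) ^ n * a p)" for n
  proof (induction n)
    case (Suc n)
    have "dir_deriv (0, 1) (\<lambda>p. of_real (fst p) * (of_real (fst p) ^ n * a p))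
       = (\<lambda>p. of_real (fst p) * (of_real (fst p) ^ n * dir_deriv (0, 1) a p))"
      using Suc.IH uamp_smooth[OF Suc.IH[THEN conjunct2]]
      by (subst dir_deriv_mult)
         (auto intro!: smooth_differentiable smooth_of_real bounded_linear_fst simp: dir_deriv_of_real[OF bounded_linear_fst])
    then show ?case using amp_fst_mult[OF Suc.IH[THEN conjunct2]] by (simp add: mult.assoc)
  qed (simp add: Suc.prems)
  ultimately have "osc_lim (\<lambda>p. of_real (fst p) * (of_real (fst p) ^ N * a p)) (- \<i> * ((- \<i>) ^ N * I))"
    by (intro osc_lim_fst_mult[of "k + N"]) auto
  then show ?case by (simp add: mult.assoc)
qed simp

text \<open>From x \<le> exp x at x = (1 + r) / n comes (1 + r) ^ n \<le> n ^ n exp (1 + r), and (r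
  - 1)^2 \<ge> 0 gives 1 + r - r^2 / 2 \<le> 3 / 2.\<close>

lemma power_times_exp_le:
  assumes "0 \<le> r" shows "(1 + r) ^ n * exp (- r\<^sup>2 / 2) \<le> real n ^ n * exp (3 / 2)"
proof (cases "n = 0")
  \<comment> \<open>Here \<open>real n ^ n\<close> is 0 ^ 0 = 1.\<close>
  case True
  have "exp (- r\<^sup>2 / 2) \<le> exp (3 / 2)" using zero_le_power2[of r] by (subst exp_le_cancel_iff) linarith
  then show ?thesis using True by simp
next
  case False
  have "(1 + r) / n \<le> exp ((1 + r) / n)" using exp_ge_add_one_self[of "(1 + r) / n"] by linarith
  then have "((1 + r) / n) ^ n \<le> exp ((1 + r) / n) ^ n" using assms by (intro power_mono) auto
  also have "\<dots> = exp (1 + r)" using False by (simp flip: exp_of_nat_mult)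
  finally have "(1 + r) ^ n \<le> real n ^ n * exp (1 + r)"
    using False by (simp add: power_divide field_simps)
  then have "(1 + r) ^ n * exp (- r\<^sup>2 / 2) \<le> real n ^ n * exp (1 + r) * exp (- r\<^sup>2 / 2)"
    by (intro mult_right_mono) auto
  also have "\<dots> = real n ^ n * exp (1 + r + (- r\<^sup>2 / 2))" by (simp only: exp_add mult.assoc)
  also have "\<dots> \<le> real n ^ n * exp (3 / 2)"
  proof -
    have "0 \<le> (r - 1)\<^sup>2" by simp
    then have "1 + r + (- r\<^sup>2 / 2) \<le> 3 / 2" by (simp add: power2_eq_square algebra_simps)
    then show ?thesis by (intro mult_left_mono) auto
  qed
  finally show ?thesis .
qed

text \<open>A concrete cutoff with value 1 at the origin: it makes the values of oscillatory
  integrals unique and lets them be computed.\<close>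

definition gauss :: "real \<times> real \<Rightarrow> complex" where
  "gauss p = of_real (exp (- (norm p)\<^sup>2 / 2))"

lemma has_derivative_gauss:
  "(gauss has_derivative (\<lambda>v. - of_real (p \<bullet> v) * gauss p)) (at p)"
proof -
  have "((\<lambda>p. exp (- (p \<bullet> p) / 2)) has_derivative (\<lambda>v. (- (p \<bullet> v)) * exp (- (p \<bullet> p) / 2))) (at p)"
    by (auto intro!: derivative_eq_intros simp: fun_eq_iff inner_commute algebra_simps)
  from bounded_linear.has_derivative[OF bounded_linear_of_real this]
  have "((\<lambda>p. complex_of_real (exp (- (p \<bullet> p) / 2))) has_derivative
    (\<lambda>v. complex_of_real ((- (p \<bullet> v)) * exp (- (p \<bullet> p) / 2)))) (at p)" .
  then show ?thesis
    unfolding gauss_def power2_norm_eq_inner by simp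
qed

text \<open>Products of the Gaussian with amplitudes of polynomial growth are stable under
  differentiation, and the exponential absorbs every power.\<close>

lemma gauss_schwartz: "gauss \<in> schwartz"
proof (rule amp_schwartz)
  fix K
  let ?X = "{\<lambda>p. m p * gauss p |m. \<exists>k. amp (\<lambda>p::real \<times> real. (1 + norm p) ^ k) m}"
  have dg: "gauss differentiable_on UNIV"
    using has_derivative_gauss by (auto simp: differentiable_on_def differentiable_def)
  have Dg: "dir_deriv b gauss = (\<lambda>p. - of_real (p \<bullet> b) * gauss p)" for b
    by (rule ext, rule dir_deriv_eq, rule has_derivative_gauss)
  show "amp (\<lambda>p. 1 / (1 + norm p) ^ K) gauss"
  proof (rule amp_coinduct[where X="?X"])
    have "amp (\<lambda>p::real \<times> real. (1 + norm p) ^ 0) (\<lambda>_. 1)"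
      by (rule bampI) (auto simp: smooth_const iter_deriv_const intro!: exI[of _ 1])
    then have "gauss \<in> ?X" by (intro CollectI exI[of _ "\<lambda>_. 1"] conjI exI[of _ 0]) auto
    then show "gauss \<in> lin_span ?X" by (rule lin_span_base)
  next
    fix g assume "g \<in> ?X"
    then obtain m k where m: "amp (\<lambda>p. (1 + norm p) ^ k) m" and g: "g = (\<lambda>p. m p * gauss p)" by blast
    show "g differentiable_on UNIV"
      unfolding g by (intro differentiable_on_mult smooth_differentiable[OF uamp_smooth[OF m]] dg)
    obtain C where C: "C \<ge> 0" "\<And>p. cmod (m p) \<le> C * (1 + norm p) ^ k"
      using bamp_bound[OF m] by auto
    have "cmod (g p) \<le> (C * (real (k + K) ^ (k + K) * exp (3 / 2))) * (1 / (1 + norm p) ^ K)" for p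
    proof -
      have pos: "0 < (1 + norm p) ^ K" by (simp add: add_pos_nonneg)
      have "cmod (g p) * (1 + norm p) ^ K = cmod (m p) * exp (- (norm p)\<^sup>2 / 2) * (1 + norm p) ^ K"
        by (simp add: g norm_mult gauss_def)
      also have "\<dots> \<le> C * (1 + norm p) ^ k * exp (- (norm p)\<^sup>2 / 2) * (1 + norm p) ^ K"
        by (intro mult_right_mono C) auto
      also have "\<dots> = C * ((1 + norm p) ^ (k + K) * exp (- (norm p)\<^sup>2 / 2))"
        by (simp add: power_add mult_ac)
      also have "\<dots> \<le> C * (real (k + K) ^ (k + K) * exp (3 / 2))"
        by (intro mult_left_mono power_times_exp_le C) auto
      finally show ?thesis using pos by (simp add: field_simps)
    qed
    then show "\<exists>C. \<forall>p. cmod (g p) \<le> C * (1 / (1 + norm p) ^ K)" by blast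
    fix b :: "real \<times> real" assume b: "b \<in> Basis"
    have bl: "bounded_linear (\<lambda>p::real \<times> real. p \<bullet> b)" by (rule bounded_linear_inner_left)
    have pb: "amp (\<lambda>p. (1 + norm p) ^ 1) (\<lambda>p. complex_of_real (p \<bullet> b))"
    proof (rule bamp_mono[OF amp_of_real[OF bl], where B=1])
      show "1 + \<bar>p \<bullet> b\<bar> \<le> 1 * (1 + norm p) ^ 1" for p using Basis_le_norm[OF b, of p] by simp
    qed simp
    have "amp (\<lambda>p. (1 + norm p) ^ Suc k) (\<lambda>p. dir_deriv b m p + (- 1) * (m p * of_real (p \<bullet> b)))"
    proof (intro uamp_add uamp_cmult)
      show "amp (\<lambda>p. (1 + norm p) ^ Suc k) (dir_deriv b m)"
      proof (rule bamp_mono[OF bamp_dir_deriv[OF m], where B=1])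
        show "(1 + norm p) ^ k \<le> 1 * (1 + norm p) ^ Suc k" for p :: "real \<times> real"
          unfolding mult_1 by (intro power_increasing) auto
      qed (intro zero_le_power add_nonneg_nonneg zero_le_one norm_ge_zero)
      show "amp (\<lambda>p. (1 + norm p) ^ Suc k) (\<lambda>p. m p * of_real (p \<bullet> b))"
        using uamp_mult[OF m pb] by (simp add: mult_ac)
    qed
    then have "(\<lambda>p. (dir_deriv b m p + (- 1) * (m p * of_real (p \<bullet> b))) * gauss p) \<in> ?X"
      by (intro CollectI exI[of _ "\<lambda>p. dir_deriv b m p + (- 1) * (m p * of_real (p \<bullet> b))"] conjI
          exI[of _ "Suc k"]) simp_all
    moreover have "dir_deriv b g = (\<lambda>p. (dir_deriv b m p + (- 1) * (m p * of_real (p \<bullet> b))) * gauss p)"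
      unfolding g dir_deriv_mult[OF smooth_differentiable[OF uamp_smooth[OF m]] dg] Dg
      by (simp add: algebra_simps)
    ultimately show "dir_deriv b g \<in> lin_span ?X" by (simp add: lin_span_base)
  qed
qed

lemma gauss_0 [simp]: "gauss 0 = 1"
  by (simp add: gauss_def)

lemma amp_tensor:
  assumes u: "amp (\<lambda>x. (1 + \<bar>x\<bar>) ^ k) u" and v: "amp (\<lambda>x. (1 + \<bar>x\<bar>) ^ l) v"
  shows "amp (poly_weight k l) (\<lambda>p. u (fst p) * v (snd p))"
  using uamp_mult[OF bamp_affine[OF u bounded_linear_fst, of "\<lambda>_. 0"] bamp_affine[OF v bounded_linear_snd, of "\<lambda>_. 0"]]
  by (simp add: poly_weight_def[abs_def])

section \<open>Fourier inversion and the Taylor remainder\<close>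

abbreviation deriv1 :: "(real \<Rightarrow> complex) \<Rightarrow> real \<Rightarrow> complex" where
  "deriv1 \<equiv> dir_deriv 1"

lemma funpow_dir_deriv: "(dir_deriv v ^^ k) f = iter_deriv (replicate k v) f"
  by (induction k) auto

lemma smooth_funpow_dir_deriv: "smooth f \<Longrightarrow> smooth ((dir_deriv v ^^ k) f)"
  unfolding funpow_dir_deriv by (rule smooth_iter_deriv)

lemma bamp_funpow_dir_deriv: "bamp W f \<Longrightarrow> bamp W (\<lambda>q. (dir_deriv v ^^ k) (f q))"
  unfolding funpow_dir_deriv by (rule bamp_iter_deriv)

lemma amp_snd: "amp (\<lambda>x. (1 + \<bar>x\<bar>) ^ l) v \<Longrightarrow> amp (poly_weight 0 l) (\<lambda>p. v (snd p))"
  using bamp_affine[OF _ bounded_linear_snd, of "\<lambda>_ x. (1 + \<bar>x\<bar>) ^ l" "\<lambda>_. v" "\<lambda>_. 0"]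
  by (simp add: poly_weight_def[abs_def])

text \<open>Read off from the characteristic function of the standard normal distribution, after
  removing its normalization.\<close>

lemma gauss_integral:
  "(\<integral>x. cis (- (x * w)) * of_real (exp (- x\<^sup>2 / 2)) \<partial>lborel) = of_real (sqrt (2 * pi) * exp (- w\<^sup>2 / 2))"
proof -
  have "char std_normal_distribution (- w) = (\<integral>x. std_normal_density x *\<^sub>R iexp (- w * x) \<partial>lborel)"
    unfolding char_def by (subst integral_density) auto
  also have "\<dots> = (\<integral>x. of_real (1 / sqrt (2 * pi)) * (cis (- (x * w)) * of_real (exp (- x\<^sup>2 / 2))) \<partial>lborel)"
    by (rule Bochner_Integration.integral_cong)
       (auto simp: std_normal_density_def scaleR_conv_of_real cis_conv_exp mult_ac)
  also have "\<dots> = of_real (1 / sqrt (2 * pi)) * (\<integral>x. cis (- (x * w)) * of_real (exp (- x\<^sup>2 / 2)) \<partial>lborel)"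
    by (rule integral_mult_right_zero)
  finally have "of_real (exp (- w\<^sup>2 / 2)) = of_real (1 / sqrt (2 * pi)) * (\<integral>x. cis (- (x * w)) * of_real (exp (- x\<^sup>2 / 2)) \<partial>lborel)"
    by (simp add: char_std_normal_distribution)
  then have "of_real (sqrt (2 * pi)) * complex_of_real (exp (- w\<^sup>2 / 2))
    = (of_real (sqrt (2 * pi)) * of_real (1 / sqrt (2 * pi))) * (\<integral>x. cis (- (x * w)) * of_real (exp (- x\<^sup>2 / 2)) \<partial>lborel)"
    by (simp only: mult.assoc)
  moreover have "complex_of_real (sqrt (2 * pi)) * of_real (1 / sqrt (2 * pi)) = 1"
    by (simp flip: of_real_mult)
  ultimately show ?thesis by simp
qed

lemma gauss_integral_scaled:
  assumes "0 < \<epsilon>"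
  shows "(\<integral>z. cis (- (z * w)) * of_real (exp (- (\<epsilon> * z)\<^sup>2 / 2)) \<partial>lborel)
    = of_real (sqrt (2 * pi) / \<epsilon> * exp (- (w / \<epsilon>)\<^sup>2 / 2))"
proof -
  have "(\<integral>z. cis (- (z * w)) * of_real (exp (- (\<epsilon> * z)\<^sup>2 / 2)) \<partial>lborel)
    = \<bar>1 / \<epsilon>\<bar> *\<^sub>R (\<integral>x. cis (- ((0 + 1 / \<epsilon> * x) * w)) * of_real (exp (- (\<epsilon> * (0 + 1 / \<epsilon> * x))\<^sup>2 / 2)) \<partial>lborel)"
    using assms by (intro lborel_integral_real_affine) simp
  also have "(\<lambda>x. cis (- ((0 + 1 / \<epsilon> * x) * w)) * complex_of_real (exp (- (\<epsilon> * (0 + 1 / \<epsilon> * x))\<^sup>2 / 2)))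
    = (\<lambda>x. cis (- (x * (w / \<epsilon>))) * of_real (exp (- x\<^sup>2 / 2)))"
    using assms by (simp add: fun_eq_iff mult.commute)
  finally show ?thesis
    using assms unfolding gauss_integral by (simp add: scaleR_conv_of_real)
qed

text \<open>The z integral of the Gaussian is a Gaussian of width \<epsilon> in the frequency, an
  approximate identity. The substitution w = \<epsilon> x turns its concentration at 0 into
  convergence of the integrand.\<close>

lemma osc_int_gauss_cutoff:
  assumes \<epsilon>: "0 < \<epsilon>" and v: "amp (\<lambda>x. (1 + \<bar>x\<bar>) ^ l) v"
  shows "osc_int (\<lambda>p. v (snd p) * cutoff gauss \<epsilon> 0 p)
    = of_real (sqrt (2 * pi)) * (\<integral>x. v (\<epsilon> * x) * of_real (exp (- (\<epsilon>\<^sup>2 * x)\<^sup>2 / 2) * exp (- x\<^sup>2 / 2)) \<partial>lborel)"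
proof -
  let ?g = "\<lambda>x. complex_of_real (exp (- x\<^sup>2 / 2))"
  have g: "cutoff gauss \<epsilon> 0 (z, w) = ?g (\<epsilon> * z) * ?g (\<epsilon> * w)" for z w
  proof -
    have "(norm (\<epsilon> * z, \<epsilon> * w))\<^sup>2 = (\<epsilon> * z)\<^sup>2 + (\<epsilon> * w)\<^sup>2" by (simp add: norm_Pair)
    then show ?thesis
      by (simp add: cutoff_def gauss_def exp_add[symmetric] add_divide_distrib flip: of_real_mult)
  qed
  from amp_integrable(1)[OF amp_cutoff_mult[OF gauss_schwartz \<epsilon> amp_snd[OF v], of 0]]
  have int: "integrable lborel (\<lambda>p. osc_exp p * (v (snd p) * cutoff gauss \<epsilon> 0 p))" by simp
  have "osc_int (\<lambda>p. v (snd p) * cutoff gauss \<epsilon> 0 p)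
    = (\<integral>w. (\<integral>z. osc_exp (z, w) * (v w * cutoff gauss \<epsilon> 0 (z, w)) \<partial>lborel) \<partial>lborel)"
    unfolding osc_int_def using lborel_integral_snd[OF int] by simp
  also have "\<dots> = (\<integral>w. (\<integral>z. (v w * ?g (\<epsilon> * w)) * (cis (- (z * w)) * ?g (\<epsilon> * z)) \<partial>lborel) \<partial>lborel)"
    by (intro Bochner_Integration.integral_cong refl) (simp add: g osc_exp_def mult_ac)
  also have "\<dots> = (\<integral>w. (v w * ?g (\<epsilon> * w)) * of_real (sqrt (2 * pi) / \<epsilon> * exp (- (w / \<epsilon>)\<^sup>2 / 2)) \<partial>lborel)"
    by (simp only: integral_mult_right_zero gauss_integral_scaled[OF \<epsilon>])
  also have "\<dots> = \<bar>\<epsilon>\<bar> *\<^sub>R (\<integral>x. (v (0 + \<epsilon> * x) * ?g (\<epsilon> * (0 + \<epsilon> * x))) * of_real (sqrt (2 * pi) / \<epsilon> * exp (- ((0 + \<epsilon> * x) / \<epsilon>)\<^sup>2 / 2)) \<partial>lborel)"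
    using \<epsilon> by (intro lborel_integral_real_affine) simp
  also have "(\<lambda>x. (v (0 + \<epsilon> * x) * ?g (\<epsilon> * (0 + \<epsilon> * x))) * of_real (sqrt (2 * pi) / \<epsilon> * exp (- ((0 + \<epsilon> * x) / \<epsilon>)\<^sup>2 / 2)))
     = (\<lambda>x. of_real (sqrt (2 * pi) / \<epsilon>) * (v (\<epsilon> * x) * of_real (exp (- (\<epsilon>\<^sup>2 * x)\<^sup>2 / 2) * exp (- x\<^sup>2 / 2))))"
    using \<epsilon> by (auto simp: fun_eq_iff power2_eq_square mult_ac)
  finally show ?thesis using \<epsilon> by (simp add: scaleR_conv_of_real)
qed

text \<open>Fourier inversion at the origin. The limit exists and is the same for all cutoffs, so
  the Gaussian one may be used to evaluate it.\<close>

lemma osc_lim_snd: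
  assumes v: "amp (\<lambda>x. (1 + \<bar>x\<bar>) ^ l) v"
  shows "osc_lim (\<lambda>p. v (snd p)) (of_real (2 * pi) * v 0)"
proof -
  note a = amp_snd[OF v]
  obtain I where I: "osc_lim (\<lambda>p. v (snd p)) I" using osc_limI[OF a order_refl order_refl] by blast
  define \<epsilon> where "\<epsilon> = (\<lambda>n. inverse (real (Suc n)))"
  have \<epsilon>: "\<forall>n. 0 < \<epsilon> n" "\<epsilon> \<longlonglongrightarrow> 0" "\<And>n. \<epsilon> n \<le> 1"
    unfolding \<epsilon>_def by (simp, rule LIMSEQ_inverse_real_of_nat, simp add: inverse_eq_divide)
  have sm: "smooth v" by (rule uamp_smooth[OF v])
  obtain C where C: "0 \<le> C" "\<And>x. cmod (v x) \<le> C * (1 + \<bar>x\<bar>) ^ l" using bamp_bound[OF v] by auto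
  \<comment> \<open>The Gaussian pays for the growth exponent \<open>l\<close> of \<open>v\<close>
    and for two more powers that make the majorant integrable.\<close>
  define K where "K = C * (real (l + 2) ^ (l + 2) * exp (3 / 2))"
  have "(\<lambda>n. \<integral>x. v (\<epsilon> n * x) * of_real (exp (- ((\<epsilon> n)\<^sup>2 * x)\<^sup>2 / 2) * exp (- x\<^sup>2 / 2)) \<partial>lborel)
     \<longlonglongrightarrow> (\<integral>x. v 0 * of_real (exp (- x\<^sup>2 / 2)) \<partial>lborel)"
  proof (rule integral_dominated_convergence[where w="\<lambda>x. K * (1 / (1 + \<bar>x\<bar>) ^ 2)"])
    show "(\<lambda>x. v 0 * complex_of_real (exp (- x\<^sup>2 / 2))) \<in> borel_measurable lborel" by simp
    show "integrable lborel (\<lambda>x. K * (1 / (1 + \<bar>x\<bar>) ^ 2))" by (intro integrable_mult_right integrable_weight) simp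
    show "(\<lambda>x. v (\<epsilon> n * x) * of_real (exp (- ((\<epsilon> n)\<^sup>2 * x)\<^sup>2 / 2) * exp (- x\<^sup>2 / 2))) \<in> borel_measurable lborel" for n
      using smooth_borel[OF sm] by measurable
    show "AE x in lborel. (\<lambda>n. v (\<epsilon> n * x) * of_real (exp (- ((\<epsilon> n)\<^sup>2 * x)\<^sup>2 / 2) * exp (- x\<^sup>2 / 2)))
       \<longlonglongrightarrow> v 0 * of_real (exp (- x\<^sup>2 / 2))"
    proof (rule AE_I2)
      fix x
      have "(\<lambda>n. \<epsilon> n * x) \<longlonglongrightarrow> 0 * x" by (intro tendsto_intros \<epsilon>)
      then have "(\<lambda>n. v (\<epsilon> n * x)) \<longlonglongrightarrow> v 0"
        by (intro continuous_on_tendsto_compose[OF smooth_continuous[OF sm, of UNIV]]) auto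
      moreover have "(\<lambda>n. complex_of_real (exp (- ((\<epsilon> n)\<^sup>2 * x)\<^sup>2 / 2) * exp (- x\<^sup>2 / 2)))
         \<longlonglongrightarrow> of_real (exp (- (0\<^sup>2 * x)\<^sup>2 / 2) * exp (- x\<^sup>2 / 2))"
        by (intro tendsto_intros \<epsilon>) auto
      ultimately show "(\<lambda>n. v (\<epsilon> n * x) * of_real (exp (- ((\<epsilon> n)\<^sup>2 * x)\<^sup>2 / 2) * exp (- x\<^sup>2 / 2)))
       \<longlonglongrightarrow> v 0 * of_real (exp (- x\<^sup>2 / 2))" by (auto intro: tendsto_mult)
    qed
    show "AE x in lborel. norm (v (\<epsilon> n * x) * of_real (exp (- ((\<epsilon> n)\<^sup>2 * x)\<^sup>2 / 2) * exp (- x\<^sup>2 / 2)))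
       \<le> K * (1 / (1 + \<bar>x\<bar>) ^ 2)" for n
    proof (rule AE_I2)
      fix x :: real
      have "\<bar>\<epsilon> n * x\<bar> \<le> \<bar>x\<bar>" using \<epsilon>(1,3)[rule_format, of n] by (simp add: abs_mult mult_left_le_one_le less_imp_le)
      then have "cmod (v (\<epsilon> n * x)) \<le> C * (1 + \<bar>x\<bar>) ^ l"
        by (intro order_trans[OF C(2)] mult_left_mono power_mono) (auto intro: C)
      moreover have "exp (- ((\<epsilon> n)\<^sup>2 * x)\<^sup>2 / 2) * exp (- x\<^sup>2 / 2) \<le> 1 * exp (- x\<^sup>2 / 2)"
        by (intro mult_right_mono) auto
      ultimately have "cmod (v (\<epsilon> n * x)) * (exp (- ((\<epsilon> n)\<^sup>2 * x)\<^sup>2 / 2) * exp (- x\<^sup>2 / 2)) \<le> (C * (1 + \<bar>x\<bar>) ^ l) * (1 * exp (- x\<^sup>2 / 2))"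
        using C(1) by (intro mult_mono) auto
      also have "\<dots> * (1 + \<bar>x\<bar>) ^ 2 = C * ((1 + \<bar>x\<bar>) ^ (l + 2) * exp (- \<bar>x\<bar>\<^sup>2 / 2))"
        by (simp add: power_add power2_eq_square mult_ac)
      also have "\<dots> \<le> K" unfolding K_def by (intro mult_left_mono power_times_exp_le C) auto
      finally have "cmod (v (\<epsilon> n * x)) * (exp (- ((\<epsilon> n)\<^sup>2 * x)\<^sup>2 / 2) * exp (- x\<^sup>2 / 2)) * (1 + \<bar>x\<bar>) ^ 2 \<le> K"
        by (simp add: mult_right_mono)
      moreover have "0 < (1 + \<bar>x\<bar>) ^ 2" by (simp add: add_pos_nonneg)
      ultimately show "norm (v (\<epsilon> n * x) * of_real (exp (- ((\<epsilon> n)\<^sup>2 * x)\<^sup>2 / 2) * exp (- x\<^sup>2 / 2)))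
         \<le> K * (1 / (1 + \<bar>x\<bar>) ^ 2)"
        by (simp add: norm_mult field_simps)
    qed
  qed
  then have L1: "(\<lambda>n. osc_int (\<lambda>p. v (snd p) * cutoff gauss (\<epsilon> n) 0 p))
     \<longlonglongrightarrow> of_real (sqrt (2 * pi)) * (\<integral>x. v 0 * of_real (exp (- x\<^sup>2 / 2)) \<partial>lborel)"
    unfolding osc_int_gauss_cutoff[OF \<epsilon>(1)[rule_format] v] by (intro tendsto_intros)
  \<comment> \<open>One factor sqrt (2 pi) stems from the z integral, the other from the remaining
    Gaussian integral.\<close>
  have eq: "of_real (sqrt (2 * pi)) * (\<integral>x. v 0 * complex_of_real (exp (- x\<^sup>2 / 2)) \<partial>lborel) = of_real (2 * pi) * v 0"
  proof -
    have "(\<integral>x. complex_of_real (exp (- x\<^sup>2 / 2)) \<partial>lborel) = of_real (sqrt (2 * pi))"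
      using gauss_integral[of 0] by simp
    then have "(\<integral>x. v 0 * complex_of_real (exp (- x\<^sup>2 / 2)) \<partial>lborel) = v 0 * of_real (sqrt (2 * pi))"
      by (simp only: integral_mult_right_zero)
    moreover have "complex_of_real (sqrt (2 * pi)) * of_real (sqrt (2 * pi)) = of_real (2 * pi)"
      unfolding of_real_mult[symmetric] by simp
    ultimately show ?thesis by (simp only: mult.left_commute) (rule mult.commute)
  qed
  have L2: "(\<lambda>n. osc_int (\<lambda>p. v (snd p) * cutoff gauss (\<epsilon> n) 0 p)) \<longlonglongrightarrow> I"
    by (rule osc_limD[OF I gauss_schwartz gauss_0 \<epsilon>(1,2)])
  have "I = of_real (2 * pi) * v 0" using LIMSEQ_unique[OF L2 L1] unfolding eq .
  with I show ?thesis by simp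
qed

section \<open>Regularization of tensor products and Taylor's formula\<close>

definition one_plus_deriv :: "(real \<Rightarrow> complex) \<Rightarrow> real \<Rightarrow> complex" where
  "one_plus_deriv u x = u x + deriv1 u x"

lemma smooth_one_plus_deriv: "smooth u \<Longrightarrow> smooth (one_plus_deriv u)"
  unfolding one_plus_deriv_def[abs_def] by (intro smooth_add smooth_dir_deriv)

lemma smooth_funpow_one_plus_deriv: "smooth u \<Longrightarrow> smooth ((one_plus_deriv ^^ k) u)"
  by (induction k) (auto intro: smooth_one_plus_deriv)

lemma smooth_fst: "smooth u \<Longrightarrow> smooth (\<lambda>p::real \<times> real. u (fst p))"
  using smooth_affine[OF _ bounded_linear_fst, of u 0] by simp

lemma smooth_snd: "smooth u \<Longrightarrow> smooth (\<lambda>p::real \<times> real. u (snd p))"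
  using smooth_affine[OF _ bounded_linear_snd, of u 0] by simp

lemma dir_deriv_tensor:
  assumes "smooth u" "smooth v"
  shows "dir_deriv (a, b) (\<lambda>p. u (fst p) * v (snd p))
     = (\<lambda>p. of_real a * deriv1 u (fst p) * v (snd p) + u (fst p) * (of_real b * deriv1 v (snd p)))"
proof -
  have "dir_deriv (a, b) (\<lambda>p. u (fst p)) = (\<lambda>p. of_real a * deriv1 u (fst p))"
    using dir_deriv_affine[OF smooth_differentiable[OF assms(1)] bounded_linear_fst, of "(a, b)" 0]
      dir_deriv_scaleR[OF smooth_differentiable[OF assms(1)], of a 1] by simp
  moreover have "dir_deriv (a, b) (\<lambda>p. v (snd p)) = (\<lambda>p. of_real b * deriv1 v (snd p))"
    using dir_deriv_affine[OF smooth_differentiable[OF assms(2)] bounded_linear_snd, of "(a, b)" 0]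
      dir_deriv_scaleR[OF smooth_differentiable[OF assms(2)], of b 1] by simp
  ultimately show ?thesis
    by (simp add: dir_deriv_mult smooth_differentiable smooth_fst smooth_snd assms)
qed

lemma smooth_resolvent_power: "smooth (\<lambda>x. resolvent x ^ k)"
  by (induction k) (auto intro: smooth_const smooth_mult smooth_resolvent)

lemma opA_tensor:
  assumes "smooth u" "smooth v"
  shows "(opA ^^ M) (\<lambda>p. u (fst p) * v (snd p))
     = (\<lambda>p. (one_plus_deriv ^^ M) u (fst p) * (resolvent (snd p) ^ M * v (snd p)))"
proof (induction M)
  case (Suc M)
  have sm: "smooth (\<lambda>x. resolvent x ^ k * v x)" for k
    by (intro smooth_mult smooth_resolvent_power assms)
  show ?case
    unfolding funpow.simps o_apply Suc
    by (rule ext, unfold osc_op_def dir_deriv_tensor[OF smooth_funpow_one_plus_deriv[OF assms(1)] sm])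
       (simp add: one_plus_deriv_def algebra_simps)
qed simp

lemma opB_tensor:
  assumes "smooth u" "smooth v"
  shows "(opB ^^ J) (\<lambda>p. u (fst p) * v (snd p))
     = (\<lambda>p. resolvent (fst p) ^ J * u (fst p) * (one_plus_deriv ^^ J) v (snd p))"
proof (induction J)
  case (Suc J)
  have sm: "smooth (\<lambda>x. resolvent x ^ k * u x)" for k
    by (intro smooth_mult smooth_resolvent_power assms)
  show ?case
    unfolding funpow.simps o_apply Suc
    by (rule ext, unfold osc_op_def dir_deriv_tensor[OF sm smooth_funpow_one_plus_deriv[OF assms(2)]])
       (simp add: one_plus_deriv_def algebra_simps)
qed simp

lemma amp_resolvent_power: "amp (\<lambda>x. 1 / (1 + \<bar>x\<bar>) ^ k) (\<lambda>x. resolvent x ^ k)"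
proof (induction k)
  case 0
  show ?case by (rule bampI) (auto simp: smooth_const iter_deriv_const intro: exI[of _ 1])
next
  case (Suc k)
  show ?case using uamp_mult[OF amp_resolvent Suc] by simp
qed

text \<open>Each operator differentiates in one variable and multiplies by a resolvent in the other,
  so the tensor form is kept and the work is reduced to one variable.\<close>

lemma ops_tensor:
  assumes "smooth u" "smooth v"
  shows "(opB ^^ J) ((opA ^^ M) (\<lambda>p. u (fst p) * v (snd p)))
     = (\<lambda>p. resolvent (fst p) ^ J * (one_plus_deriv ^^ M) u (fst p)
          * (one_plus_deriv ^^ J) (\<lambda>x. resolvent x ^ M * v x) (snd p))"
  unfolding opA_tensor[OF assms]
  by (intro opB_tensor smooth_funpow_one_plus_deriv smooth_mult smooth_resolvent_power assms)

text \<open>The binomial theorem for 1 + d/dx; it isolates single derivatives, to which the symbol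
  estimates apply.\<close>

lemma one_plus_deriv_sum:
  assumes "smooth u"
  shows "(one_plus_deriv ^^ M) u = (\<lambda>x. \<Sum>i\<le>M. of_nat (M choose i) * (deriv1 ^^ i) u x)"
proof (induction M)
  case (Suc M)
  have sm: "smooth ((deriv1 ^^ i) u)" for i by (rule smooth_funpow_dir_deriv[OF assms])
  have D: "deriv1 (\<lambda>x. \<Sum>i\<in>I. of_nat (M choose i) * (deriv1 ^^ i) u x)
     = (\<lambda>x. \<Sum>i\<in>I. of_nat (M choose i) * (deriv1 ^^ Suc i) u x)" if "finite I" for I
    using that
    by (induction I rule: finite_induct)
       (simp_all add: dir_deriv_add dir_deriv_cmult smooth_differentiable smooth_cmult smooth_sum sm)
  show ?case
  proof (rule ext)
    fix x
    let ?d = "\<lambda>i. (deriv1 ^^ i) u x"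
    have "(one_plus_deriv ^^ Suc M) u x
       = (\<Sum>i\<le>M. of_nat (M choose i) * ?d i) + (\<Sum>i\<le>M. of_nat (M choose i) * ?d (Suc i))"
      by (simp only: funpow.simps o_apply Suc one_plus_deriv_def D[OF finite_atMost])
    also have "(\<Sum>i\<le>M. of_nat (M choose i) * ?d i) = (\<Sum>i\<le>Suc M. of_nat (M choose i) * ?d i)"
      by simp
    also have "\<dots> = ?d 0 + (\<Sum>i\<le>M. of_nat (M choose Suc i) * ?d (Suc i))"
      by (subst sum.atMost_Suc_shift) simp
    also have "?d 0 + (\<Sum>i\<le>M. of_nat (M choose Suc i) * ?d (Suc i)) + (\<Sum>i\<le>M. of_nat (M choose i) * ?d (Suc i))
       = ?d 0 + (\<Sum>i\<le>M. of_nat (Suc M choose Suc i) * ?d (Suc i))"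
      by (simp add: sum.distrib[symmetric] algebra_simps)
    also have "\<dots> = (\<Sum>i\<le>Suc M. of_nat (Suc M choose i) * ?d i)"
      by (subst sum.atMost_Suc_shift) simp
    finally show "(one_plus_deriv ^^ Suc M) u x = (\<Sum>i\<le>Suc M. of_nat (Suc M choose i) * ?d i)" .
  qed
qed simp

text \<open>The indicator is part of the weight so that r ranges over the whole line and can be
  joined with z and w in one integral.\<close>

definition taylor_weight :: "nat \<Rightarrow> real \<Rightarrow> real" where
  "taylor_weight m r = indicator {0..1} r * ((1 - r) ^ m / fact m)"

text \<open>The integral remainder of order \<open>Suc m\<close> at the origin, divided by \<open>z ^ Suc m\<close>.\<close>
definition taylor_rem :: "nat \<Rightarrow> (real \<Rightarrow> complex) \<Rightarrow> real \<Rightarrow> complex" where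
  "taylor_rem m u z = (\<integral>r. of_real (taylor_weight m r) * (deriv1 ^^ Suc m) u (r * z) \<partial>lborel)"

text \<open>The Taylor polynomial centred at r z and evaluated at z has a telescoping derivative in
  r, equal to the remainder integrand. Integrating over r from 0 to 1 leads from the polynomial at
  the origin to \<open>u z\<close>.\<close>

lemma taylor_formula:
  assumes u: "smooth u"
  shows "u z = (\<Sum>k<Suc m. (deriv1 ^^ k) u 0 / fact k * of_real z ^ k) + of_real z ^ Suc m * taylor_rem m u z"
proof -
  define G where "G = (\<lambda>n r. \<Sum>k<n. of_real ((1 - r) ^ k / fact k) * (of_real z ^ k * (deriv1 ^^ k) u (r * z)))"
  define g where "g = (\<lambda>m r. of_real ((1 - r) ^ m / fact m) * (of_real z ^ Suc m * (deriv1 ^^ Suc m) u (r * z)))"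
  have Du: "((\<lambda>r. (deriv1 ^^ k) u (r * z)) has_vector_derivative of_real z * (deriv1 ^^ Suc k) u (r * z)) (at r)" for k r
  proof -
    have "((\<lambda>r. r * z) has_derivative (\<lambda>h. h * z)) (at r)" by (auto intro!: derivative_eq_intros)
    from has_derivative_compose[OF this smooth_has_derivative[OF smooth_funpow_dir_deriv[OF u, where v=1 and k=k]]]
    have "((\<lambda>r. (deriv1 ^^ k) u (r * z)) has_derivative (\<lambda>h. dir_deriv (h * z) ((deriv1 ^^ k) u) (r * z))) (at r)" .
    moreover have "dir_deriv (h * z) ((deriv1 ^^ k) u) (r * z) = h *\<^sub>R (of_real z * (deriv1 ^^ Suc k) u (r * z))" for h
      using dir_deriv_scaleR[OF smooth_differentiable[OF smooth_funpow_dir_deriv[OF u, where v=1 and k=k]], of "h * z" 1]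
      by (simp add: scaleR_conv_of_real mult.assoc)
    ultimately show ?thesis by (simp add: has_vector_derivative_def)
  qed
  have G: "(G (Suc m) has_vector_derivative g m r) (at r)" for m r
  proof (induction m)
    case 0
    show ?case unfolding G_def g_def using Du[of 0 r] by simp
  next
    case (Suc m)
    have *: "((\<lambda>r. (1 - r) ^ Suc m / fact (Suc m)) has_real_derivative - ((1 - r) ^ m / fact m)) (at r)"
    proof -
      have "((\<lambda>r. 1 - r) has_real_derivative - 1) (at r)" by (auto intro!: derivative_eq_intros)
      from DERIV_cdivide[OF DERIV_power[OF this, of "Suc m"], of "fact (Suc m)"]
      have X: "((\<lambda>r. (1 - r) ^ Suc m / fact (Suc m)) has_real_derivative (real (Suc m) * (1 - r) ^ m * (- 1)) / fact (Suc m)) (at r)"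
        by (simp add: mult_ac del: power_Suc of_nat_Suc fact_Suc)
      have eq: "(real (Suc m) * (1 - r) ^ m * (- 1)) / fact (Suc m) = - ((1 - r) ^ m / fact m)"
        by (simp add: divide_simps)
      show ?thesis using X unfolding eq .
    qed
    have "((\<lambda>r. of_real ((1 - r) ^ Suc m / fact (Suc m)) * (of_real z ^ Suc m * (deriv1 ^^ Suc m) u (r * z)))
      has_vector_derivative (of_real ((1 - r) ^ Suc m / fact (Suc m)) * (of_real z ^ Suc m * (of_real z * (deriv1 ^^ Suc (Suc m)) u (r * z)))
        + of_real (- ((1 - r) ^ m / fact m)) * (of_real z ^ Suc m * (deriv1 ^^ Suc m) u (r * z)))) (at r)"
      by (intro has_vector_derivative_mult has_vector_derivative_mult_right Du
          has_vector_derivative_of_real *)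
    from has_vector_derivative_add[OF Suc this]
    have "((\<lambda>r. G (Suc (Suc m)) r) has_vector_derivative g (Suc m) r) (at r)"
      unfolding G_def g_def by (simp add: algebra_simps del: fact_Suc)
    then show ?case by simp
  qed
  have "(\<integral>r. indicator {0..1} r *\<^sub>R g m r \<partial>lborel) = G (Suc m) 1 - G (Suc m) 0"
  proof (rule integral_FTC_Icc)
    show "(G (Suc m) has_vector_derivative g m r) (at r within {0..1})" for r
      using G by (rule has_vector_derivative_at_within)
    show "continuous_on {0..1} (g m)"
      unfolding g_def
      by (intro continuous_intros continuous_on_compose2[OF smooth_continuous[OF smooth_funpow_dir_deriv[OF u], where S=UNIV]]) auto
  qed simp
  moreover have "(\<lambda>r. indicator {0..1} r *\<^sub>R g m r)
     = (\<lambda>r. of_real z ^ Suc m * (of_real (taylor_weight m r) * (deriv1 ^^ Suc m) u (r * z)))"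
    by (auto simp: fun_eq_iff g_def taylor_weight_def indicator_def)
  then have "(\<integral>r. indicator {0..1} r *\<^sub>R g m r \<partial>lborel) = of_real z ^ Suc m * taylor_rem m u z"
    unfolding taylor_rem_def by (simp only: integral_mult_right_zero)
  \<comment> \<open>At r = 1 all terms vanish except k = 0, where (1 - r) ^ 0 = 1.\<close>
  moreover have "G (Suc m) 1 = u z"
    unfolding G_def by (subst sum.lessThan_Suc_shift) simp
  moreover have "G (Suc m) 0 = (\<Sum>k<Suc m. (deriv1 ^^ k) u 0 / fact k * of_real z ^ k)"
    unfolding G_def by (intro sum.cong) auto
  ultimately show ?thesis by (simp add: algebra_simps)
qed

lemma taylor_weight_bound: "\<bar>taylor_weight m r\<bar> \<le> indicator {0..1} r"
proof (cases "r \<in> {0..1}")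
  case True
  then have "(1 - r) ^ m \<le> 1" "0 \<le> (1 - r) ^ m" by (auto intro: power_le_one)
  then have "(1 - r) ^ m / fact m \<le> 1 / 1" by (intro frac_le) (auto simp: fact_ge_1)
  then show ?thesis using True by (simp add: taylor_weight_def)
qed (simp add: taylor_weight_def)

lemma taylor_weight_measurable [measurable]: "taylor_weight m \<in> borel_measurable borel"
  unfolding taylor_weight_def[abs_def] by measurable

lemma integrable_indicator_unit: "integrable lborel (\<lambda>r::real. indicator {0..1} r :: real)"
  using borel_integrable_atLeastAtMost'[of 0 1 "\<lambda>_. 1::real"] by (simp add: set_integrable_def)

text \<open>Each z derivative of u (r z) brings a factor r from the unit interval, so the quotient
  of the remainder by the power of z stays bounded with all its derivatives, although z ranges over
  the whole line.\<close>

lemma amp_taylor_rem: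
  assumes u: "amp (\<lambda>_. 1) u"
  shows "amp (\<lambda>_. 1) (taylor_rem m u)"
    and "(deriv1 ^^ i) (taylor_rem m u) z
      = (\<integral>r. of_real (taylor_weight m r * r ^ i) * (deriv1 ^^ (Suc m + i)) u (r * z) \<partial>lborel)"
proof -
  let ?g = "(deriv1 ^^ Suc m) u"
  let ?f = "\<lambda>r z. of_real (taylor_weight m r) * ?g (r * z)"
  have g: "amp (\<lambda>_. 1) ?g" using bamp_funpow_dir_deriv[OF u, where k="Suc m"] .
  have sg: "smooth ?g" by (rule uamp_smooth[OF g])
  have comp: "smooth (\<lambda>z. ?g (r * z))" and
    it: "iter_deriv w (\<lambda>z. ?g (r * z)) = (\<lambda>z. iter_deriv (map ((*) r) w) ?g (r * z))" for r w
    using smooth_affine[OF sg bounded_linear_scaleR_right, of r 0]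
      iter_deriv_affine[OF sg bounded_linear_scaleR_right, of w r 0] by simp_all
  have scal: "iter_deriv (map ((*) r) w) ?g = (\<lambda>z. of_real r ^ length w * iter_deriv w ?g z)" for r w
    using iter_deriv_scaleR_word[OF sg, of r w] by (simp add: real_scaleR_def[abs_def])
  have f: "bamp (\<lambda>r _. indicator {0..1} r) ?f"
  proof (rule bampI)
    show "smooth (?f r)" for r by (intro smooth_cmult comp)
    fix w :: "real list"
    obtain C where C: "0 \<le> C" "\<And>z. cmod (iter_deriv w ?g z) \<le> C" using bamp_word_nonneg[OF g, of w] by auto
    have "cmod (iter_deriv w (?f r) z) \<le> C * indicator {0..1} r" for r z
    proof (cases "r \<in> {0..1}")
      case True
      have "cmod (iter_deriv w (?f r) z) = \<bar>taylor_weight m r\<bar> * (\<bar>r\<bar> ^ length w * cmod (iter_deriv w ?g (r * z)))"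
        by (simp add: iter_deriv_cmult[OF comp] it scal norm_mult norm_power del: funpow.simps)
      also have "\<dots> \<le> 1 * (1 * C)"
        using True taylor_weight_bound[of m r] by (intro mult_mono power_le_one C) auto
      finally show ?thesis using True by simp
    next
      case False
      then have "?f r = (\<lambda>_. 0)" by (simp add: taylor_weight_def)
      then show ?thesis using C by (simp add: iter_deriv_const)
    qed
    then show "\<exists>C. \<forall>r z. cmod (iter_deriv w (?f r) z) \<le> C * indicator {0..1} r" by blast
  qed
  have meas: "(\<lambda>r. ?f r z) \<in> borel_measurable lborel" for z
    using smooth_borel[OF sg] by measurable
  have B: "amp (\<lambda>_. 1) (\<lambda>z. \<integral>r. ?f r z \<partial>lborel)" "dominated_family lborel ?f"
  proof -
    have loc: "\<exists>s>0. \<exists>k. integrable lborel k \<and> (\<forall>r::real. \<forall>z\<in>ball z0 s. (indicator {0..1} r :: real) \<le> k r)" for z0 :: real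
      by (rule exI[of _ "1::real"], rule conjI, simp, rule exI[of _ "\<lambda>r::real. indicator {0..1} r :: real"])
         (intro conjI integrable_indicator_unit, simp)
    show "amp (\<lambda>_. 1) (\<lambda>z. \<integral>r. ?f r z \<partial>lborel)" "dominated_family lborel ?f"
      using bamp_integral[OF f _ meas integrable_indicator_unit _ loc, of 1 "\<lambda>_. 1"] by simp_all
  qed
  then show "amp (\<lambda>_. 1) (taylor_rem m u)" unfolding taylor_rem_def[abs_def] by simp
  have "(deriv1 ^^ i) (taylor_rem m u) z = (\<integral>r. iter_deriv (replicate i 1) (?f r) z \<partial>lborel)"
    unfolding taylor_rem_def[abs_def] funpow_dir_deriv[of i] iter_deriv_integral[OF B(2)] ..
  also have "\<dots> = (\<integral>r. of_real (taylor_weight m r * r ^ i) * (deriv1 ^^ (Suc m + i)) u (r * z) \<partial>lborel)"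
  proof (rule Bochner_Integration.integral_cong[OF refl])
    fix r
    have "iter_deriv (replicate i 1) (?f r) z = of_real (taylor_weight m r) * (of_real r ^ i * iter_deriv (replicate i 1) ?g (r * z))"
      by (simp only: iter_deriv_cmult[OF comp] it scal length_replicate)
    also have "iter_deriv (replicate i 1) ?g = (deriv1 ^^ (Suc m + i)) u"
      unfolding funpow_dir_deriv[symmetric] by (metis add.commute funpow_add o_apply)
    finally show "iter_deriv (replicate i 1) (?f r) z = of_real (taylor_weight m r * r ^ i) * (deriv1 ^^ (Suc m + i)) u (r * z)"
      by (simp add: mult.assoc)
  qed
  finally show "(deriv1 ^^ i) (taylor_rem m u) z
      = (\<integral>r. of_real (taylor_weight m r * r ^ i) * (deriv1 ^^ (Suc m + i)) u (r * z) \<partial>lborel)" .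
qed

section \<open>Expansion of tensor amplitudes and the remainder kernel\<close>

lemma osc_lim_sum:
  assumes "finite S" "\<And>i. i \<in> S \<Longrightarrow> amp (poly_weight k l) (a i)" "\<And>i. i \<in> S \<Longrightarrow> osc_lim (a i) (I i)"
  shows "osc_lim (\<lambda>p. \<Sum>i\<in>S. a i p) (\<Sum>i\<in>S. I i)"
  using assms
proof (induction S rule: finite_induct)
  case empty
  then show ?case by (simp add: osc_lim_def osc_int_def)
next
  case (insert x S)
  have "amp (poly_weight k l) (\<lambda>p. \<Sum>i\<in>S. a i p)"
    using insert by (intro uamp_sum) auto
  with insert show ?case by (auto intro!: osc_lim_add[of k l _ k l])
qed

lemma amp_fst_power_mult:
  "amp (poly_weight k l) a \<Longrightarrow> amp (poly_weight (k + n) l) (\<lambda>p. of_real (fst p) ^ n * a p)"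
  by (induction n) (auto simp: mult.assoc intro: amp_fst_mult)

lemma funpow_dir_deriv_tensor:
  fixes u v :: "real \<Rightarrow> complex"
  assumes "smooth u" "smooth v"
  shows "(dir_deriv (0, 1) ^^ k) (\<lambda>p. u (fst p) * v (snd p)) = (\<lambda>p. u (fst p) * (deriv1 ^^ k) v (snd p))"
  by (induction k) (simp_all add: dir_deriv_tensor[OF assms(1) smooth_funpow_dir_deriv[OF assms(2)]])

text \<open>Each power z ^ k turns into (- i) ^ k and k derivatives of \<open>v\<close>, and
  inversion evaluates the result at 0. The power in front of the remainder is removed in the same
  way, which leaves an amplitude bounded in z; hence two steps of \<open>opB\<close> are
  enough.\<close>

lemma osc_lim_taylor:
  assumes u: "amp (\<lambda>_. 1) u" and v: "amp (\<lambda>x. (1 + \<bar>x\<bar>) ^ l) v" and M: "l + 2 \<le> M"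
  shows "osc_lim (\<lambda>p. u (fst p) * v (snd p))
    (of_real (2 * pi) * (\<Sum>k<Suc m. (- \<i>) ^ k / fact k * (deriv1 ^^ k) v 0 * (deriv1 ^^ k) u 0)
     + (- \<i>) ^ Suc m * osc_int ((opB ^^ 2) ((opA ^^ M) (\<lambda>p. taylor_rem m u (fst p) * (deriv1 ^^ Suc m) v (snd p)))))"
proof -
  note su = uamp_smooth[OF u] and sv = uamp_smooth[OF v]
  let ?t = "taylor_rem m u"
  note t = amp_taylor_rem(1)[OF u, of m]
  have amp0: "amp (poly_weight 0 l) (\<lambda>p. ?t (fst p) * w (snd p))" if "amp (\<lambda>x. (1 + \<bar>x\<bar>) ^ l) w" for w
    using amp_tensor[of 0 ?t l w] t that by simp
  have rem: "osc_lim (\<lambda>p. of_real (fst p) ^ Suc m * (?t (fst p) * v (snd p)))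
     ((- \<i>) ^ Suc m * osc_int ((opB ^^ 2) ((opA ^^ M) (\<lambda>p. ?t (fst p) * (deriv1 ^^ Suc m) v (snd p)))))"
  proof (rule osc_lim_fst_power_mult[OF amp0[OF v]])
    show "osc_lim ((dir_deriv (0, 1) ^^ Suc m) (\<lambda>p. ?t (fst p) * v (snd p)))
      (osc_int ((opB ^^ 2) ((opA ^^ M) (\<lambda>p. ?t (fst p) * (deriv1 ^^ Suc m) v (snd p)))))"
      unfolding funpow_dir_deriv_tensor[OF uamp_smooth[OF t] sv]
      by (rule osc_limI[OF amp0[OF bamp_funpow_dir_deriv[OF v]]]) (use M in auto)
  qed
  let ?c = "\<lambda>k. (deriv1 ^^ k) u 0 / fact k"
  have main: "osc_lim (\<lambda>p. \<Sum>k<Suc m. ?c k * (of_real (fst p) ^ k * v (snd p)))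
     (\<Sum>k<Suc m. ?c k * ((- \<i>) ^ k * (of_real (2 * pi) * (deriv1 ^^ k) v 0)))"
  proof (rule osc_lim_sum[where k="Suc m" and l=l])
    fix k assume k: "k \<in> {..<Suc m}"
    show "amp (poly_weight (Suc m) l) (\<lambda>p. ?c k * (of_real (fst p) ^ k * v (snd p)))"
    proof (rule uamp_cmult, rule bamp_mono[OF amp_fst_power_mult[OF amp_snd[OF v], of k], where B=1])
      show "poly_weight (0 + k) l p \<le> 1 * poly_weight (Suc m) l p" for p
        using k poly_weight_mono[of k "Suc m" l l p] by simp
    qed (rule poly_weight_nonneg)
    have "(dir_deriv (0, 1) ^^ k) (\<lambda>p::real \<times> real. v (snd p)) = (\<lambda>p. (deriv1 ^^ k) v (snd p))"
      using funpow_dir_deriv_tensor[OF smooth_const[of 1] sv, of k] by simp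
    then show "osc_lim (\<lambda>p. ?c k * (of_real (fst p) ^ k * v (snd p))) (?c k * ((- \<i>) ^ k * (of_real (2 * pi) * (deriv1 ^^ k) v 0)))"
      by (intro osc_lim_cmult osc_lim_fst_power_mult[OF amp_snd[OF v]])
         (simp only: osc_lim_snd[OF bamp_funpow_dir_deriv[OF v]])
  qed simp
  have amp_main: "amp (poly_weight (Suc m) l) (\<lambda>p. \<Sum>k<Suc m. ?c k * (of_real (fst p) ^ k * v (snd p)))"
  proof (rule uamp_sum)
    fix k assume k: "k \<in> {..<Suc m}"
    show "amp (poly_weight (Suc m) l) (\<lambda>p. ?c k * (of_real (fst p) ^ k * v (snd p)))"
    proof (rule uamp_cmult, rule bamp_mono[OF amp_fst_power_mult[OF amp_snd[OF v], of k], where B=1])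
      show "poly_weight (0 + k) l p \<le> 1 * poly_weight (Suc m) l p" for p
        using k poly_weight_mono[of k "Suc m" l l p] by simp
    qed (rule poly_weight_nonneg)
  qed simp
  have "(\<lambda>p. u (fst p) * v (snd p)) = (\<lambda>p. (\<Sum>k<Suc m. ?c k * (of_real (fst p) ^ k * v (snd p)))
      + of_real (fst p) ^ Suc m * (?t (fst p) * v (snd p)))"
  proof (rule ext)
    fix p :: "real \<times> real"
    show "u (fst p) * v (snd p) = (\<Sum>k<Suc m. ?c k * (of_real (fst p) ^ k * v (snd p)))
      + of_real (fst p) ^ Suc m * (?t (fst p) * v (snd p))"
      by (subst taylor_formula[OF su, of _ m])
         (simp only: distrib_right sum_distrib_right mult.assoc)
  qed
  moreover have "of_real (2 * pi) * (\<Sum>k<Suc m. (- \<i>) ^ k / fact k * (deriv1 ^^ k) v 0 * (deriv1 ^^ k) u 0)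
    = (\<Sum>k<Suc m. ?c k * ((- \<i>) ^ k * (of_real (2 * pi) * (deriv1 ^^ k) v 0)))"
    unfolding sum_distrib_left by (intro sum.cong refl) (simp add: field_simps)
  ultimately show ?thesis
    using osc_lim_add[OF amp_main amp_fst_power_mult[OF amp0[OF v]] main rem] by simp
qed

text \<open>These are the coefficients of v, v' and v'' in the expansion of (1 + d/dx)^2 (g
  v).\<close>

definition resolvent_coeff :: "nat \<Rightarrow> nat \<Rightarrow> real \<Rightarrow> complex" where
  "resolvent_coeff M j x = (let g = (\<lambda>x. resolvent x ^ M) in
     if j = 0 then g x + 2 * deriv1 g x + deriv1 (deriv1 g) x
     else if j = 1 then 2 * g x + 2 * deriv1 g x else g x)"

lemma amp_resolvent_coeff: "amp (\<lambda>x. 1 / (1 + \<bar>x\<bar>) ^ M) (resolvent_coeff M j)"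
proof -
  let ?W = "\<lambda>x. 1 / (1 + \<bar>x\<bar>) ^ M" and ?g = "\<lambda>x. resolvent x ^ M"
  note g = amp_resolvent_power[of M]
  have "amp ?W (\<lambda>x. ?g x + 2 * deriv1 ?g x + deriv1 (deriv1 ?g) x)"
    "amp ?W (\<lambda>x. 2 * ?g x + 2 * deriv1 ?g x)"
    by (intro uamp_add uamp_cmult bamp_dir_deriv g)+
  then show ?thesis
    using g by (cases "j = 0"; cases "j = 1") (simp_all add: resolvent_coeff_def[abs_def] Let_def)
qed

lemma one_plus_deriv_sq_resolvent_mult:
  assumes v: "smooth v"
  shows "(one_plus_deriv ^^ 2) (\<lambda>x. resolvent x ^ M * v x)
    = (\<lambda>x. \<Sum>j\<le>2. resolvent_coeff M j x * (deriv1 ^^ j) v x)"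
proof -
  let ?g = "\<lambda>x. resolvent x ^ M"
  note g = smooth_resolvent_power[of M]
  have 1: "one_plus_deriv (\<lambda>x. ?g x * v x) = (\<lambda>x. ?g x * v x + (deriv1 ?g x * v x + ?g x * deriv1 v x))"
    by (rule ext) (simp add: one_plus_deriv_def dir_deriv_mult smooth_differentiable g v)
  have 2: "deriv1 (\<lambda>x. ?g x * v x + (deriv1 ?g x * v x + ?g x * deriv1 v x))
    = (\<lambda>x. (deriv1 ?g x * v x + ?g x * deriv1 v x) + ((deriv1 (deriv1 ?g) x * v x + deriv1 ?g x * deriv1 v x)
       + (deriv1 ?g x * deriv1 v x + ?g x * deriv1 (deriv1 v) x)))"
    by (simp add: dir_deriv_add dir_deriv_mult smooth_differentiable smooth_mult smooth_add smooth_dir_deriv g v)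
  have "(one_plus_deriv ^^ 2) (\<lambda>x. ?g x * v x) x = (\<Sum>j\<le>2. resolvent_coeff M j x * (deriv1 ^^ j) v x)" for x
  proof -
    have "(one_plus_deriv ^^ 2) (\<lambda>x. ?g x * v x) x = one_plus_deriv (one_plus_deriv (\<lambda>x. ?g x * v x)) x"
      by (simp add: numeral_2_eq_2)
    also have "\<dots> = (?g x * v x + (deriv1 ?g x * v x + ?g x * deriv1 v x))
       + ((deriv1 ?g x * v x + ?g x * deriv1 v x) + ((deriv1 (deriv1 ?g) x * v x + deriv1 ?g x * deriv1 v x)
       + (deriv1 ?g x * deriv1 v x + ?g x * deriv1 (deriv1 v) x)))"
      unfolding 1 unfolding one_plus_deriv_def 2 ..
    also have "\<dots> = (\<Sum>j\<le>2. resolvent_coeff M j x * (deriv1 ^^ j) v x)"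
      by (simp add: numeral_2_eq_2 resolvent_coeff_def Let_def algebra_simps)
    finally show ?thesis .
  qed
  then show ?thesis by (rule ext)
qed

text \<open>The variables are the Taylor parameter \<open>r\<close>, the space variable \<open>z\<close> and the frequency \<open>w\<close>;
  the indices \<open>i\<close> and \<open>j\<close> count the derivatives that fall on the two factors of the amplitude.\<close>
definition osc_kernel :: "nat \<Rightarrow> nat \<Rightarrow> nat \<Rightarrow> nat \<Rightarrow> real \<times> real \<times> real \<Rightarrow> complex" where
  "osc_kernel m M i j = (\<lambda>(r, z, w). of_real (taylor_weight m r * r ^ i)
     * (osc_exp (z, w) * (resolvent z ^ 2 * resolvent_coeff M j w)))"

lemma osc_kernel_measurable [measurable]: "osc_kernel m M i j \<in> borel_measurable borel"
proof -
  have [measurable]: "resolvent_coeff M j \<in> borel_measurable borel" "osc_exp \<in> borel_measurable borel"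
      "resolvent \<in> borel_measurable borel"
    using smooth_borel[OF uamp_smooth[OF amp_resolvent_coeff]] smooth_borel[OF smooth_osc_exp]
      smooth_borel[OF smooth_resolvent] by auto
  show ?thesis unfolding osc_kernel_def split_beta borel_prod[symmetric] by measurable
qed

definition kernel_weight :: "nat \<Rightarrow> real \<times> real \<times> real \<Rightarrow> real" where
  "kernel_weight M = (\<lambda>(r, z, w). indicator {0..1} r * (1 / (1 + \<bar>z\<bar>) ^ 2 * (1 / (1 + \<bar>w\<bar>) ^ M)))"

lemma kernel_weight_nonneg: "0 \<le> kernel_weight M q"
  by (auto simp: kernel_weight_def split: prod.split)

text \<open>Of the \<open>M\<close> powers, \<open>l\<close> compensate the growth and at least 2
  remain for integrability.\<close>

lemma integrable_kernel_weight:
  assumes "l + 2 \<le> M" shows "integrable lborel (\<lambda>q. kernel_weight M q * (1 + \<bar>snd (snd q)\<bar>) ^ l)"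
proof -
  have eq: "1 / (1 + \<bar>w\<bar>) ^ M * (1 + \<bar>w\<bar>) ^ l = 1 / (1 + \<bar>w\<bar>) ^ (M - l)" for w :: real
    using assms by (simp add: power_diff)
  have "integrable lborel (\<lambda>q::real \<times> real \<times> real. (indicator {0..1} (fst q) :: real)
     * (\<lambda>p. 1 / (1 + \<bar>fst p\<bar>) ^ 2 * (1 / (1 + \<bar>snd p\<bar>) ^ (M - l))) (snd q))"
    using assms by (intro integrable_lborel_mult_prod integrable_indicator_unit integrable_weight) auto
  then show ?thesis
    by (simp add: kernel_weight_def split_beta eq[symmetric] mult.assoc)
qed

lemma osc_kernel_bound:
  "\<exists>C\<ge>0. \<forall>q. cmod (osc_kernel m M i j q) \<le> C * kernel_weight M q"
proof -
  obtain C where C: "0 \<le> C" "\<And>w. cmod (resolvent_coeff M j w) \<le> C * (1 / (1 + \<bar>w\<bar>) ^ M)"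
    using bamp_bound[OF amp_resolvent_coeff[of M j]] by auto
  \<comment> \<open>The 4 is the square of the constant 2 in
    \<open>norm_resolvent_le\<close>.\<close>
  have "cmod (osc_kernel m M i j (r, z, w)) \<le> (4 * C) * kernel_weight M (r, z, w)" for r z w
  proof (cases "r \<in> {0..1}")
    case True
    have "cmod (osc_kernel m M i j (r, z, w)) = (\<bar>taylor_weight m r\<bar> * \<bar>r\<bar> ^ i) * (cmod (resolvent z) ^ 2 * cmod (resolvent_coeff M j w))"
      by (simp add: osc_kernel_def norm_mult norm_power power_abs abs_mult)
    also have "\<dots> \<le> (1 * 1) * ((2 * (1 / (1 + \<bar>z\<bar>))) ^ 2 * (C * (1 / (1 + \<bar>w\<bar>) ^ M)))"
      using True taylor_weight_bound[of m r]
      by (intro mult_mono power_mono norm_resolvent_le C power_le_one mult_nonneg_nonneg) auto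
    finally show ?thesis using True by (simp add: kernel_weight_def power_divide power_mult_distrib)
  next
    case False
    then show ?thesis by (simp add: osc_kernel_def taylor_weight_def kernel_weight_def)
  qed
  then show ?thesis using C(1) by (intro exI[of _ "4 * C"]) auto
qed

text \<open>The kernels contain neither \<open>u\<close> nor \<open>v\<close>. When these carry
  parameters, only their derivatives inside the integral have to be differentiated, against fixed
  kernels.\<close>

lemma osc_int_taylor_rem:
  assumes u: "amp (\<lambda>_. 1) u" and v: "amp (\<lambda>x. (1 + \<bar>x\<bar>) ^ l) v" and M: "l + 2 \<le> M"
  shows "osc_int ((opB ^^ 2) ((opA ^^ M) (\<lambda>p. taylor_rem m u (fst p) * (deriv1 ^^ Suc m) v (snd p))))
    = (\<Sum>i\<le>M. \<Sum>j\<le>2. of_nat (M choose i) *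
        (\<integral>q. osc_kernel m M i j q * ((deriv1 ^^ (Suc m + i)) u (fst q * fst (snd q))
            * (deriv1 ^^ (Suc m + j)) v (snd (snd q))) \<partial>lborel))"
proof -
  let ?T = "\<lambda>i j q. osc_kernel m M i j q * ((deriv1 ^^ (Suc m + i)) u (fst q * fst (snd q))
            * (deriv1 ^^ (Suc m + j)) v (snd (snd q)))"
  let ?V = "(deriv1 ^^ Suc m) v"
  have su: "smooth ((deriv1 ^^ k) u)" and sv: "smooth ((deriv1 ^^ k) v)" for k
    by (rule smooth_funpow_dir_deriv[OF uamp_smooth[OF u]], rule smooth_funpow_dir_deriv[OF uamp_smooth[OF v]])
  have int: "integrable lborel (?T i j)" for i j
  proof -
    obtain C where C: "0 \<le> C" "\<And>q. cmod (osc_kernel m M i j q) \<le> C * kernel_weight M q"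
      using osc_kernel_bound by blast
    obtain A where A: "0 \<le> A" "\<And>z. cmod ((deriv1 ^^ (Suc m + i)) u z) \<le> A"
      using bamp_bound[OF bamp_funpow_dir_deriv[OF u, where v=1 and k="Suc m + i"]] by auto
    obtain B where B: "0 \<le> B" "\<And>x. cmod ((deriv1 ^^ (Suc m + j)) v x) \<le> B * (1 + \<bar>x\<bar>) ^ l"
      using bamp_bound[OF bamp_funpow_dir_deriv[OF v, where v=1 and k="Suc m + j"]] by auto
    have [measurable]: "(deriv1 ^^ (Suc m + i)) u \<in> borel_measurable borel" "(deriv1 ^^ (Suc m + j)) v \<in> borel_measurable borel"
      by (rule smooth_borel[OF su], rule smooth_borel[OF sv])
    show ?thesis
    proof (rule Bochner_Integration.integrable_bound[of _ "\<lambda>q. (C * A * B) * (kernel_weight M q * (1 + \<bar>snd (snd q)\<bar>) ^ l)"])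
      show "integrable lborel (\<lambda>q. (C * A * B) * (kernel_weight M q * (1 + \<bar>snd (snd q)\<bar>) ^ l))"
        by (intro integrable_mult_right integrable_kernel_weight M)
      have [measurable]: "(\<lambda>q::real \<times> real \<times> real. fst q * fst (snd q)) \<in> borel_measurable borel"
        "(\<lambda>q::real \<times> real \<times> real. snd (snd q)) \<in> borel_measurable borel"
        by (auto intro!: borel_measurable_continuous_onI continuous_intros)
      show "?T i j \<in> borel_measurable lborel" by measurable
      show "AE q in lborel. norm (?T i j q) \<le> norm ((C * A * B) * (kernel_weight M q * (1 + \<bar>snd (snd q)\<bar>) ^ l))"
      proof (rule AE_I2)
        fix q
        have "norm (?T i j q) \<le> (C * kernel_weight M q) * (A * (B * (1 + \<bar>snd (snd q)\<bar>) ^ l))"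
          unfolding norm_mult
          by (intro mult_mono C A B mult_nonneg_nonneg kernel_weight_nonneg) auto
        then show "norm (?T i j q) \<le> norm ((C * A * B) * (kernel_weight M q * (1 + \<bar>snd (snd q)\<bar>) ^ l))"
          by (simp add: mult_ac)
      qed
    qed
  qed
  have T: "(\<integral>r. ?T i j (r, p) \<partial>lborel) = (osc_exp p * (resolvent (fst p) ^ 2 * resolvent_coeff M j (snd p)))
      * ((deriv1 ^^ i) (taylor_rem m u) (fst p) * (deriv1 ^^ j) ?V (snd p))" for i j p
  proof -
    have "(\<integral>r. ?T i j (r, p) \<partial>lborel) = (\<integral>r. (osc_exp p * (resolvent (fst p) ^ 2 * resolvent_coeff M j (snd p)) * (deriv1 ^^ (Suc m + j)) v (snd p))
       * (of_real (taylor_weight m r * r ^ i) * (deriv1 ^^ (Suc m + i)) u (r * fst p)) \<partial>lborel)"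
      by (intro Bochner_Integration.integral_cong refl) (simp add: osc_kernel_def split_beta mult_ac)
    also have "\<dots> = (osc_exp p * (resolvent (fst p) ^ 2 * resolvent_coeff M j (snd p)) * (deriv1 ^^ (Suc m + j)) v (snd p))
        * (deriv1 ^^ i) (taylor_rem m u) (fst p)"
      by (simp only: integral_mult_right_zero amp_taylor_rem(2)[OF u])
    finally have *: "(\<integral>r. ?T i j (r, p) \<partial>lborel) = (osc_exp p * (resolvent (fst p) ^ 2 * resolvent_coeff M j (snd p)) * (deriv1 ^^ (Suc m + j)) v (snd p))
        * (deriv1 ^^ i) (taylor_rem m u) (fst p)" .
    have "(deriv1 ^^ (Suc m + j)) v = (deriv1 ^^ j) ?V"
      by (metis add.commute funpow_add o_apply)
    then show ?thesis unfolding * by (simp only: mult_ac)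
  qed
  have intp: "integrable lborel (\<lambda>p. \<integral>r. ?T i j (r, p) \<partial>lborel)" for i j
    using lborel_pair.integrable_snd[of "curry (?T i j)"] int[of i j] by (simp add: lborel_prod)
  have "osc_int ((opB ^^ 2) ((opA ^^ M) (\<lambda>p. taylor_rem m u (fst p) * ?V (snd p))))
    = (\<integral>p. (\<Sum>i\<le>M. \<Sum>j\<le>2. of_nat (M choose i) * (\<integral>r. ?T i j (r, p) \<partial>lborel)) \<partial>lborel)"
    unfolding osc_int_def ops_tensor[OF uamp_smooth[OF amp_taylor_rem(1)[OF u]] sv]
  proof (rule Bochner_Integration.integral_cong[OF refl])
    fix p
    show "osc_exp p * (resolvent (fst p) ^ 2 * (one_plus_deriv ^^ M) (taylor_rem m u) (fst p)
       * (one_plus_deriv ^^ 2) (\<lambda>x. resolvent x ^ M * ?V x) (snd p))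
      = (\<Sum>i\<le>M. \<Sum>j\<le>2. of_nat (M choose i) * (\<integral>r. ?T i j (r, p) \<partial>lborel))"
      unfolding one_plus_deriv_sum[OF uamp_smooth[OF amp_taylor_rem(1)[OF u]]]
        one_plus_deriv_sq_resolvent_mult[OF sv] T
      by (simp only: sum_distrib_left sum_distrib_right mult_ac)
  qed
  also have "\<dots> = (\<Sum>i\<le>M. \<Sum>j\<le>2. of_nat (M choose i) * (\<integral>p. (\<integral>r. ?T i j (r, p) \<partial>lborel) \<partial>lborel))"
    using intp by (simp only: Bochner_Integration.integral_sum Bochner_Integration.integrable_sum
        integrable_mult_right integral_mult_right_zero)
  also have "\<dots> = (\<Sum>i\<le>M. \<Sum>j\<le>2. of_nat (M choose i) * (\<integral>q. ?T i j q \<partial>lborel))"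
    by (simp only: lborel_integral_snd[OF int])
  finally show ?thesis .
qed

section \<open>Symbol classes\<close>

text \<open>Since directional derivatives of a smooth function commute, only the multiset of
  directions matters.\<close>

lemma iter_deriv_perm:
  assumes "smooth f" "mset w = mset w'" shows "iter_deriv w f = iter_deriv w' f"
  using assms(2)
proof (induction w arbitrary: w')
  case (Cons v w)
  then have "v \<in> set w'" by (metis list.set_intros(1) mset_eq_setD)
  then obtain xs ys where w': "w' = xs @ v # ys" by (meson split_list)
  then have "mset w = mset (xs @ ys)" using Cons.prems by simp
  then have "iter_deriv w f = iter_deriv (xs @ ys) f" by (rule Cons.IH)
  then show ?case
    by (simp add: w' iter_deriv_dir_deriv_commute smooth_iter_deriv assms(1))
qed simp

lemma mset_concat_replicate_count:
  assumes "distinct es" "set w \<subseteq> set es"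
  shows "mset w = mset (concat (map (\<lambda>e. replicate (count (mset w) e) e) es))"
proof -
  have "mset w = (\<Sum>e\<in>set es. replicate_mset (count (mset w) e) e)"
  proof (rule multiset_eqI)
    fix x
    have "count (\<Sum>e\<in>set es. replicate_mset (count (mset w) e) e) x
       = (\<Sum>e\<in>set es. if e = x then count (mset w) x else 0)"
      by (simp add: count_sum if_distrib cong: if_cong)
    also have "\<dots> = (if x \<in> set es then count (mset w) x else 0)" by simp
    also have "\<dots> = count (mset w) x" using assms(2) by (auto simp: count_eq_zero_iff)
    finally show "count (mset w) x = count (\<Sum>e\<in>set es. replicate_mset (count (mset w) e) e) x" by simp
  qed
  also have "\<dots> = mset (concat (map (\<lambda>e. replicate (count (mset w) e) e) es))"
    using assms(1) by (simp add: mset_concat sum_list_distinct_conv_sum_set o_def)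
  finally show ?thesis .
qed

lemma prod_list_map_perm:
  fixes f :: "'a \<Rightarrow> real"
  assumes "mset w = mset w'" shows "(\<Prod>e\<leftarrow>w. f e) = (\<Prod>e\<leftarrow>w'. f e)"
  using assms by (metis mset_map prod_mset_prod_list)

text \<open>By symmetry of the mixed derivatives it suffices to bound the sorted words.\<close>
lemma uamp_sortedI:
  assumes sm: "smooth f" and es: "distinct es"
    and bd: "\<And>n. \<exists>C. \<forall>p. cmod (iter_deriv (concat (map (\<lambda>e. replicate (n e) e) es)) f p)
        \<le> C * W p * (\<Prod>e\<leftarrow>concat (map (\<lambda>e. replicate (n e) e) es). \<kappa> e p)"
  shows "uamp (set es) (\<lambda>e _. \<kappa> e) (\<lambda>_::unit. W) (\<lambda>_. f)"
  unfolding uamp_def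
proof (intro conjI allI impI)
  fix w assume w: "set w \<subseteq> set es"
  note eq = mset_concat_replicate_count[OF es w]
  show "\<exists>C. \<forall>q p. cmod (iter_deriv w f p) \<le> C * W p * (\<Prod>e\<leftarrow>w. \<kappa> e p)"
    using bd[of "count (mset w)"]
    unfolding iter_deriv_perm[OF sm eq, symmetric] prod_list_map_perm[OF eq, symmetric] by blast
qed (rule sm)

text \<open>\<open>S_class\<close> recast as an amplitude class: one gain per frequency derivative,
  in any order of differentiation, makes the general Leibniz rule available.\<close>

definition lin_symbol :: "real \<Rightarrow> (real \<times> real \<Rightarrow> complex) \<Rightarrow> bool" where
  "lin_symbol t \<tau> \<longleftrightarrow> uamp {(1, 0), (0, 1)} (\<lambda>e _ p. if e = (0, 1) then 1 / (1 + \<bar>snd p\<bar>) else 1)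
     (\<lambda>_::unit. \<lambda>p. (1 + \<bar>snd p\<bar>) powr t) (\<lambda>_. \<tau>)"

lemma powr_diff_nat: "0 < a \<Longrightarrow> a powr (t - real b) = a powr t * (1 / a) ^ b" for a :: real
  by (simp add: powr_diff powr_realpow power_divide)

lemma S_class_lin_symbol:
  assumes "\<tau> \<in> S_class t" shows "lin_symbol t \<tau>"
proof -
  have sm: "smooth \<tau>" using assms by (simp add: S_class_def)
  have "uamp (set [(1, 0), (0, 1)]) (\<lambda>e _ p. if e = (0, 1) then 1 / (1 + \<bar>snd p\<bar>) else 1)
     (\<lambda>_::unit. \<lambda>p. (1 + \<bar>snd p\<bar>) powr t) (\<lambda>_. \<tau>)"
  proof (rule uamp_sortedI[OF sm])
    fix n :: "real \<times> real \<Rightarrow> nat"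
    obtain C where C: "\<And>x \<xi>. cmod ((lin_dx ^^ n (1, 0)) ((lin_dxi ^^ n (0, 1)) \<tau>) (x, \<xi>))
       \<le> C * (1 + \<bar>\<xi>\<bar>) powr (t - real (n (0, 1)))"
      using assms unfolding S_class_def by blast
    have "cmod (iter_deriv (concat (map (\<lambda>e. replicate (n e) e) [(1, 0), (0, 1)])) \<tau> (x, \<xi>))
        \<le> C * (1 + \<bar>snd (x, \<xi>)\<bar>) powr t *
          (\<Prod>e\<leftarrow>concat (map (\<lambda>e. replicate (n e) e) [(1, 0), (0, 1)]). if e = (0, 1) then 1 / (1 + \<bar>snd (x, \<xi>)\<bar>) else 1)" for x \<xi>
      using C[of x \<xi>] powr_diff_nat[of "1 + \<bar>\<xi>\<bar>" t "n (0, 1)"]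
      by (simp add: lin_dx_def lin_dxi_def add_pos_nonneg mult.assoc prod_list_replicate)
    then show "\<exists>C. \<forall>p. cmod (iter_deriv (concat (map (\<lambda>e. replicate (n e) e) [(1, 0), (0, 1)])) \<tau> p)
        \<le> C * (1 + \<bar>snd p\<bar>) powr t *
          (\<Prod>e\<leftarrow>concat (map (\<lambda>e. replicate (n e) e) [(1, 0), (0, 1)]). if e = (0, 1) then 1 / (1 + \<bar>snd p\<bar>) else 1)"
      by auto
  qed simp
  then show ?thesis by (simp add: lin_symbol_def)
qed

lemma lin_symbol_smooth: "lin_symbol t \<tau> \<Longrightarrow> smooth \<tau>"
  unfolding lin_symbol_def by (rule uamp_smooth)

lemma lin_symbol_mono:
  assumes "lin_symbol t \<tau>" "t \<le> t'" shows "lin_symbol t' \<tau>"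
  unfolding lin_symbol_def
  by (rule uamp_mono[OF assms(1)[unfolded lin_symbol_def], where B=1])
     (auto intro!: powr_mono assms)

lemma lin_symbol_dxi:
  assumes "lin_symbol t \<tau>" shows "lin_symbol (t - 1) (lin_dxi \<tau>)"
proof -
  have "(1 + \<bar>x\<bar>) powr t * (1 / (1 + \<bar>x\<bar>)) = (1 + \<bar>x\<bar>) powr (t - 1)" for x :: real
    using powr_diff_nat[of "1 + \<bar>x\<bar>" t 1] by (simp add: add_pos_nonneg)
  then show ?thesis
    using uamp_deriv[OF assms[unfolded lin_symbol_def], of "(0, 1)"]
    by (simp add: lin_symbol_def lin_dxi_def)
qed

lemma lin_symbol_dxi_power:
  assumes "lin_symbol t \<tau>" shows "lin_symbol (t - real k) ((lin_dxi ^^ k) \<tau>)"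
proof (induction k)
  case (Suc k)
  show ?case using lin_symbol_dxi[OF Suc] by (simp add: algebra_simps)
qed (simp add: assms)

lemma Basis_prod_real: "(Basis :: (real \<times> real) set) = {(1, 0), (0, 1)}"
  by (auto simp: Basis_prod_def zero_prod_def)

lemma Basis_prod_real3: "(Basis :: (real \<times> real \<times> real) set) = {(1, 0, 0), (0, 1, 0), (0, 0, 1)}"
  by (auto simp: Basis_prod_def zero_prod_def)

lemma lin_symbol_amp:
  assumes "lin_symbol t \<tau>" shows "amp (\<lambda>p. (1 + \<bar>snd p\<bar>) powr t) \<tau>"
  unfolding Basis_prod_real
  by (rule uamp_mono[OF assms[unfolded lin_symbol_def], where B=1]) (auto simp: field_simps)

text \<open>Peetre's inequality. For nonnegative t it is the submultiplicativity of 1 + |x|; for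
  negative t the same bound is applied to s = (s + x) - x and inverted.\<close>

lemma peetre: "(1 + \<bar>s + x\<bar>) powr t \<le> (1 + \<bar>s\<bar>) powr t * (1 + \<bar>x\<bar>) powr \<bar>t\<bar>" for s x t :: real
proof (cases "0 \<le> t")
  case True
  have "1 + \<bar>s + x\<bar> \<le> (1 + \<bar>s\<bar>) * (1 + \<bar>x\<bar>)"
    unfolding distrib_left distrib_right mult_1 mult_1_right
    using abs_triangle_ineq[of s x] mult_nonneg_nonneg[of "\<bar>s\<bar>" "\<bar>x\<bar>"] by linarith
  then have "(1 + \<bar>s + x\<bar>) powr t \<le> ((1 + \<bar>s\<bar>) * (1 + \<bar>x\<bar>)) powr t"
    using True by (intro powr_mono2) auto
  then show ?thesis using True by (simp add: powr_mult)
next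
  case False
  have "1 + \<bar>s\<bar> \<le> (1 + \<bar>s + x\<bar>) * (1 + \<bar>x\<bar>)"
    unfolding distrib_left distrib_right mult_1 mult_1_right
    using abs_triangle_ineq4[of "s + x" x] mult_nonneg_nonneg[OF abs_ge_zero[of "s + x"] abs_ge_zero[of x]] by linarith
  then have "(1 + \<bar>s\<bar>) powr (- t) \<le> ((1 + \<bar>s + x\<bar>) * (1 + \<bar>x\<bar>)) powr (- t)"
    using False by (intro powr_mono2) auto
  then have "(1 + \<bar>s\<bar>) powr (- t) \<le> (1 + \<bar>s + x\<bar>) powr (- t) * (1 + \<bar>x\<bar>) powr (- t)"
    by (simp add: powr_mult)
  \<comment> \<open>Multiplying by the powers with exponent t of both weights turns the inequality
    between the reciprocals around.\<close>
  then have "(1 + \<bar>s + x\<bar>) powr t * (1 + \<bar>s\<bar>) powr t * (1 + \<bar>s\<bar>) powr (- t)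
     \<le> (1 + \<bar>s + x\<bar>) powr t * (1 + \<bar>s\<bar>) powr t * ((1 + \<bar>s + x\<bar>) powr (- t) * (1 + \<bar>x\<bar>) powr (- t))"
    by (intro mult_left_mono) auto
  also have "\<dots> = ((1 + \<bar>s + x\<bar>) powr t * (1 + \<bar>s + x\<bar>) powr (- t)) * ((1 + \<bar>s\<bar>) powr t * (1 + \<bar>x\<bar>) powr (- t))"
    by (simp only: mult_ac)
  also have "(1 + \<bar>s + x\<bar>) powr t * (1 + \<bar>s\<bar>) powr t * (1 + \<bar>s\<bar>) powr (- t)
     = (1 + \<bar>s + x\<bar>) powr t"
    by (simp add: mult.assoc flip: powr_add)
  also have "(1 + \<bar>s + x\<bar>) powr t * (1 + \<bar>s + x\<bar>) powr (- t) = 1"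
    by (simp flip: powr_add)
  finally show ?thesis using False by simp
qed

lemma peetre_nat:
  fixes s x t :: real
  assumes "\<bar>t\<bar> \<le> real l"
  shows "(1 + \<bar>s + x\<bar>) powr t \<le> (1 + \<bar>s\<bar>) powr t * (1 + \<bar>x\<bar>) ^ l"
proof -
  have "(1 + \<bar>x\<bar>) powr \<bar>t\<bar> \<le> (1 + \<bar>x\<bar>) powr real l" using assms by (intro powr_mono) auto
  also have "\<dots> = (1 + \<bar>x\<bar>) ^ l" by (simp add: powr_realpow add_pos_nonneg)
  finally show ?thesis by (intro order_trans[OF peetre] mult_left_mono) auto
qed

section \<open>Bilinear symbols in two given frequency directions\<close>

lemma iter_deriv_zero_vec: "0 \<in> set w \<Longrightarrow> smooth f \<Longrightarrow> iter_deriv w f = (\<lambda>_. 0)"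
  by (induction w) auto

text \<open>At a point this is alpha + beta; for a direction it is the rate at which alpha + beta
  changes along it.\<close>

abbreviation freq :: "real \<times> real \<times> real \<Rightarrow> real" where
  "freq p \<equiv> fst (snd p) + snd (snd p)"

text \<open>Treats both symbol classes at once. A frequency direction either leaves alpha + beta
  fixed and annihilates \<tau>, or moves it at unit speed with a gain no stronger than 1 / (1 +
  |alpha + beta|), which the derivative of \<tau> provides. The span condition recovers the
  coordinate derivatives.\<close>

locale symbol_directions =
  fixes e1 e2 :: "real \<times> real \<times> real" and U V :: "real \<times> real \<Rightarrow> real"
  assumes fst_e: "fst e1 = 0" "fst e2 = 0" and e_neq: "e1 \<noteq> e2"
    and span_e: "(Basis :: (real \<times> real \<times> real) set) \<subseteq> span {(1, 0, 0), e1, e2}"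
    and U_ge: "\<And>p. 1 \<le> U p" and V_ge: "\<And>p. 1 \<le> V p"
    and freq_e1: "freq e1 = 0 \<or> freq e1 = 1 \<and> (\<forall>p. U p \<le> 1 + \<bar>fst p + snd p\<bar>)"
    and freq_e2: "freq e2 = 0 \<or> freq e2 = 1 \<and> (\<forall>p. V p \<le> 1 + \<bar>fst p + snd p\<bar>)"
begin

definition gain :: "real \<times> real \<times> real \<Rightarrow> real \<times> real \<times> real \<Rightarrow> real" where
  "gain e p = (if e = e1 then 1 / U (snd p) else if e = e2 then 1 / V (snd p) else 1)"

abbreviation dirs :: "(real \<times> real \<times> real) set" where "dirs \<equiv> {(1, 0, 0), e1, e2}"

text \<open>Weight and gains depend on the frequencies alone, so translating \<sigma> in x preserves
  all estimates.\<close>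

definition bil_symbol :: "(real \<times> real \<Rightarrow> real) \<Rightarrow> (real \<times> real \<times> real \<Rightarrow> complex) \<Rightarrow> bool" where
  "bil_symbol W \<sigma> \<longleftrightarrow> uamp dirs (\<lambda>e _. gain e) (\<lambda>_::unit. \<lambda>p. W (snd p)) (\<lambda>_. \<sigma>)"

lemma gain_nonneg: "0 \<le> gain e p"
  using U_ge[of "snd p"] V_ge[of "snd p"] by (simp add: gain_def)

lemma gain_le_1: "gain e p \<le> 1"
  using U_ge[of "snd p"] V_ge[of "snd p"] by (simp add: gain_def)

lemma e_neq_dx: "(1, 0, 0) \<noteq> e1" "(1, 0, 0) \<noteq> e2"
  using fst_e by auto

lemma gain_dx [simp]: "gain (1, 0, 0) p = 1"
  using e_neq_dx by (simp add: gain_def)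

lemma bil_symbol_smooth: "bil_symbol W \<sigma> \<Longrightarrow> smooth \<sigma>"
  unfolding bil_symbol_def by (rule uamp_smooth)

lemma bil_symbol_dx_power: "bil_symbol W \<sigma> \<Longrightarrow> bil_symbol W ((bil_dx ^^ k) \<sigma>)"
proof (induction k)
  case (Suc k)
  have "uamp dirs (\<lambda>e _. gain e) (\<lambda>_::unit. \<lambda>p. W (snd p) * gain (1, 0, 0) p)
     (\<lambda>_. dir_deriv (1, 0, 0) ((bil_dx ^^ k) \<sigma>))"
    using Suc by (intro uamp_deriv) (auto simp: bil_symbol_def)
  then show ?case by (simp add: bil_symbol_def bil_dx_def)
qed simp

lemma bil_symbol_amp:
  assumes "bil_symbol W \<sigma>" "\<And>p. 0 \<le> W p"
  shows "amp (\<lambda>p. W (snd p)) \<sigma>"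
proof (rule uamp_change_directions[OF _ span_e])
  show "uamp dirs (\<lambda>_ _ _. 1) (\<lambda>_::unit. \<lambda>p. W (snd p)) (\<lambda>_. \<sigma>)"
    by (rule uamp_mono[OF assms(1)[unfolded bil_symbol_def], where B=1])
       (auto simp: gain_nonneg gain_le_1 assms)
qed

lemma bil_symbol_add:
  "bil_symbol W \<sigma> \<Longrightarrow> bil_symbol W \<rho> \<Longrightarrow> bil_symbol W (\<lambda>p. \<sigma> p + \<rho> p)"
  unfolding bil_symbol_def by (rule uamp_add)

lemma bounded_linear_freq: "bounded_linear (\<lambda>p::real \<times> real \<times> real. (fst p, freq p))"
  by (intro bounded_linear_Pair bounded_linear_add bounded_linear_fst bounded_linear_snd
      bounded_linear_compose[OF bounded_linear_fst] bounded_linear_compose[OF bounded_linear_snd])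

text \<open>A derivative of \<tau> gains relative to the shifted frequency alpha + beta + \<omega>.
  Returning to alpha + beta costs a factor 1 + |\<omega>| per derivative, and \<open>l\<close>
  further such factors for the weight by Peetre's inequality.\<close>

lemma lin_symbol_freq:
  assumes \<tau>: "lin_symbol t \<tau>" and l: "\<bar>t\<bar> \<le> real l"
  shows "uamp dirs (\<lambda>e \<omega> p. (1 + \<bar>\<omega>\<bar>) * gain e p)
     (\<lambda>\<omega> p. (1 + \<bar>freq p\<bar>) powr t * (1 + \<bar>\<omega>\<bar>) ^ l) (\<lambda>\<omega> p. \<tau> (fst p, freq p + \<omega>))"
proof -
  let ?L = "\<lambda>p::real \<times> real \<times> real. (fst p, freq p)"
  let ?\<kappa> = "\<lambda>e p. if e = (0, 1) then 1 / (1 + \<bar>snd p :: real\<bar>) else (1::real)"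
  note sm = lin_symbol_smooth[OF \<tau>]
  have eq: "\<tau> (fst p, freq p + \<omega>) = \<tau> (?L p + (0, \<omega>))" for p \<omega> by simp
  have it: "iter_deriv w (\<lambda>p. \<tau> (?L p + (0, \<omega>))) = (\<lambda>p. iter_deriv (map ?L w) \<tau> (?L p + (0, \<omega>)))" for w \<omega>
    by (rule iter_deriv_affine[OF sm bounded_linear_freq])
  have Le: "?L e = 0 \<or> ?L e \<in> {(1, 0), (0, 1)} \<and> (\<forall>p \<omega>. ?\<kappa> (?L e) (?L p + (0, \<omega>)) \<le> (1 + \<bar>\<omega>\<bar>) * gain e p)"
    if e: "e \<in> dirs" for e
  proof -
    \<comment> \<open>Both directions reduce to B \<le> 1 + |s| \<le> (1 + |\<omega>|) (1 + |s +
      \<omega>|) with s = \<open>freq p\<close>.\<close>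
    have step: "1 / (1 + \<bar>freq p + \<omega>\<bar>) \<le> (1 + \<bar>\<omega>\<bar>) * (1 / B)" if "1 \<le> B" "B \<le> 1 + \<bar>freq p\<bar>" for B p \<omega>
    proof -
      have "B \<le> (1 + \<bar>\<omega>\<bar>) * (1 + \<bar>freq p + \<omega>\<bar>)"
        unfolding distrib_left distrib_right mult_1 mult_1_right
        using that abs_triangle_ineq4[of "freq p + \<omega>" \<omega>] mult_nonneg_nonneg[of "\<bar>\<omega>\<bar>" "\<bar>freq p + \<omega>\<bar>"]
        by linarith
      then show ?thesis using that by (simp add: divide_simps mult.commute)
    qed
    consider "e = (1, 0, 0)" | "e = e1" | "e = e2" using e by blast
    then show ?thesis
    proof cases
      case 1
      then show ?thesis by simp
    next
      case 2
      have "1 / (1 + \<bar>freq p + \<omega>\<bar>) \<le> (1 + \<bar>\<omega>\<bar>) * (1 / U (snd p))" if "freq e1 \<noteq> 0" for p \<omega>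
      proof (rule step[OF U_ge])
        have "\<forall>p. U p \<le> 1 + \<bar>fst p + snd p\<bar>" using freq_e1 that by blast
        then show "U (snd p) \<le> 1 + \<bar>freq p\<bar>" by blast
      qed
      then show ?thesis
        using 2 freq_e1 fst_e by (auto simp: gain_def zero_prod_def)
    next
      case 3
      have "1 / (1 + \<bar>freq p + \<omega>\<bar>) \<le> (1 + \<bar>\<omega>\<bar>) * (1 / V (snd p))" if "freq e2 \<noteq> 0" for p \<omega>
      proof (rule step[OF V_ge])
        have "\<forall>p. V p \<le> 1 + \<bar>fst p + snd p\<bar>" using freq_e2 that by blast
        then show "V (snd p) \<le> 1 + \<bar>freq p\<bar>" by blast
      qed
      then show ?thesis
        using 3 freq_e2 fst_e e_neq by (auto simp: gain_def zero_prod_def)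
    qed
  qed
  show ?thesis
    unfolding uamp_def eq it
  proof (intro conjI allI impI)
    show "smooth (\<lambda>p. \<tau> (?L p + (0, \<omega>)))" for \<omega> by (rule smooth_affine[OF sm bounded_linear_freq])
    fix w :: "(real \<times> real \<times> real) list" assume w: "set w \<subseteq> dirs"
    show "\<exists>C. \<forall>\<omega> p. cmod (iter_deriv (map ?L w) \<tau> (?L p + (0, \<omega>)))
       \<le> C * ((1 + \<bar>freq p\<bar>) powr t * (1 + \<bar>\<omega>\<bar>) ^ l) * (\<Prod>e\<leftarrow>w. (1 + \<bar>\<omega>\<bar>) * gain e p)"
    proof (cases "0 \<in> set (map ?L w)")
      \<comment> \<open>A direction along which x and alpha + beta are both constant annihilates the
        composition.\<close>
      case True
      then show ?thesis by (intro exI[of _ 0]) (simp only: iter_deriv_zero_vec[OF True sm] norm_zero mult_zero_left order_refl simp_thms)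
    next
      case False
      then have w': "set (map ?L w) \<subseteq> {(1, 0), (0, 1)}" and
        \<kappa>: "\<And>e p \<omega>. e \<in> set w \<Longrightarrow> ?\<kappa> (?L e) (?L p + (0, \<omega>)) \<le> (1 + \<bar>\<omega>\<bar>) * gain e p"
      proof -
        have ne: "?L e \<noteq> 0" if "e \<in> set w" for e using False that by (metis (no_types, lifting) image_eqI list.set_map)
        show "set (map ?L w) \<subseteq> {(1, 0), (0, 1)}"
          unfolding set_map by (rule image_subsetI) (use Le ne w in blast)
        show "?\<kappa> (?L e) (?L p + (0, \<omega>)) \<le> (1 + \<bar>\<omega>\<bar>) * gain e p" if "e \<in> set w" for e p \<omega>
          using Le[of e] ne[OF that] w that by blast
      qed
      obtain C where C: "0 \<le> C" "\<And>p. cmod (iter_deriv (map ?L w) \<tau> p)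
          \<le> C * (1 + \<bar>snd p\<bar>) powr t * (\<Prod>e\<leftarrow>map ?L w. ?\<kappa> e p)"
        by (rule uampD_nonneg[OF \<tau>[unfolded lin_symbol_def] w']) auto
      have pr: "0 \<le> (\<Prod>e\<leftarrow>map ?L w. ?\<kappa> e (?L p + (0, \<omega>))) \<and>
          (\<Prod>e\<leftarrow>map ?L w. ?\<kappa> e (?L p + (0, \<omega>))) \<le> (\<Prod>e\<leftarrow>w. (1 + \<bar>\<omega>\<bar>) * gain e p)" for p \<omega>
        using \<kappa>
      proof (induction w)
        case (Cons e w)
        then have "0 \<le> (\<Prod>e\<leftarrow>map ?L w. ?\<kappa> e (?L p + (0, \<omega>)))"
          "(\<Prod>e\<leftarrow>map ?L w. ?\<kappa> e (?L p + (0, \<omega>))) \<le> (\<Prod>e\<leftarrow>w. (1 + \<bar>\<omega>\<bar>) * gain e p)" by auto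
        moreover have "?\<kappa> (?L e) (?L p + (0, \<omega>)) \<le> (1 + \<bar>\<omega>\<bar>) * gain e p" using Cons.prems by simp
        moreover have "0 \<le> ?\<kappa> (?L e) (?L p + (0, \<omega>))" by simp
        ultimately show ?case
          unfolding list.map prod_list.Cons by (intro conjI mult_nonneg_nonneg mult_mono) (auto simp: gain_nonneg)
      qed simp
      have "cmod (iter_deriv (map ?L w) \<tau> (?L p + (0, \<omega>)))
         \<le> C * ((1 + \<bar>freq p\<bar>) powr t * (1 + \<bar>\<omega>\<bar>) ^ l) * (\<Prod>e\<leftarrow>w. (1 + \<bar>\<omega>\<bar>) * gain e p)" for p \<omega>
      proof (rule order_trans[OF C(2)])
        show "C * (1 + \<bar>snd (?L p + (0, \<omega>))\<bar>) powr t * (\<Prod>e\<leftarrow>map ?L w. ?\<kappa> e (?L p + (0, \<omega>)))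
          \<le> C * ((1 + \<bar>freq p\<bar>) powr t * (1 + \<bar>\<omega>\<bar>) ^ l) * (\<Prod>e\<leftarrow>w. (1 + \<bar>\<omega>\<bar>) * gain e p)"
          using pr[of p \<omega>] peetre_nat[OF l, of "freq p" \<omega>] C(1)
          by (intro mult_mono mult_left_mono mult_nonneg_nonneg) auto
      qed
      then show ?thesis by blast
    qed
  qed
qed

lemma bil_symbol_mult_lin_symbol:
  assumes \<sigma>: "bil_symbol W \<sigma>" and \<tau>: "lin_symbol t \<tau>"
  shows "bil_symbol (\<lambda>p. W p * (1 + \<bar>fst p + snd p\<bar>) powr t) (\<lambda>p. \<sigma> p * \<tau> (fst p, freq p))"
proof -
  obtain l :: nat where l: "\<bar>t\<bar> \<le> real l" using real_arch_simple by blast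
  have "uamp dirs (\<lambda>e _. gain e) (\<lambda>_::unit. \<lambda>p. (1 + \<bar>freq p\<bar>) powr t) (\<lambda>_ p. \<tau> (fst p, freq p))"
    using uamp_reindex[OF lin_symbol_freq[OF \<tau> l], of "\<lambda>_::unit. 0"] by simp
  from uamp_mult[OF \<sigma>[unfolded bil_symbol_def] this] show ?thesis by (simp add: bil_symbol_def)
qed

text \<open>With q = (r, z, w), the point x of \<sigma> moves by r z and the frequency of \<tau> by
  w. Remainders are finite sums of such averages.\<close>

definition kernel_op :: "(real \<times> real \<times> real \<Rightarrow> complex) \<Rightarrow> (real \<times> real \<times> real \<Rightarrow> complex) \<Rightarrow>
    (real \<times> real \<Rightarrow> complex) \<Rightarrow> real \<times> real \<times> real \<Rightarrow> complex" where
  "kernel_op h \<sigma> \<tau> p = (\<integral>q. h q * (\<sigma> (p + (fst q * fst (snd q), 0)) * \<tau> (fst p, freq p + snd (snd q))) \<partial>lborel)"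

text \<open>The exponent \<open>M\<close> pays \<open>l\<close> for Peetre's inequality, up to
  \<open>n\<close> for the derivatives and 2 for integrability. Hence the sharp bound covers words
  of length at most \<open>n\<close>, whereas smoothness follows from bounds without gains, whose
  cost in w does not grow with the number of derivatives.\<close>

lemma kernel_op_bound:
  assumes \<sigma>: "bil_symbol W \<sigma>" and W: "\<And>p. 0 \<le> W p" "continuous_on UNIV W"
    and \<tau>: "lin_symbol t \<tau>" and l: "\<bar>t\<bar> \<le> real l"
    and h: "h \<in> borel_measurable borel" "\<And>q. cmod (h q) \<le> C * kernel_weight M q" "0 \<le> C" and M: "l + n + 2 \<le> M"
  shows "smooth (kernel_op h \<sigma> \<tau>)"
    and "set w \<subseteq> dirs \<Longrightarrow> length w \<le> n \<Longrightarrow> \<exists>D. \<forall>p. cmod (iter_deriv w (kernel_op h \<sigma> \<tau>) p)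
          \<le> D * (W (snd p) * (1 + \<bar>freq p\<bar>) powr t) * (\<Prod>e\<leftarrow>w. gain e p)"
proof -
  let ?Z = "\<lambda>q::real \<times> real \<times> real. (fst q * fst (snd q), 0::real \<times> real)" and ?\<omega> = "\<lambda>q::real \<times> real \<times> real. snd (snd q)"
  let ?f = "\<lambda>q p. h q * (\<sigma> (p + ?Z q) * \<tau> (fst p, freq p + ?\<omega> q))"
  let ?V = "\<lambda>p. W (snd p) * (1 + \<bar>freq p\<bar>) powr t"
  note sm\<sigma> = bil_symbol_smooth[OF \<sigma>] and sm\<tau> = lin_symbol_smooth[OF \<tau>]
  have \<sigma>q: "uamp dirs (\<lambda>e q p. (1 + \<bar>?\<omega> q\<bar>) * gain e p) (\<lambda>q p. W (snd p)) (\<lambda>q p. \<sigma> (p + ?Z q))"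
    unfolding uamp_def
  proof (intro conjI allI impI)
    show "smooth (\<lambda>p. \<sigma> (p + ?Z q))" for q by (rule smooth_affine[OF sm\<sigma> bounded_linear_ident])
    fix w assume w: "set w \<subseteq> dirs"
    obtain A where A: "0 \<le> A" "\<And>p. cmod (iter_deriv w \<sigma> p) \<le> A * W (snd p) * (\<Prod>e\<leftarrow>w. gain e p)"
      by (rule uampD_nonneg[OF \<sigma>[unfolded bil_symbol_def] w]) (auto simp: W gain_nonneg)
    have "cmod (iter_deriv w (\<lambda>p. \<sigma> (p + ?Z q)) p) \<le> A * W (snd p) * (\<Prod>e\<leftarrow>w. (1 + \<bar>?\<omega> q\<bar>) * gain e p)" for q p
    proof -
      have g: "gain e (p + ?Z q) = gain e p" for e by (simp add: gain_def)
      have pr: "0 \<le> (\<Prod>e\<leftarrow>w. gain e p) \<and> (\<Prod>e\<leftarrow>w. gain e p) \<le> (\<Prod>e\<leftarrow>w. (1 + \<bar>?\<omega> q\<bar>) * gain e p)"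
      proof (induction w)
        case (Cons e w)
        have "1 * gain e p \<le> (1 + \<bar>?\<omega> q\<bar>) * gain e p" by (intro mult_right_mono gain_nonneg) simp
        then show ?case
          using Cons gain_nonneg[of e p] unfolding list.map prod_list.Cons
          by (intro conjI mult_nonneg_nonneg mult_mono) auto
      qed simp
      have "cmod (iter_deriv w (\<lambda>p. \<sigma> (p + ?Z q)) p) \<le> A * W (snd p) * (\<Prod>e\<leftarrow>w. gain e p)"
        using A(2)[of "p + ?Z q"] iter_deriv_affine[OF sm\<sigma> bounded_linear_ident, of w "?Z q"] by (simp add: g)
      also have "\<dots> \<le> A * W (snd p) * (\<Prod>e\<leftarrow>w. (1 + \<bar>?\<omega> q\<bar>) * gain e p)"
        using pr A(1) W by (intro mult_left_mono) auto
      finally show ?thesis .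
    qed
    then show "\<exists>A. \<forall>q p. cmod (iter_deriv w (\<lambda>p. \<sigma> (p + ?Z q)) p) \<le> A * W (snd p) * (\<Prod>e\<leftarrow>w. (1 + \<bar>?\<omega> q\<bar>) * gain e p)"
      by blast
  qed
  \<comment> \<open>Keeps the gains, at the price of a factor 1 + |w| per derivative.\<close>
  have fine: "uamp dirs (\<lambda>e q p. (1 + \<bar>?\<omega> q\<bar>) * gain e p)
     (\<lambda>q p. cmod (h q) * (W (snd p) * ((1 + \<bar>freq p\<bar>) powr t * (1 + \<bar>?\<omega> q\<bar>) ^ l))) ?f"
    by (rule uamp_scale[OF uamp_mult[OF \<sigma>q uamp_reindex[OF lin_symbol_freq[OF \<tau> l], of ?\<omega>]]])
  \<comment> \<open>Drops the gains: the majorant then has the same power of 1 + |w| for all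
    derivatives, which justifies differentiating under the integral arbitrarily often.\<close>
  have coarse: "bamp (\<lambda>q p. C * kernel_weight M q * (1 + \<bar>?\<omega> q\<bar>) ^ l * ?V p) ?f"
  proof (rule bamp_mono[where B=1])
    have "bamp (\<lambda>q p. W (snd (p + ?Z q))) (\<lambda>q p. \<sigma> (p + ?Z q))"
      using bamp_affine[OF bamp_const_index[OF bil_symbol_amp[OF \<sigma> W(1)]] bounded_linear_ident, of ?Z] .
    moreover have "bamp (\<lambda>q p. (1 + \<bar>snd ((fst p, freq p) + (0, ?\<omega> q))\<bar>) powr t) (\<lambda>q p. \<tau> ((fst p, freq p) + (0, ?\<omega> q)))"
      using bamp_affine[OF bamp_const_index[OF lin_symbol_amp[OF \<tau>]] bounded_linear_freq, of "\<lambda>q. (0, ?\<omega> q)"] .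
    ultimately show "bamp (\<lambda>q p. cmod (h q) * (W (snd (p + ?Z q)) * (1 + \<bar>snd ((fst p, freq p) + (0, ?\<omega> q))\<bar>) powr t)) ?f"
      using uamp_scale[OF uamp_mult, of Basis "\<lambda>_ _ _. 1" _ _ _ _ h] by fastforce
    fix q p :: "real \<times> real \<times> real"
    show "cmod (h q) * (W (snd (p + ?Z q)) * (1 + \<bar>snd ((fst p, freq p) + (0, ?\<omega> q))\<bar>) powr t)
       \<le> 1 * (C * kernel_weight M q * (1 + \<bar>?\<omega> q\<bar>) ^ l * ?V p)"
    proof -
      have "cmod (h q) * (W (snd p) * (1 + \<bar>freq p + ?\<omega> q\<bar>) powr t)
        \<le> (C * kernel_weight M q) * (W (snd p) * ((1 + \<bar>freq p\<bar>) powr t * (1 + \<bar>?\<omega> q\<bar>) ^ l))"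
        using h(3) W(1) by (intro mult_mono h(2) mult_left_mono peetre_nat[OF l] mult_nonneg_nonneg kernel_weight_nonneg) auto
      then show ?thesis by (simp add: mult_ac)
    qed
  qed (auto simp: W)
  have int: "integrable lborel (\<lambda>q. kernel_weight M q * (1 + \<bar>?\<omega> q\<bar>) ^ k)" if "k \<le> l + n" for k
    using that M by (intro integrable_kernel_weight) auto
  have V0: "0 \<le> ?V p" for p using W(1) by simp
  have dom: "dominated_family lborel ?f"
  proof (rule bamp_integral(2)[OF coarse])
    show "0 \<le> C * kernel_weight M q * (1 + \<bar>?\<omega> q\<bar>) ^ l * ?V p" for q p
      by (rule mult_nonneg_nonneg[OF _ V0]) (intro mult_nonneg_nonneg h(3) kernel_weight_nonneg zero_le_power, simp)
    show "integrable lborel (\<lambda>q. C * kernel_weight M q * (1 + \<bar>?\<omega> q\<bar>) ^ l * ?V p)" for p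
    proof -
      have "integrable lborel (\<lambda>q. (C * ?V p) * (kernel_weight M q * (1 + \<bar>?\<omega> q\<bar>) ^ l))"
        by (intro integrable_mult_right int) simp
      then show ?thesis by (simp add: mult_ac)
    qed
    show "(\<integral>q. C * kernel_weight M q * (1 + \<bar>?\<omega> q\<bar>) ^ l * ?V p \<partial>lborel)
       \<le> (C * (\<integral>q. kernel_weight M q * (1 + \<bar>?\<omega> q\<bar>) ^ l \<partial>lborel)) * ?V p" for p
      by (simp only: mult.assoc[of C] integral_mult_right_zero integral_mult_left_zero order_refl)
    show "(\<lambda>q. ?f q p) \<in> borel_measurable lborel" for p
    proof -
      have [measurable]: "(\<lambda>q. \<sigma> (p + ?Z q)) \<in> borel_measurable borel"
        by (intro borel_measurable_continuous_onI continuous_on_compose2[OF smooth_continuous[OF sm\<sigma>, where S=UNIV]])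
           (auto intro!: continuous_intros)
      have [measurable]: "(\<lambda>q. \<tau> (fst p, freq p + ?\<omega> q)) \<in> borel_measurable borel"
        by (intro borel_measurable_continuous_onI continuous_on_compose2[OF smooth_continuous[OF sm\<tau>, where S=UNIV]])
           (auto intro!: continuous_intros)
      note h(1)[measurable]
      show ?thesis by measurable
    qed
    fix p0 :: "real \<times> real \<times> real"
    have "continuous_on (cball p0 1) ?V"
      by (intro continuous_intros continuous_on_compose2[OF W(2)]) auto
    then have "bounded (?V ` cball p0 1)"
      by (intro compact_imp_bounded compact_continuous_image) auto
    then obtain B where B: "\<And>p. p \<in> cball p0 1 \<Longrightarrow> \<bar>?V p\<bar> \<le> B"
      unfolding bounded_iff real_norm_def by blast
    have "C * kernel_weight M q * (1 + \<bar>?\<omega> q\<bar>) ^ l * ?V p \<le> (C * (kernel_weight M q * (1 + \<bar>?\<omega> q\<bar>) ^ l)) * B"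
      if "p \<in> ball p0 1" for p q
    proof -
      have "?V p \<le> B" using B[of p] that by auto
      moreover have "0 \<le> C * (kernel_weight M q * (1 + \<bar>?\<omega> q\<bar>) ^ l)"
        using h(3) kernel_weight_nonneg[of M q] by simp
      ultimately have "(C * (kernel_weight M q * (1 + \<bar>?\<omega> q\<bar>) ^ l)) * ?V p
          \<le> (C * (kernel_weight M q * (1 + \<bar>?\<omega> q\<bar>) ^ l)) * B"
        by (rule mult_left_mono)
      then show ?thesis by (simp only: mult.assoc)
    qed
    moreover have "integrable lborel (\<lambda>q. (C * (kernel_weight M q * (1 + \<bar>?\<omega> q\<bar>) ^ l)) * B)"
      using int[of l] by simp
    ultimately show "\<exists>r>0. \<exists>k. integrable lborel k \<and> (\<forall>q. \<forall>p\<in>ball p0 r. C * kernel_weight M q * (1 + \<bar>?\<omega> q\<bar>) ^ l * ?V p \<le> k q)"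
      by (intro exI[of _ "1::real"] conjI exI[of _ "\<lambda>q. (C * (kernel_weight M q * (1 + \<bar>?\<omega> q\<bar>) ^ l)) * B"]) auto
  qed
  show "smooth (kernel_op h \<sigma> \<tau>)" unfolding kernel_op_def[abs_def] by (rule smooth_integral[OF dom])
  assume w: "set w \<subseteq> dirs" "length w \<le> n"
  obtain A where A: "0 \<le> A" "\<And>q p. cmod (iter_deriv w (?f q) p)
     \<le> A * (cmod (h q) * (W (snd p) * ((1 + \<bar>freq p\<bar>) powr t * (1 + \<bar>?\<omega> q\<bar>) ^ l))) * (\<Prod>e\<leftarrow>w. (1 + \<bar>?\<omega> q\<bar>) * gain e p)"
    by (rule uampD_nonneg[OF fine w(1)]) (auto simp: W gain_nonneg)
  let ?I = "\<integral>q. kernel_weight M q * (1 + \<bar>?\<omega> q\<bar>) ^ (l + length w) \<partial>lborel"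
  have "cmod (iter_deriv w (kernel_op h \<sigma> \<tau>) p) \<le> (A * C * ?I) * ?V p * (\<Prod>e\<leftarrow>w. gain e p)" for p
  proof -
    have pr: "(\<Prod>e\<leftarrow>w. c * gain e p) = c ^ length w * (\<Prod>e\<leftarrow>w. gain e p)" for c
      by (induction w) (auto simp: mult_ac)
    have gp: "0 \<le> (\<Prod>e\<leftarrow>w. gain e p)" by (rule prod_list_nonneg) (auto simp: gain_nonneg)
    have "cmod (iter_deriv w (kernel_op h \<sigma> \<tau>) p)
      \<le> (\<integral>q. (A * C * ?V p * (\<Prod>e\<leftarrow>w. gain e p)) * (kernel_weight M q * (1 + \<bar>?\<omega> q\<bar>) ^ (l + length w)) \<partial>lborel)"
      unfolding kernel_op_def[abs_def] iter_deriv_integral[OF dom]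
    proof (rule norm_integral_le)
      show "integrable lborel (\<lambda>q. iter_deriv w (?f q) p)"
        by (intro dominated_family_integrable dominated_family_iter_deriv dom)
      show "integrable lborel (\<lambda>q. (A * C * ?V p * (\<Prod>e\<leftarrow>w. gain e p)) * (kernel_weight M q * (1 + \<bar>?\<omega> q\<bar>) ^ (l + length w)))"
        using w(2) by (intro integrable_mult_right int) simp
      fix q
      have "cmod (iter_deriv w (?f q) p) \<le> A * (cmod (h q) * (W (snd p) * ((1 + \<bar>freq p\<bar>) powr t * (1 + \<bar>?\<omega> q\<bar>) ^ l))) * (\<Prod>e\<leftarrow>w. (1 + \<bar>?\<omega> q\<bar>) * gain e p)"
        by (rule A(2))
      also have "\<dots> = cmod (h q) * (A * ?V p * (\<Prod>e\<leftarrow>w. gain e p) * (1 + \<bar>?\<omega> q\<bar>) ^ (l + length w))"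
        by (simp add: pr power_add mult_ac)
      also have "\<dots> \<le> (C * kernel_weight M q) * (A * ?V p * (\<Prod>e\<leftarrow>w. gain e p) * (1 + \<bar>?\<omega> q\<bar>) ^ (l + length w))"
        using A(1) W(1)[of "snd p"] gp by (intro mult_right_mono h(2) mult_nonneg_nonneg) auto
      finally show "cmod (iter_deriv w (?f q) p) \<le> (A * C * ?V p * (\<Prod>e\<leftarrow>w. gain e p)) * (kernel_weight M q * (1 + \<bar>?\<omega> q\<bar>) ^ (l + length w))"
        by (simp add: mult_ac)
    qed
    also have "\<dots> = (A * C * ?V p * (\<Prod>e\<leftarrow>w. gain e p)) * ?I" by (rule integral_mult_right_zero)
    finally show ?thesis by (simp only: mult_ac)
  qed
  then show "\<exists>D. \<forall>p. cmod (iter_deriv w (kernel_op h \<sigma> \<tau>) p) \<le> D * ?V p * (\<Prod>e\<leftarrow>w. gain e p)" by blast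
qed

end

section \<open>The symbol of the composition\<close>

text \<open>Translation by \<open>p0\<close> moves the integral to the variables of the amplitude
  and turns the cutoff into a shifted one; \<open>c\<close> absorbs a phase that does not depend on
  the integration variables.\<close>

lemma has_osc_integralI:
  assumes a: "amp (poly_weight k l) a" and I: "osc_lim a I"
    and F: "\<And>q. F (q + p0) = c * (osc_exp q * a q)"
  shows "has_osc_integral F (c * I)"
  unfolding has_osc_integral_def
proof (intro ballI impI conjI allI)
  fix \<phi> :: "real \<times> real \<Rightarrow> complex" assume \<phi>: "\<phi> \<in> schwartz" "\<phi> 0 = 1"
  let ?G = "\<lambda>\<epsilon> q. \<phi> (\<epsilon> *\<^sub>R q) * F q"
  have G: "?G \<epsilon> (q + p0) = c * (osc_exp q * (a q * cutoff \<phi> \<epsilon> p0 q))" for \<epsilon> q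
    unfolding F by (simp add: cutoff_def scaleR_add_right)
  have int_G: "(\<integral>q. ?G \<epsilon> q \<partial>lborel) = c * osc_int (\<lambda>q. a q * cutoff \<phi> \<epsilon> p0 q)" for \<epsilon>
    using lborel_integral_translate[of "?G \<epsilon>" p0] unfolding G osc_int_def by simp
  show "integrable lborel (?G \<epsilon>)" if "0 < \<epsilon>" for \<epsilon>
    using amp_integrable(1)[OF amp_cutoff_mult[OF \<phi>(1) that a, of p0]]
      lborel_integrable_translate[of "?G \<epsilon>" p0] unfolding G by simp
  show "((\<lambda>\<epsilon>. \<integral>q. ?G \<epsilon> q \<partial>lborel) \<longlongrightarrow> c * I) (at_right 0)"
    unfolding int_G tendsto_at_iff_sequentially o_def
    by (auto intro!: tendsto_mult tendsto_const osc_limD[OF I \<phi>])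
qed

text \<open>With the origin moved to (x, xi + eta), the phase becomes the pure product - z
  \<omega>.\<close>

lemma has_osc_integral_comp_integrand:
  assumes "amp (poly_weight k l) (\<lambda>q. \<sigma> ((fst q, 0) + p) * \<tau> ((0, snd q) + (fst p, freq p)))"
    and "osc_lim (\<lambda>q. \<sigma> ((fst q, 0) + p) * \<tau> ((0, snd q) + (fst p, freq p))) I"
  shows "has_osc_integral (comp_integrand \<tau> \<sigma> p) I"
proof -
  have "comp_integrand \<tau> \<sigma> p (q + (fst p, freq p))
     = 1 * (osc_exp q * (\<sigma> ((fst q, 0) + p) * \<tau> ((0, snd q) + (fst p, freq p))))" for q
    by (cases p; cases q) (simp add: comp_integrand_def osc_exp_def add_ac)
  from has_osc_integralI[OF assms this] show ?thesis by simp
qed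

lemma has_osc_integral_unique:
  assumes "has_osc_integral F I" "has_osc_integral F I'" shows "I = I'"
  using assms gauss_schwartz gauss_0 unfolding has_osc_integral_def
  by (meson tendsto_unique trivial_limit_at_right_real)

lemma comp_symbol_eq:
  assumes "has_osc_integral (comp_integrand \<tau> \<sigma> p) I"
  shows "comp_symbol \<tau> \<sigma> p = of_real (1 / (2 * pi)) * I"
proof -
  have "osc_integral (comp_integrand \<tau> \<sigma> p) = I"
    unfolding osc_integral_def using assms has_osc_integral_unique by blast
  then show ?thesis by (simp add: comp_symbol_def)
qed

lemma bounded_linear_Pair_left: "bounded_linear (\<lambda>z::real. (z, 0::'b::real_normed_vector))"
  by (intro bounded_linear_Pair bounded_linear_ident bounded_linear_zero)

lemma bounded_linear_Pair_right: "bounded_linear (\<lambda>z::real. (0::'b::real_normed_vector, z))"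
  by (intro bounded_linear_Pair bounded_linear_ident bounded_linear_zero)

section \<open>Symbols as functions of one variable and the remainder of the composed symbol\<close>

lemma deriv1_power_symbol_x:
  assumes "smooth \<sigma>" shows "(deriv1 ^^ k) (\<lambda>z. \<sigma> ((z, 0) + p)) = (\<lambda>z. (bil_dx ^^ k) \<sigma> ((z, 0) + p))"
proof (induction k)
  case (Suc k)
  have "smooth ((bil_dx ^^ k) \<sigma>)" unfolding bil_dx_def by (rule smooth_funpow_dir_deriv[OF assms])
  then show ?case
    using dir_deriv_affine[OF smooth_differentiable bounded_linear_Pair_left, of "(bil_dx ^^ k) \<sigma>" 1 p]
    unfolding funpow.simps o_apply Suc by (simp add: bil_dx_def zero_prod_def)
qed simp

lemma deriv1_power_symbol_xi:
  assumes "smooth \<tau>" shows "(deriv1 ^^ k) (\<lambda>\<omega>. \<tau> ((0, \<omega>) + p)) = (\<lambda>\<omega>. (lin_dxi ^^ k) \<tau> ((0, \<omega>) + p))"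
proof (induction k)
  case (Suc k)
  have "smooth ((lin_dxi ^^ k) \<tau>)" unfolding lin_dxi_def by (rule smooth_funpow_dir_deriv[OF assms])
  then show ?case
    using dir_deriv_affine[OF smooth_differentiable bounded_linear_Pair_right, of "(lin_dxi ^^ k) \<tau>" 1 p]
    unfolding funpow.simps o_apply Suc by (simp add: lin_dxi_def)
qed simp

lemma amp_lin_symbol_xi:
  assumes \<tau>: "lin_symbol t \<tau>" and l: "\<bar>t\<bar> \<le> real l"
  shows "amp (\<lambda>\<omega>. (1 + \<bar>\<omega>\<bar>) ^ l) (\<lambda>\<omega>. \<tau> ((0, \<omega>) + (x, s)))"
proof (rule bamp_mono[where B="(1 + \<bar>s\<bar>) powr t"])
  show "amp (\<lambda>\<omega>. (1 + \<bar>snd ((0, \<omega>) + (x, s))\<bar>) powr t) (\<lambda>\<omega>. \<tau> ((0, \<omega>) + (x, s)))"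
    using bamp_affine[OF lin_symbol_amp[OF \<tau>] bounded_linear_Pair_right, of "\<lambda>_. (x, s)"] .
  show "(1 + \<bar>snd ((0, \<omega>) + (x, s))\<bar>) powr t \<le> (1 + \<bar>s\<bar>) powr t * (1 + \<bar>\<omega>\<bar>) ^ l" for \<omega>
    using peetre_nat[OF l, of s \<omega>] by (simp add: add.commute)
qed simp

lemma iter_deriv_sum_bound:
  assumes "finite I" and "\<And>i. i \<in> I \<Longrightarrow> smooth (f i)"
    and "\<And>i. i \<in> I \<Longrightarrow> \<exists>D. \<forall>p. cmod (iter_deriv w (f i) p) \<le> D * B p"
  shows "\<exists>D. \<forall>p. cmod (iter_deriv w (\<lambda>p. \<Sum>i\<in>I. c i * f i p) p) \<le> D * B p"
  using assms
proof (induction I rule: finite_induct)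
  case empty
  then show ?case by (auto simp: iter_deriv_const intro!: exI[of _ 0])
next
  case (insert x F)
  obtain D where D: "\<And>p. cmod (iter_deriv w (f x) p) \<le> D * B p" using insert.prems by blast
  obtain E where E: "\<And>p. cmod (iter_deriv w (\<lambda>p. \<Sum>i\<in>F. c i * f i p) p) \<le> E * B p" using insert by auto
  have "cmod (iter_deriv w (\<lambda>p. \<Sum>i\<in>insert x F. c i * f i p) p) \<le> (cmod (c x) * D + E) * B p" for p
  proof -
    have "iter_deriv w (\<lambda>p. \<Sum>i\<in>insert x F. c i * f i p) p
      = c x * iter_deriv w (f x) p + iter_deriv w (\<lambda>p. \<Sum>i\<in>F. c i * f i p) p"
      using insert by (simp add: iter_deriv_add iter_deriv_cmult smooth_cmult smooth_sum)
    then show ?thesis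
      using norm_triangle_ineq[of "c x * iter_deriv w (f x) p" "iter_deriv w (\<lambda>p. \<Sum>i\<in>F. c i * f i p) p"]
        E[of p] mult_left_mono[OF D[of p], of "cmod (c x)"]
      by (simp add: norm_mult distrib_right mult.assoc)
  qed
  then show ?case by blast
qed

text \<open>The weight does not involve x, so for fixed frequencies it is a constant.\<close>

lemma (in symbol_directions) amp_bil_symbol_x:
  assumes \<sigma>: "bil_symbol W \<sigma>" and W: "\<And>p. 0 \<le> W p"
  shows "amp (\<lambda>_. 1) (\<lambda>z. \<sigma> ((z, 0) + p))"
proof (rule bamp_mono[where B="W (snd p)"])
  show "amp (\<lambda>z. W (snd ((z, 0) + p))) (\<lambda>z. \<sigma> ((z, 0) + p))"
    using bamp_affine[OF bil_symbol_amp[OF \<sigma> W] bounded_linear_Pair_left, of "\<lambda>_. p"] .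
qed (auto simp: W)

lemma (in symbol_directions) ex_has_osc_integral:
  assumes \<sigma>: "bil_symbol W \<sigma>" and W: "\<And>p. 0 \<le> W p" and \<tau>: "lin_symbol t \<tau>"
  shows "\<exists>I. has_osc_integral (comp_integrand \<tau> \<sigma> p) I"
proof -
  obtain l :: nat where l: "\<bar>t\<bar> \<le> real l" using real_arch_simple by blast
  have "amp (\<lambda>z. (1 + \<bar>z\<bar>) ^ 0) (\<lambda>z. \<sigma> ((z, 0) + p))" using amp_bil_symbol_x[OF \<sigma> W] by simp
  from amp_tensor[OF this amp_lin_symbol_xi[OF \<tau> l, of "fst p" "freq p"]]
  have "amp (poly_weight 0 l) (\<lambda>q. \<sigma> ((fst q, 0) + p) * \<tau> ((0, snd q) + (fst p, freq p)))" .
  from has_osc_integral_comp_integrand[OF this osc_limI[OF this order_refl order_refl]] show ?thesis by blast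
qed

text \<open>The left side does not mention \<open>M\<close>, so this supplies a whole family of
  representations of the same remainder, one for every large \<open>M\<close>.\<close>

lemma (in symbol_directions) comp_symbol_remainder:
  assumes \<sigma>: "bil_symbol W \<sigma>" and W: "\<And>p. 0 \<le> W p" and \<tau>: "lin_symbol t \<tau>"
    and l: "\<bar>t\<bar> \<le> real l" and M: "l + 2 \<le> M"
  shows "comp_symbol \<tau> \<sigma> p - comp_expansion (Suc m) \<tau> \<sigma> p = of_real (1 / (2 * pi)) * (- \<i>) ^ Suc m *
    (\<Sum>i\<le>M. \<Sum>j\<le>2. of_nat (M choose i) *
       kernel_op (osc_kernel m M i j) ((bil_dx ^^ (Suc m + i)) \<sigma>) ((lin_dxi ^^ (Suc m + j)) \<tau>) p)"
proof -
  let ?u = "\<lambda>z. \<sigma> ((z, 0) + p)" and ?v = "\<lambda>\<omega>. \<tau> ((0, \<omega>) + (fst p, freq p))"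
  note u = amp_bil_symbol_x[OF \<sigma> W, of p] and v = amp_lin_symbol_xi[OF \<tau> l, of "fst p" "freq p"]
  note D = deriv1_power_symbol_x[OF bil_symbol_smooth[OF \<sigma>], of _ p]
    deriv1_power_symbol_xi[OF lin_symbol_smooth[OF \<tau>], of _ "(fst p, freq p)"]
  have "amp (\<lambda>z. (1 + \<bar>z\<bar>) ^ 0) ?u" using u by simp
  note a = amp_tensor[OF this v]
  let ?S = "\<Sum>k<Suc m. (- \<i>) ^ k / fact k * (deriv1 ^^ k) ?v 0 * (deriv1 ^^ k) ?u 0"
  let ?R = "\<Sum>i\<le>M. \<Sum>j\<le>2. of_nat (M choose i) *
        (\<integral>q. osc_kernel m M i j q * ((deriv1 ^^ (Suc m + i)) ?u (fst q * fst (snd q))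
            * (deriv1 ^^ (Suc m + j)) ?v (snd (snd q))) \<partial>lborel)"
  have "comp_symbol \<tau> \<sigma> p = of_real (1 / (2 * pi)) * (of_real (2 * pi) * ?S + (- \<i>) ^ Suc m * ?R)"
    by (rule comp_symbol_eq, rule has_osc_integral_comp_integrand[OF a])
       (rule osc_lim_taylor[OF u v M, of m, unfolded osc_int_taylor_rem[OF u v M]])
  also have "\<dots> = (of_real (1 / (2 * pi)) * of_real (2 * pi)) * ?S + of_real (1 / (2 * pi)) * (- \<i>) ^ Suc m * ?R"
    by (simp only: distrib_left mult.assoc)
  also have "of_real (1 / (2 * pi)) * of_real (2 * pi) = (1::complex)"
    unfolding of_real_mult[symmetric] by simp
  also have "?S = comp_expansion (Suc m) \<tau> \<sigma> p"
    unfolding comp_expansion_def D by (cases p) (simp add: zero_prod_def[symmetric])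
  also have "?R = (\<Sum>i\<le>M. \<Sum>j\<le>2. of_nat (M choose i) *
       kernel_op (osc_kernel m M i j) ((bil_dx ^^ (Suc m + i)) \<sigma>) ((lin_dxi ^^ (Suc m + j)) \<tau>) p)"
    unfolding kernel_op_def D by (simp only: add.commute[of p] add_Pair add_0_left add.commute[of "freq p"])
  finally show ?thesis by simp
qed

text \<open>For each word of derivatives a representation with its own \<open>M\<close> is used; a
  single \<open>M\<close> would control only words up to a fixed length.\<close>

lemma (in symbol_directions) bil_symbol_remainder_Suc:
  assumes \<sigma>: "bil_symbol W \<sigma>" and W: "\<And>p. 0 \<le> W p" "continuous_on UNIV W" and \<tau>: "lin_symbol t \<tau>"
  shows "bil_symbol (\<lambda>p. W p * (1 + \<bar>fst p + snd p\<bar>) powr (t - real (Suc m)))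
     (\<lambda>p. comp_symbol \<tau> \<sigma> p - comp_expansion (Suc m) \<tau> \<sigma> p)"
proof -
  let ?t = "t - real (Suc m)"
  obtain l :: nat where "max \<bar>t\<bar> \<bar>?t\<bar> \<le> real l" using real_arch_simple by blast
  then have l: "\<bar>t\<bar> \<le> real l" "\<bar>?t\<bar> \<le> real l" by auto
  let ?K = "\<lambda>M (i, j). kernel_op (osc_kernel m M i j) ((bil_dx ^^ (Suc m + i)) \<sigma>) ((lin_dxi ^^ (Suc m + j)) \<tau>)"
  let ?c = "\<lambda>M (i, j). of_real (1 / (2 * pi)) * (- \<i>) ^ Suc m * of_nat (M choose i)"
  have R: "(\<lambda>p. comp_symbol \<tau> \<sigma> p - comp_expansion (Suc m) \<tau> \<sigma> p)
     = (\<lambda>p. \<Sum>ij\<in>{..M} \<times> {..2::nat}. ?c M ij * ?K M ij p)" if "l + 2 \<le> M" for M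
    unfolding comp_symbol_remainder[OF \<sigma> W(1) \<tau> l(1) that] sum_distrib_left sum.cartesian_product
    by (intro ext sum.cong refl) (auto simp only: mult.assoc prod.case split_paired_all)
  have \<sigma>': "bil_symbol W ((bil_dx ^^ k) \<sigma>)" for k by (rule bil_symbol_dx_power[OF \<sigma>])
  \<comment> \<open>At least \<open>Suc m\<close> derivatives fall on \<tau>; the further
    \<open>j\<close> would lower the order more, and this surplus is given up.\<close>
  have \<tau>': "lin_symbol ?t ((lin_dxi ^^ (Suc m + j)) \<tau>)" for j
    by (rule lin_symbol_mono[OF lin_symbol_dxi_power[OF \<tau>]]) simp
  have K: "smooth (?K M ij)"
    "set w \<subseteq> dirs \<Longrightarrow> length w \<le> n \<Longrightarrow> \<exists>D. \<forall>p. cmod (iter_deriv w (?K M ij) p)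
          \<le> D * (W (snd p) * (1 + \<bar>freq p\<bar>) powr ?t * (\<Prod>e\<leftarrow>w. gain e p))"
    if M: "l + n + 2 \<le> M" for M ij n w
  proof -
    obtain i j where ij: "ij = (i, j)" by fastforce
    obtain C where C: "0 \<le> C" "\<And>q. cmod (osc_kernel m M i j q) \<le> C * kernel_weight M q"
      using osc_kernel_bound by blast
    note b = kernel_op_bound[OF \<sigma>' W \<tau>' l(2) osc_kernel_measurable C(2,1) M]
    show "smooth (?K M ij)" unfolding ij by (simp only: prod.case) (rule b(1))
    assume w: "set w \<subseteq> dirs" "length w \<le> n"
    show "\<exists>D. \<forall>p. cmod (iter_deriv w (?K M ij) p)
          \<le> D * (W (snd p) * (1 + \<bar>freq p\<bar>) powr ?t * (\<Prod>e\<leftarrow>w. gain e p))"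
      using b(2)[OF w, of "Suc m + i" j] unfolding ij by (simp only: prod.case mult.assoc)
  qed
  show ?thesis
    unfolding bil_symbol_def uamp_def
  proof (intro conjI allI impI)
    show "smooth (\<lambda>p. comp_symbol \<tau> \<sigma> p - comp_expansion (Suc m) \<tau> \<sigma> p)"
      unfolding R[OF order_refl] using K(1)[of 0 "l + 2"] by (intro smooth_sum smooth_cmult) auto
    fix w assume w: "set w \<subseteq> dirs"
    \<comment> \<open>The exponent l + length w + 2 is adapted to the word \<open>w\<close>.\<close>
    have M: "l + 2 \<le> l + length w + 2" and M': "l + length w + 2 \<le> l + length w + 2" by simp_all
    have "\<exists>D. \<forall>p. cmod (iter_deriv w (\<lambda>p. \<Sum>ij\<in>{..l + length w + 2} \<times> {..2::nat}.
        ?c (l + length w + 2) ij * ?K (l + length w + 2) ij p) p)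
      \<le> D * (W (snd p) * (1 + \<bar>freq p\<bar>) powr ?t * (\<Prod>e\<leftarrow>w. gain e p))"
      by (rule iter_deriv_sum_bound) (use K(1)[OF M'] K(2)[OF M' w order_refl] in auto)
    then show "\<exists>D. \<forall>q p. cmod (iter_deriv w (\<lambda>p. comp_symbol \<tau> \<sigma> p - comp_expansion (Suc m) \<tau> \<sigma> p) p)
      \<le> D * (W (snd p) * (1 + \<bar>freq p\<bar>) powr ?t) * (\<Prod>e\<leftarrow>w. gain e p)"
      unfolding R[OF M] by (simp only: mult.assoc) blast
  qed
qed

lemma (in symbol_directions) bil_symbol_mono:
  assumes "bil_symbol W \<sigma>" "\<And>p. 0 \<le> W p" "\<And>p. W p \<le> W' p" shows "bil_symbol W' \<sigma>"
  unfolding bil_symbol_def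
  by (rule uamp_mono[OF assms(1)[unfolded bil_symbol_def], where B=1])
     (auto simp: assms gain_nonneg)

text \<open>The symbol is its leading term, a pointwise product, plus the first remainder, whose
  order t - 1 is below t.\<close>

lemma (in symbol_directions) bil_symbol_comp_symbol:
  assumes \<sigma>: "bil_symbol W \<sigma>" and W: "\<And>p. 0 \<le> W p" "continuous_on UNIV W" and \<tau>: "lin_symbol t \<tau>"
  shows "bil_symbol (\<lambda>p. W p * (1 + \<bar>fst p + snd p\<bar>) powr t) (comp_symbol \<tau> \<sigma>)"
proof -
  have 1: "bil_symbol (\<lambda>p. W p * (1 + \<bar>fst p + snd p\<bar>) powr t)
     (\<lambda>p. comp_symbol \<tau> \<sigma> p - comp_expansion (Suc 0) \<tau> \<sigma> p)"
    by (rule bil_symbol_mono[OF bil_symbol_remainder_Suc[OF \<sigma> W \<tau>]])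
       (auto intro!: mult_left_mono powr_mono simp: W)
  have "comp_expansion (Suc 0) \<tau> \<sigma> = (\<lambda>p. \<sigma> p * \<tau> (fst p, freq p))"
    by (auto simp: comp_expansion_def fun_eq_iff)
  with bil_symbol_mult_lin_symbol[OF \<sigma> \<tau>]
  have 2: "bil_symbol (\<lambda>p. W p * (1 + \<bar>fst p + snd p\<bar>) powr t) (comp_expansion (Suc 0) \<tau> \<sigma>)"
    by simp
  from bil_symbol_add[OF 1 2] show ?thesis by simp
qed

lemma (in symbol_directions) bil_symbol_remainder:
  assumes \<sigma>: "bil_symbol W \<sigma>" and W: "\<And>p. 0 \<le> W p" "continuous_on UNIV W" and \<tau>: "lin_symbol t \<tau>"
  shows "bil_symbol (\<lambda>p. W p * (1 + \<bar>fst p + snd p\<bar>) powr (t - real N))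
     (\<lambda>p. comp_symbol \<tau> \<sigma> p - comp_expansion N \<tau> \<sigma> p)"
proof (cases N)
  case 0
  then show ?thesis
    using bil_symbol_comp_symbol[OF assms] by (simp add: comp_expansion_def split_beta)
next
  case (Suc m)
  then show ?thesis using bil_symbol_remainder_Suc[OF assms, of m] by simp
qed

section \<open>The bilinear operator on Schwartz functions\<close>

lemma has_derivative_cis:
  assumes "(f has_derivative f') (at p)"
  shows "((\<lambda>p. cis (f p)) has_derivative (\<lambda>v. \<i> * of_real (f' v) * cis (f p))) (at p)"
proof -
  have "((\<lambda>p. \<i> * of_real (f p)) has_derivative (\<lambda>v. \<i> * of_real (f' v))) (at p)"
    by (intro has_derivative_mult_right bounded_linear.has_derivative[OF bounded_linear_of_real] assms)
  from has_derivative_compose[OF this DERIV_exp[unfolded has_field_derivative_def]]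
  show ?thesis by (simp add: cis_conv_exp mult.commute)
qed

lemma smooth_cis_linear:
  fixes L :: "'a::euclidean_space \<Rightarrow> real"
  assumes "bounded_linear L"
  shows "smooth (\<lambda>p. cis (L p))" and "dir_deriv v (\<lambda>p. cis (L p)) = (\<lambda>p. \<i> * of_real (L v) * cis (L p))"
proof -
  have D: "((\<lambda>p. cis (L p)) has_derivative (\<lambda>v. \<i> * of_real (L v) * cis (L p))) (at p)" for p
    by (rule has_derivative_cis[OF bounded_linear_imp_has_derivative[OF assms]])
  show E: "dir_deriv v (\<lambda>p. cis (L p)) = (\<lambda>p. \<i> * of_real (L v) * cis (L p))" for v
    by (rule ext, rule dir_deriv_eq, rule D)
  show "smooth (\<lambda>p. cis (L p))"
  proof (rule smooth_exponential_type)
    show "(\<lambda>p. cis (L p)) differentiable_on UNIV"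
      using D by (auto simp: differentiable_on_def differentiable_def)
    show "\<exists>m. smooth m \<and> dir_deriv b (\<lambda>p. cis (L p)) = (\<lambda>p. m p * cis (L p))" for b
      unfolding E by (intro exI[of _ "\<lambda>_. \<i> * of_real (L b)"] conjI smooth_const refl)
  qed
qed

section \<open>The Fourier transform on Schwartz functions\<close>

lemma iter_deriv_real:
  fixes f :: "real \<Rightarrow> complex"
  assumes "set w \<subseteq> Basis" shows "iter_deriv w f = (deriv1 ^^ length w) f"
  using assms by (induction w) auto

lemma amp_weight_integrable:
  assumes "amp (\<lambda>x::real. 1 / (1 + \<bar>x\<bar>) ^ 2) u"
  shows "integrable lborel (\<lambda>x. cis (- (x * \<xi>)) * u x)"
proof -
  obtain C where C: "0 \<le> C" "\<And>x. cmod (u x) \<le> C * (1 / (1 + \<bar>x\<bar>) ^ 2)" using bamp_bound[OF assms] by auto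
  note [measurable] = smooth_borel[OF uamp_smooth[OF assms]]
  have [measurable]: "(\<lambda>x. cis (- (x * \<xi>))) \<in> borel_measurable borel"
    by (auto intro!: borel_measurable_continuous_onI continuous_intros)
  have "integrable lborel (\<lambda>x::real. C * (1 / (1 + \<bar>x\<bar>) ^ 2))" by (intro integrable_mult_right integrable_weight) simp
  then show ?thesis
  proof (rule Bochner_Integration.integrable_bound)
    show "AE x in lborel. norm (cis (- (x * \<xi>)) * u x) \<le> norm (C * (1 / (1 + \<bar>x\<bar>) ^ 2))"
      using C by (intro AE_I2) (auto simp: norm_mult intro: order_trans[OF C(2)])
  qed measurable
qed

definition FT :: "(real \<Rightarrow> complex) \<Rightarrow> real \<Rightarrow> complex" where
  "FT u \<xi> = (\<integral>x. cis (- (x * \<xi>)) * u x \<partial>lborel)"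

lemma fourier_FT: "fourier f = (\<lambda>\<xi>. of_real (1 / (2 * pi)) * FT f \<xi>)"
  by (simp add: fun_eq_iff fourier_def FT_def)

text \<open>By parts, the transform of u + u' is 1 + i xi times the transform of u; dividing gives
  one order of decay in xi.\<close>

lemma FT_one_plus_deriv:
  assumes u: "amp (\<lambda>x::real. 1 / (1 + \<bar>x\<bar>) ^ 2) u"
  shows "FT u \<xi> = resolvent \<xi> * FT (one_plus_deriv u) \<xi>"
proof -
  let ?e = "\<lambda>x. cis (- (x * \<xi>))"
  have bl: "bounded_linear (\<lambda>x. - (x * \<xi>))"
    by (intro bounded_linear_minus bounded_linear_mult_left)
  note e = smooth_cis_linear[OF bl] and su = uamp_smooth[OF u]
  have H: "deriv1 (\<lambda>x. ?e x * u x) = (\<lambda>x. ?e x * deriv1 u x - (\<i> * of_real \<xi>) * (?e x * u x))"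
    unfolding dir_deriv_mult[OF smooth_differentiable[OF e(1)] smooth_differentiable[OF su]] e(2)
    by (simp add: fun_eq_iff algebra_simps)
  note Du = bamp_dir_deriv[OF u, of 1]
  note int = amp_weight_integrable[OF u, of \<xi>] amp_weight_integrable[OF Du, of \<xi>]
  have "(\<integral>x. deriv1 (\<lambda>x. ?e x * u x) x \<partial>lborel) = 0"
    using int by (intro integral_dir_deriv_eq_0 smooth_mult e su) (simp_all add: H)
  then have "FT (deriv1 u) \<xi> = (\<i> * of_real \<xi>) * FT u \<xi>"
    unfolding H FT_def using int by simp
  moreover have "FT (one_plus_deriv u) \<xi> = FT u \<xi> + FT (deriv1 u) \<xi>"
    unfolding FT_def one_plus_deriv_def[abs_def] distrib_left using int by simp
  ultimately have "FT (one_plus_deriv u) \<xi> = (1 + \<i> * of_real \<xi>) * FT u \<xi>"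
    by (simp add: algebra_simps)
  then have "resolvent \<xi> * FT (one_plus_deriv u) \<xi> = (resolvent \<xi> * (1 + \<i> * of_real \<xi>)) * FT u \<xi>"
    by (simp only: mult.assoc)
  then show ?thesis unfolding resolvent_mult by simp
qed

lemma amp_one_plus_deriv: "amp W u \<Longrightarrow> amp W (one_plus_deriv u)"
  unfolding one_plus_deriv_def[abs_def] by (intro uamp_add bamp_dir_deriv)

lemma amp_one_plus_deriv_power: "amp W u \<Longrightarrow> amp W ((one_plus_deriv ^^ k) u)"
  by (induction k) (simp, unfold funpow.simps o_apply, rule amp_one_plus_deriv)

lemma FT_one_plus_deriv_power:
  assumes u: "amp (\<lambda>x::real. 1 / (1 + \<bar>x\<bar>) ^ 2) u"
  shows "FT u \<xi> = resolvent \<xi> ^ M * FT ((one_plus_deriv ^^ M) u) \<xi>"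
proof (induction M)
  case (Suc M)
  show ?case
    using Suc FT_one_plus_deriv[OF amp_one_plus_deriv_power[OF u], of M \<xi>] by simp
qed simp

text \<open>Each xi derivative of the exponential brings a factor x, which the Schwartz decay of
  \<open>u\<close> absorbs.\<close>

lemma amp_FT:
  assumes u: "u \<in> schwartz" shows "amp (\<lambda>_. 1) (FT u)"
proof -
  let ?f = "\<lambda>x \<xi>. cis (- (x * \<xi>)) * u x" and ?W = "\<lambda>x::real. 1 / (1 + \<bar>x\<bar>) ^ 2"
  have bl: "bounded_linear (\<lambda>\<xi>. - (x * \<xi>))" for x :: real
    by (intro bounded_linear_minus bounded_linear_mult_right)
  note e = smooth_cis_linear[OF bl]
  have D: "(deriv1 ^^ k) (?f x) = (\<lambda>\<xi>. (- \<i> * of_real x) ^ k * ?f x \<xi>)" for k x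
  proof (induction k)
    case (Suc k)
    have "?f x = (\<lambda>\<xi>. u x * cis (- (x * \<xi>)))" by (simp add: mult.commute)
    then have "deriv1 (?f x) = (\<lambda>\<xi>. (- \<i> * of_real x) * ?f x \<xi>)"
      by (simp only: dir_deriv_cmult[OF smooth_differentiable[OF e(1)]] e(2)) (simp add: mult_ac)
    moreover have "smooth (?f x)" using smooth_cmult[OF e(1), of "u x" x] by (simp add: mult.commute)
    ultimately show ?case
      unfolding funpow.simps o_apply Suc by (simp add: dir_deriv_cmult smooth_differentiable fun_eq_iff)
  qed simp
  have f: "bamp (\<lambda>x _. ?W x) ?f"
  proof (rule bampI)
    show "smooth (?f x)" for x using smooth_cmult[OF e(1), of "u x" x] by (simp add: mult.commute)
    fix w :: "real list" assume w: "set w \<subseteq> Basis"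
    let ?n = "length w"
    obtain C where C: "0 \<le> C" "\<And>x. cmod (u x) \<le> C * (1 / (1 + \<bar>x\<bar>) ^ (?n + 2))"
      using bamp_bound[OF schwartz_amp[OF u, of "?n + 2"]] by auto
    have "cmod (iter_deriv w (?f x) \<xi>) \<le> C * ?W x" for x \<xi>
    proof -
      have "cmod (iter_deriv w (?f x) \<xi>) = \<bar>x\<bar> ^ ?n * cmod (u x)"
        by (simp add: iter_deriv_real[OF w] D norm_mult norm_power)
      also have "\<dots> \<le> (1 + \<bar>x\<bar>) ^ ?n * (C * (1 / (1 + \<bar>x\<bar>) ^ (?n + 2)))"
        by (intro mult_mono power_mono C) auto
      also have "\<dots> = C * ?W x" by (simp add: power_add power2_eq_square)
      finally show ?thesis .
    qed
    then show "\<exists>C. \<forall>x \<xi>. cmod (iter_deriv w (?f x) \<xi>) \<le> C * ?W x" by blast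
  qed
  have "amp (\<lambda>_. 1) (\<lambda>\<xi>. \<integral>x. ?f x \<xi> \<partial>lborel)"
  proof (rule bamp_integral(1)[OF f, where B="\<integral>x. ?W x \<partial>lborel"])
    show "(\<lambda>x. ?f x \<xi>) \<in> borel_measurable lborel" for \<xi>
      using borel_measurable_integrable[OF amp_weight_integrable[of u \<xi>]] schwartz_amp[OF u, of 2] by simp
    show "integrable lborel ?W" by (rule integrable_weight) simp
    then show "\<exists>r>0. \<exists>k. integrable lborel k \<and> (\<forall>x. \<forall>\<xi>\<in>ball \<xi>0 r. ?W x \<le> k x)" for \<xi>0 :: real
      by (intro exI[of _ "1::real"] conjI exI[of _ ?W]) auto
  qed auto
  then show ?thesis unfolding FT_def[abs_def] .
qed

lemma amp_abs_schwartz: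
  "(\<And>k. amp (\<lambda>x::real. 1 / (1 + \<bar>x\<bar>) ^ k) u) \<Longrightarrow> u \<in> schwartz"
  by (rule amp_schwartz) simp

lemma schwartz_amp_abs: "u \<in> schwartz \<Longrightarrow> amp (\<lambda>x::real. 1 / (1 + \<bar>x\<bar>) ^ k) u"
  using schwartz_amp[of u k] by simp

lemma schwartz_deriv1: "u \<in> schwartz \<Longrightarrow> deriv1 u \<in> schwartz"
  by (rule amp_abs_schwartz, rule bamp_dir_deriv, rule schwartz_amp_abs)

text \<open>Decay comes from the resolvent powers, bounded derivatives from \<open>amp_FT\<close>
  applied to (1 + d/dx)^k u, which is again Schwartz.\<close>

lemma FT_schwartz:
  assumes u: "u \<in> schwartz" shows "FT u \<in> schwartz"
proof (rule amp_abs_schwartz)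
  fix k
  have "(one_plus_deriv ^^ k) u \<in> schwartz"
    by (rule amp_abs_schwartz, rule amp_one_plus_deriv_power, rule schwartz_amp_abs, rule u)
  from uamp_mult[OF amp_resolvent_power[of k] amp_FT[OF this]]
  show "amp (\<lambda>x. 1 / (1 + \<bar>x\<bar>) ^ k) (FT u)"
    by (simp add: FT_one_plus_deriv_power[OF schwartz_amp_abs[OF u], of _ k, symmetric])
qed

lemma fourier_schwartz: "f \<in> schwartz \<Longrightarrow> fourier f \<in> schwartz"
  unfolding fourier_FT
  by (rule amp_abs_schwartz, rule uamp_cmult, rule schwartz_amp_abs, rule FT_schwartz)

section \<open>Symbols of polynomial growth and decay of the bilinear operator\<close>

definition poly_symbol :: "(real \<times> real \<times> real \<Rightarrow> complex) \<Rightarrow> bool" where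
  "poly_symbol \<sigma> \<longleftrightarrow> (\<exists>K. amp (\<lambda>p. poly_weight K K (snd p)) \<sigma>)"

lemma poly_symbol_smooth: "poly_symbol \<sigma> \<Longrightarrow> smooth \<sigma>"
  by (auto simp: poly_symbol_def intro: uamp_smooth)

lemma poly_symbol_dir_deriv: "poly_symbol \<sigma> \<Longrightarrow> poly_symbol (dir_deriv v \<sigma>)"
  by (auto simp: poly_symbol_def intro: bamp_dir_deriv)

lemma poly_symbol_add:
  assumes "poly_symbol \<sigma>" "poly_symbol \<rho>" shows "poly_symbol (\<lambda>p. \<sigma> p + \<rho> p)"
proof -
  obtain K L where K: "amp (\<lambda>p. poly_weight K K (snd p)) \<sigma>" and L: "amp (\<lambda>p. poly_weight L L (snd p)) \<rho>"
    using assms by (auto simp: poly_symbol_def)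
  have "amp (\<lambda>p. poly_weight (max K L) (max K L) (snd p)) (\<lambda>p. \<sigma> p + \<rho> p)"
  proof (rule uamp_add)
    show "amp (\<lambda>p. poly_weight (max K L) (max K L) (snd p)) \<sigma>"
      by (rule bamp_mono[OF K, where B=1])
         (use poly_weight_mono[of K "max K L" K "max K L"] in \<open>auto simp: poly_weight_nonneg\<close>)
    show "amp (\<lambda>p. poly_weight (max K L) (max K L) (snd p)) \<rho>"
      by (rule bamp_mono[OF L, where B=1])
         (use poly_weight_mono[of L "max K L" L "max K L"] in \<open>auto simp: poly_weight_nonneg\<close>)
  qed
  then show ?thesis by (auto simp: poly_symbol_def)
qed

lemma bounded_linear_freq': "bounded_linear (\<lambda>p::real \<times> real \<times> real. freq p)"
  by (intro bounded_linear_add bounded_linear_compose[OF bounded_linear_fst] bounded_linear_compose[OF bounded_linear_snd]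
      bounded_linear_snd)

text \<open>Differentiating the phase in x produces this factor. It raises the order of a symbol,
  and polynomial growth of unspecified order is a condition that absorbs it.\<close>

lemma poly_symbol_freq_mult:
  assumes "poly_symbol \<sigma>" shows "poly_symbol (\<lambda>p. \<i> * of_real (freq p) * \<sigma> p)"
proof -
  obtain K where K: "amp (\<lambda>p. poly_weight K K (snd p)) \<sigma>" using assms by (auto simp: poly_symbol_def)
  have "amp (\<lambda>p. (1 + \<bar>freq p\<bar>) * poly_weight K K (snd p)) (\<lambda>p. \<i> * (of_real (freq p) * \<sigma> p))"
    by (rule uamp_cmult[OF uamp_mult[OF amp_of_real[OF bounded_linear_freq'] K]])
  then have "amp (\<lambda>p. poly_weight (Suc K) (Suc K) (snd p)) (\<lambda>p. \<i> * (of_real (freq p) * \<sigma> p))"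
  proof (rule bamp_mono[where B=1])
    fix p :: "real \<times> real \<times> real"
    have "1 + \<bar>freq p\<bar> \<le> (1 + \<bar>fst (snd p)\<bar>) * (1 + \<bar>snd (snd p)\<bar>)"
      unfolding distrib_left distrib_right mult_1 mult_1_right
      using abs_triangle_ineq[of "fst (snd p)" "snd (snd p)"]
        mult_nonneg_nonneg[OF abs_ge_zero[of "fst (snd p)"] abs_ge_zero[of "snd (snd p)"]] by linarith
    then have "(1 + \<bar>freq p\<bar>) * poly_weight K K (snd p) \<le> (1 + \<bar>fst (snd p)\<bar>) * (1 + \<bar>snd (snd p)\<bar>) * poly_weight K K (snd p)"
      by (rule mult_right_mono) (rule poly_weight_nonneg)
    then show "(1 + \<bar>freq p\<bar>) * poly_weight K K (snd p) \<le> 1 * poly_weight (Suc K) (Suc K) (snd p)"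
      by (simp add: poly_weight_def mult_ac)
  qed (auto simp: poly_weight_nonneg)
  then show ?thesis by (auto simp: poly_symbol_def mult.assoc)
qed

text \<open>With the exponential included, the integrand of the bilinear operator is, for fixed
  frequencies, a bounded function of x on which \<tau>(x, D) can act.\<close>

definition mod_symbol :: "(real \<times> real \<times> real \<Rightarrow> complex) \<Rightarrow> real \<times> real \<times> real \<Rightarrow> complex" where
  "mod_symbol \<sigma> p = cis (fst p * freq p) * \<sigma> p"

lemma smooth_phase: "smooth (\<lambda>p::real \<times> real \<times> real. cis (fst p * freq p))"
  and bil_dx_phase: "dir_deriv (1, 0, 0) (\<lambda>p::real \<times> real \<times> real. cis (fst p * freq p))
     = (\<lambda>p. \<i> * of_real (freq p) * cis (fst p * freq p))"
proof -
  have D: "((\<lambda>p::real \<times> real \<times> real. cis (fst p * freq p)) has_derivative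
     (\<lambda>v. \<i> * of_real (fst p * freq v + fst v * freq p) * cis (fst p * freq p))) (at p)" for p
    by (rule has_derivative_cis) (auto intro!: derivative_eq_intros)
  have E: "dir_deriv v (\<lambda>p::real \<times> real \<times> real. cis (fst p * freq p))
     = (\<lambda>p. \<i> * of_real (fst p * freq v + fst v * freq p) * cis (fst p * freq p))" for v
    by (rule ext, rule dir_deriv_eq, rule D)
  show "dir_deriv (1, 0, 0) (\<lambda>p::real \<times> real \<times> real. cis (fst p * freq p))
     = (\<lambda>p. \<i> * of_real (freq p) * cis (fst p * freq p))" unfolding E by simp
  show "smooth (\<lambda>p::real \<times> real \<times> real. cis (fst p * freq p))"
  proof (rule smooth_exponential_type)
    show "(\<lambda>p::real \<times> real \<times> real. cis (fst p * freq p)) differentiable_on UNIV"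
      using D by (auto simp: differentiable_on_def differentiable_def)
    fix b :: "real \<times> real \<times> real"
    have "bounded_linear (\<lambda>p::real \<times> real \<times> real. fst p * freq b + fst b * freq p)"
      by (intro bounded_linear_add[OF bounded_linear_mult_const bounded_linear_const_mult] bounded_linear_fst bounded_linear_freq')
    then have "smooth (\<lambda>p. \<i> * of_real (fst p * freq b + fst b * freq p))"
      by (intro smooth_cmult smooth_of_real)
    then show "\<exists>m. smooth m \<and> dir_deriv b (\<lambda>p. cis (fst p * freq p)) = (\<lambda>p. m p * cis (fst p * freq p))"
      unfolding E by blast
  qed
qed

lemma smooth_mod_symbol: "smooth \<sigma> \<Longrightarrow> smooth (mod_symbol \<sigma>)"
  unfolding mod_symbol_def[abs_def] by (intro smooth_mult smooth_phase)

text \<open>Differentiating the phase multiplies the symbol by i (alpha + beta), so the growth rises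
  while the modulated form persists.\<close>

lemma bil_dx_power_mod_symbol:
  assumes "poly_symbol \<sigma>" shows "\<exists>\<rho>. poly_symbol \<rho> \<and> (bil_dx ^^ k) (mod_symbol \<sigma>) = mod_symbol \<rho>"
proof (induction k)
  case (Suc k)
  then obtain \<rho> where \<rho>: "poly_symbol \<rho>" "(bil_dx ^^ k) (mod_symbol \<sigma>) = mod_symbol \<rho>" by blast
  have "bil_dx (mod_symbol \<rho>) = mod_symbol (\<lambda>p. \<i> * of_real (freq p) * \<rho> p + dir_deriv (1, 0, 0) \<rho> p)"
    unfolding mod_symbol_def[abs_def] bil_dx_def
      dir_deriv_mult[OF smooth_differentiable[OF smooth_phase] smooth_differentiable[OF poly_symbol_smooth[OF \<rho>(1)]]] bil_dx_phase
    by (simp add: fun_eq_iff algebra_simps)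
  then show ?case
    using \<rho> poly_symbol_add[OF poly_symbol_freq_mult[OF \<rho>(1)] poly_symbol_dir_deriv[OF \<rho>(1)]] by auto
qed (use assms in auto)

lemma mod_symbol_bound:
  assumes \<sigma>: "poly_symbol \<sigma>" and f: "f \<in> schwartz" and g: "g \<in> schwartz"
  shows "\<exists>C\<ge>0. \<forall>p. cmod ((bil_dx ^^ k) (mod_symbol \<sigma>) p * (f (fst (snd p)) * g (snd (snd p)))) \<le> C * int_weight (snd p)"
proof -
  obtain \<rho> K where \<rho>: "(bil_dx ^^ k) (mod_symbol \<sigma>) = mod_symbol \<rho>" "amp (\<lambda>p. poly_weight K K (snd p)) \<rho>"
    using bil_dx_power_mod_symbol[OF \<sigma>, of k] unfolding poly_symbol_def by blast
  obtain A where A: "0 \<le> A" "\<And>p. cmod (\<rho> p) \<le> A * poly_weight K K (snd p)"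
    using bamp_bound[OF \<rho>(2) poly_weight_nonneg] by auto
  \<comment> \<open>Of these powers, \<open>K\<close> compensate the growth of the symbol and 2
    remain for \<open>int_weight\<close>.\<close>
  obtain B where B: "0 \<le> B" "\<And>x. cmod (f x) \<le> B * (1 / (1 + \<bar>x\<bar>) ^ (K + 2))"
    using bamp_bound[OF schwartz_amp_abs[OF f, of "K + 2"]] by auto
  obtain D where D: "0 \<le> D" "\<And>x. cmod (g x) \<le> D * (1 / (1 + \<bar>x\<bar>) ^ (K + 2))"
    using bamp_bound[OF schwartz_amp_abs[OF g, of "K + 2"]] by auto
  have "cmod (mod_symbol \<rho> p * (f (fst (snd p)) * g (snd (snd p)))) \<le> (A * B * D) * int_weight (snd p)" for p
  proof -
    let ?a = "1 + \<bar>fst (snd p)\<bar>" and ?b = "1 + \<bar>snd (snd p)\<bar>"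
    have "cmod (mod_symbol \<rho> p * (f (fst (snd p)) * g (snd (snd p))))
      \<le> (A * poly_weight K K (snd p)) * ((B * (1 / ?a ^ (K + 2))) * (D * (1 / ?b ^ (K + 2))))"
      unfolding mod_symbol_def norm_mult norm_cis mult_1
      by (intro mult_mono A B D mult_nonneg_nonneg poly_weight_nonneg) auto
    also have "\<dots> = (A * B * D) * ((?a ^ K / ?a ^ (K + 2)) * (?b ^ K / ?b ^ (K + 2)))"
    proof -
      have "(A * (x * y)) * ((B * (1 / u)) * (D * (1 / v))) = (A * B * D) * ((x / u) * (y / v))" for x y u v :: real
        by (simp add: mult_ac)
      then show ?thesis unfolding poly_weight_def by blast
    qed
    also have "\<dots> = (A * B * D) * int_weight (snd p)"
    proof -
      have "1 + \<bar>x\<bar> \<noteq> 0" for x :: real by linarith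
      then have "(1 + \<bar>x\<bar>) ^ K / (1 + \<bar>x\<bar>) ^ (K + 2) = 1 / (1 + \<bar>x\<bar>) ^ 2" for x :: real
        by (simp add: power_add power2_eq_square)
      then show ?thesis unfolding int_weight_def by (simp only:)
    qed
    finally show ?thesis .
  qed
  then show ?thesis using A(1) B(1) D(1) unfolding \<rho>(1) by (intro exI[of _ "A * B * D"]) auto
qed

text \<open>\<^const>\<open>bilinear_op\<close> with the Fourier transforms replaced by arbitrary functions, so that it can be
  differentiated and integrated by parts.\<close>
definition bil_integral :: "(real \<times> real \<times> real \<Rightarrow> complex) \<Rightarrow> (real \<Rightarrow> complex) \<Rightarrow> (real \<Rightarrow> complex) \<Rightarrow> real \<Rightarrow> complex" where
  "bil_integral \<sigma> f g y = (\<integral>q. mod_symbol \<sigma> (y, q) * (f (fst q) * g (snd q)) \<partial>lborel)"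

lemma bilinear_op_eq: "bilinear_op \<sigma> f g = bil_integral \<sigma> (fourier f) (fourier g)"
  unfolding bilinear_op_def[abs_def] bil_integral_def[abs_def] mod_symbol_def
  by (intro ext Bochner_Integration.integral_cong refl) (auto simp: split_beta mult.assoc)

lemma amp_bil_integral:
  assumes \<sigma>: "poly_symbol \<sigma>" and f: "f \<in> schwartz" and g: "g \<in> schwartz"
  shows "amp (\<lambda>_. 1) (bil_integral \<sigma> f g)"
    and "(deriv1 ^^ k) (bil_integral \<sigma> f g) y = (\<integral>q. (bil_dx ^^ k) (mod_symbol \<sigma>) (y, q) * (f (fst q) * g (snd q)) \<partial>lborel)"
    and "integrable lborel (\<lambda>q. (bil_dx ^^ k) (mod_symbol \<sigma>) (y, q) * (f (fst q) * g (snd q)))"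
proof -
  let ?F = "\<lambda>q y. mod_symbol \<sigma> (y, q) * (f (fst q) * g (snd q))"
  note sm = smooth_mod_symbol[OF poly_symbol_smooth[OF \<sigma>]]
  have smk: "smooth ((bil_dx ^^ k) (mod_symbol \<sigma>))" for k
    unfolding bil_dx_def by (rule smooth_funpow_dir_deriv[OF sm])
  have eq: "(y, q) = (y, 0) + (0, q)" for y :: real and q :: "real \<times> real" by simp
  have smF: "smooth (\<lambda>y. mod_symbol \<sigma> (y, q))" for q
    by (subst eq) (rule smooth_affine[OF sm bounded_linear_Pair_left])
  have DF: "(deriv1 ^^ k) (?F q) = (\<lambda>y. (bil_dx ^^ k) (mod_symbol \<sigma>) (y, q) * (f (fst q) * g (snd q)))" for k q
  proof -
    have 1: "(deriv1 ^^ k) (\<lambda>y. mod_symbol \<sigma> (y, q)) = (\<lambda>y. (bil_dx ^^ k) (mod_symbol \<sigma>) (y, q))"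
      using deriv1_power_symbol_x[OF sm, of k "(0, q)"] by simp
    have "(deriv1 ^^ k) (\<lambda>y. (f (fst q) * g (snd q)) * mod_symbol \<sigma> (y, q))
      = (\<lambda>y. (f (fst q) * g (snd q)) * (deriv1 ^^ k) (\<lambda>y. mod_symbol \<sigma> (y, q)) y)"
      unfolding funpow_dir_deriv by (rule iter_deriv_cmult[OF smF])
    then show ?thesis unfolding 1 by (simp only: mult.commute)
  qed
  have measF: "(\<lambda>q. (bil_dx ^^ k) (mod_symbol \<sigma>) (y, q) * (f (fst q) * g (snd q))) \<in> borel_measurable lborel" for k y
  proof -
    note [measurable] = smooth_borel[OF smooth_schwartz[OF f]] smooth_borel[OF smooth_schwartz[OF g]]
    have [measurable]: "(\<lambda>q. (bil_dx ^^ k) (mod_symbol \<sigma>) (y, q)) \<in> borel_measurable borel"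
      by (intro borel_measurable_continuous_onI continuous_on_compose2[OF smooth_continuous[OF smk, where S=UNIV]])
         (auto intro!: continuous_intros)
    have [measurable]: "(fst :: real \<times> real \<Rightarrow> real) \<in> borel_measurable borel" "(snd :: real \<times> real \<Rightarrow> real) \<in> borel_measurable borel"
      by (auto intro!: borel_measurable_continuous_onI continuous_intros)
    show ?thesis by measurable
  qed
  have F: "bamp (\<lambda>q _. int_weight q) ?F"
  proof (rule bampI)
    show "smooth (?F q)" for q
      using smooth_cmult[OF smF, of "f (fst q) * g (snd q)" q] by (simp add: mult.commute)
    fix w :: "real list" assume w: "set w \<subseteq> Basis"
    obtain C where "\<And>p. cmod ((bil_dx ^^ length w) (mod_symbol \<sigma>) p * (f (fst (snd p)) * g (snd (snd p)))) \<le> C * int_weight (snd p)"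
      using mod_symbol_bound[OF assms] by blast
    then have "cmod (iter_deriv w (?F q) y) \<le> C * int_weight q" for q y
      unfolding iter_deriv_real[OF w] DF by (metis fst_conv snd_conv)
    then show "\<exists>C. \<forall>q y. cmod (iter_deriv w (?F q) y) \<le> C * int_weight q" by blast
  qed
  have loc: "\<exists>r>0. \<exists>k. integrable lborel k \<and> (\<forall>q. \<forall>y\<in>ball y0 r. int_weight q \<le> k q)" for y0 :: real
    by (rule exI[of _ "1::real"], rule conjI, simp, rule exI[of _ int_weight]) (auto simp: integrable_int_weight)
  have B: "amp (\<lambda>_. 1) (\<lambda>y. \<integral>q. ?F q y \<partial>lborel)" "dominated_family lborel ?F"
    using bamp_integral[OF F int_weight_nonneg _ integrable_int_weight _ loc, of "\<integral>q. int_weight q \<partial>lborel" "\<lambda>_. 1"] measF[of 0]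
    by simp_all
  then show "amp (\<lambda>_. 1) (bil_integral \<sigma> f g)" by (simp add: bil_integral_def[abs_def])
  show "(deriv1 ^^ k) (bil_integral \<sigma> f g) y = (\<integral>q. (bil_dx ^^ k) (mod_symbol \<sigma>) (y, q) * (f (fst q) * g (snd q)) \<partial>lborel)"
    unfolding bil_integral_def[abs_def] funpow_dir_deriv[of k] iter_deriv_integral[OF B(2)]
    by (simp only: funpow_dir_deriv[symmetric] DF)
  show "integrable lborel (\<lambda>q. (bil_dx ^^ k) (mod_symbol \<sigma>) (y, q) * (f (fst q) * g (snd q)))"
    using dominated_family_integrable[OF dominated_family_iter_deriv[OF B(2)], of "replicate k 1" y]
    by (simp only: funpow_dir_deriv[symmetric] DF)
qed

text \<open>The alpha derivative of the integrand integrates to zero; the phase contributes i y, and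
  the other terms are of the same type. Solving for the integral yields one order of decay in
  y.\<close>

lemma bil_integral_ibp:
  assumes \<sigma>: "poly_symbol \<sigma>" and f: "f \<in> schwartz" and g: "g \<in> schwartz"
  shows "bil_integral \<sigma> f g y = resolvent y *
    (bil_integral \<sigma> f g y + - 1 * bil_integral (bil_da \<sigma>) f g y + - 1 * bil_integral \<sigma> (deriv1 f) g y)"
proof -
  let ?e = "\<lambda>q::real \<times> real. cis (y * (fst q + snd q))"
  let ?s = "\<lambda>q. \<sigma> (y, q)"
  have bl: "bounded_linear (\<lambda>q::real \<times> real. y * (fst q + snd q))"
    by (intro bounded_linear_const_mult bounded_linear_add bounded_linear_fst bounded_linear_snd)
  note e = smooth_cis_linear[OF bl]
  have df: "deriv1 f \<in> schwartz" by (rule schwartz_deriv1[OF f])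
  have eq: "(y, q) = (0, q) + (y, 0)" for q :: "real \<times> real" by simp
  have blq: "bounded_linear (\<lambda>q::real \<times> real. (0::real, q))"
    by (intro bounded_linear_Pair bounded_linear_ident bounded_linear_zero)
  note s\<sigma> = poly_symbol_smooth[OF \<sigma>]
  have ss: "smooth ?s" by (subst eq) (rule smooth_affine[OF s\<sigma> blq])
  have Ds: "dir_deriv (1, 0) ?s = (\<lambda>q. bil_da \<sigma> (y, q))"
    by (subst eq, subst dir_deriv_affine[OF smooth_differentiable[OF s\<sigma>] blq]) (simp add: bil_da_def)
  have sf: "smooth f" and sg: "smooth g" using f g by (auto intro: smooth_schwartz)
  have st: "smooth (\<lambda>q. f (fst q) * g (snd q))" by (intro smooth_mult smooth_fst smooth_snd sf sg)
  have Dt: "dir_deriv (1, 0) (\<lambda>q. f (fst q) * g (snd q)) = (\<lambda>q. deriv1 f (fst q) * g (snd q))"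
    using dir_deriv_tensor[OF sf sg, of 1 0] by simp
  have m: "mod_symbol \<rho> (y, q) = ?e q * \<rho> (y, q)" for \<rho> q by (simp add: mod_symbol_def)
  let ?H = "\<lambda>q. ?e q * (?s q * (f (fst q) * g (snd q)))"
  have H: "dir_deriv (1, 0) ?H = (\<lambda>q. (\<i> * of_real y) * (mod_symbol \<sigma> (y, q) * (f (fst q) * g (snd q)))
     + (mod_symbol (bil_da \<sigma>) (y, q) * (f (fst q) * g (snd q)) + mod_symbol \<sigma> (y, q) * (deriv1 f (fst q) * g (snd q))))"
    unfolding dir_deriv_mult[OF smooth_differentiable[OF e(1)] smooth_differentiable[OF smooth_mult[OF ss st]]]
      dir_deriv_mult[OF smooth_differentiable[OF ss] smooth_differentiable[OF st]] e(2) Ds Dt m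
    by (simp add: fun_eq_iff algebra_simps)
  have p\<sigma>: "poly_symbol (bil_da \<sigma>)" unfolding bil_da_def by (rule poly_symbol_dir_deriv[OF \<sigma>])
  have int: "integrable lborel (\<lambda>q. mod_symbol \<rho> (y, q) * (h (fst q) * g (snd q)))"
    if "poly_symbol \<rho>" "h \<in> schwartz" for \<rho> h
    using amp_bil_integral(3)[OF that g, of 0 y] by simp
  have "(\<integral>q. dir_deriv (1, 0) ?H q \<partial>lborel) = 0"
  proof (rule integral_dir_deriv_eq_0)
    show "smooth ?H" by (intro smooth_mult e ss st)
    show "integrable lborel ?H" using int[OF \<sigma> f] by (simp add: m mult.assoc)
    show "integrable lborel (dir_deriv (1, 0) ?H)"
      unfolding H by (intro Bochner_Integration.integrable_add integrable_mult_right int \<sigma> p\<sigma> f df)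
  qed
  then have "(\<i> * of_real y) * bil_integral \<sigma> f g y + (bil_integral (bil_da \<sigma>) f g y + bil_integral \<sigma> (deriv1 f) g y) = 0"
    unfolding H bil_integral_def using int[OF \<sigma> f] int[OF p\<sigma> f] int[OF \<sigma> df] by simp
  then have "(1 + \<i> * of_real y) * bil_integral \<sigma> f g y
     = bil_integral \<sigma> f g y + - 1 * bil_integral (bil_da \<sigma>) f g y + - 1 * bil_integral \<sigma> (deriv1 f) g y"
    by (simp add: algebra_simps)
  then have "resolvent y * (bil_integral \<sigma> f g y + - 1 * bil_integral (bil_da \<sigma>) f g y + - 1 * bil_integral \<sigma> (deriv1 f) g y)
    = (resolvent y * (1 + \<i> * of_real y)) * bil_integral \<sigma> f g y"
    by (simp only: mult.assoc)
  then show ?thesis unfolding resolvent_mult by simp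
qed

text \<open>The Fourier transform inside \<open>psdo\<close> calls for an integrable function of y.
  Repeated integration by parts gives decay of every order, with \<sigma> and \<open>f\<close>
  changing from step to step.\<close>

lemma amp_bil_integral_decay:
  assumes \<sigma>: "poly_symbol \<sigma>" and f: "f \<in> schwartz" and g: "g \<in> schwartz"
  shows "amp (\<lambda>y. 1 / (1 + \<bar>y\<bar>) ^ k) (bil_integral \<sigma> f g)"
  using \<sigma> f
proof (induction k arbitrary: \<sigma> f)
  case 0
  then show ?case using amp_bil_integral(1)[OF 0 g] by simp
next
  case (Suc k)
  have "poly_symbol (bil_da \<sigma>)" unfolding bil_da_def by (rule poly_symbol_dir_deriv[OF Suc.prems(1)])
  moreover have "deriv1 f \<in> schwartz"
    by (rule schwartz_deriv1[OF Suc.prems(2)])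
  ultimately have "amp (\<lambda>y. 1 / (1 + \<bar>y\<bar>) ^ k) (\<lambda>y. bil_integral \<sigma> f g y + - 1 * bil_integral (bil_da \<sigma>) f g y + - 1 * bil_integral \<sigma> (deriv1 f) g y)"
    by (intro uamp_add uamp_cmult Suc.IH Suc.prems)
  from uamp_mult[OF amp_resolvent this]
  have "amp (\<lambda>y. 1 / (1 + \<bar>y\<bar>) ^ Suc k) (\<lambda>y. resolvent y * (bil_integral \<sigma> f g y + - 1 * bil_integral (bil_da \<sigma>) f g y + - 1 * bil_integral \<sigma> (deriv1 f) g y))"
    by simp
  then show ?case unfolding bil_integral_ibp[OF Suc.prems g, symmetric] .
qed

section \<open>Regularized forms of both sides of the operator identity\<close>

lemma amp_tensor_int_weight:
  assumes u: "amp (\<lambda>x. 1 / (1 + \<bar>x\<bar>) ^ 2) u" and v: "amp (\<lambda>x. (1 + \<bar>x\<bar>) ^ l) v" and M: "l + 2 \<le> M"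
  shows "amp int_weight (\<lambda>p. u (fst p) * (resolvent (snd p) ^ M * v (snd p)))"
proof -
  have "amp (\<lambda>x. 1 / (1 + \<bar>x\<bar>) ^ M * (1 + \<bar>x\<bar>) ^ l) (\<lambda>x. resolvent x ^ M * v x)"
    by (rule uamp_mult[OF amp_resolvent_power v])
  then have "amp (\<lambda>x. 1 / (1 + \<bar>x\<bar>) ^ 2) (\<lambda>x. resolvent x ^ M * v x)"
  proof (rule bamp_mono[where B=1])
    fix x :: real
    have "(1 + \<bar>x\<bar>) ^ (l + 2) \<le> (1 + \<bar>x\<bar>) ^ M" using M by (intro power_increasing) auto
    then have "(1 + \<bar>x\<bar>) ^ l * (1 + \<bar>x\<bar>) ^ 2 \<le> (1 + \<bar>x\<bar>) ^ M" by (simp only: power_add)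
    moreover have "0 < (1 + \<bar>x\<bar>) ^ M" "0 < (1 + \<bar>x\<bar>) ^ 2" by (auto intro!: zero_less_power add_pos_nonneg)
    ultimately show "1 / (1 + \<bar>x\<bar>) ^ M * (1 + \<bar>x\<bar>) ^ l \<le> 1 * (1 / (1 + \<bar>x\<bar>) ^ 2)"
      by (simp add: field_simps)
  qed simp
  from uamp_mult[OF bamp_affine[OF u bounded_linear_fst, of "\<lambda>_. 0"] bamp_affine[OF this bounded_linear_snd, of "\<lambda>_. 0"]]
  show ?thesis by (simp add: int_weight_def[abs_def])
qed

text \<open>The factor exp (i x xi) translates the function to z = y - x. Inserting M resolvent
  factors makes the double integral absolutely convergent and Fubini applicable; the steps of
  \<open>opB\<close> then change nothing and match the form of the composed symbol.\<close>

lemma psdo_osc_int: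
  assumes F: "amp (\<lambda>y. 1 / (1 + \<bar>y\<bar>) ^ 2) F" and v: "amp (\<lambda>\<omega>. (1 + \<bar>\<omega>\<bar>) ^ l) (\<lambda>\<omega>. \<tau> (x, \<omega>))" and M: "l + 2 \<le> M"
  shows "psdo \<tau> F x = of_real (1 / (2 * pi)) *
    osc_int ((opB ^^ 2) ((opA ^^ M) (\<lambda>p. F (fst p + x) * \<tau> (x, snd p))))"
proof -
  let ?F = "\<lambda>z. F (z + x)" and ?v = "\<lambda>\<omega>. \<tau> (x, \<omega>)"
  have "amp (\<lambda>z. 1 / (1 + \<bar>z + x\<bar>) ^ 2) ?F" using bamp_affine[OF F bounded_linear_ident, of "\<lambda>_. x"] .
  then have Fx: "amp (\<lambda>z. 1 / (1 + \<bar>z\<bar>) ^ 2) ?F"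
  proof (rule bamp_mono[where B="(1 + \<bar>x\<bar>) ^ 2"])
    fix z :: real
    have "1 + \<bar>z\<bar> \<le> (1 + \<bar>x\<bar>) * (1 + \<bar>z + x\<bar>)"
      unfolding distrib_left distrib_right mult_1 mult_1_right
      using abs_triangle_ineq4[of "z + x" x] mult_nonneg_nonneg[OF abs_ge_zero[of x] abs_ge_zero[of "z + x"]] by linarith
    then have "(1 + \<bar>z\<bar>) ^ 2 \<le> (1 + \<bar>x\<bar>) ^ 2 * (1 + \<bar>z + x\<bar>) ^ 2"
      unfolding power_mult_distrib[symmetric] by (intro power_mono) auto
    moreover have "0 < (1 + \<bar>z\<bar>) ^ 2" "0 < (1 + \<bar>z + x\<bar>) ^ 2" by (auto intro!: zero_less_power add_pos_nonneg)
    ultimately show "1 / (1 + \<bar>z + x\<bar>) ^ 2 \<le> (1 + \<bar>x\<bar>) ^ 2 * (1 / (1 + \<bar>z\<bar>) ^ 2)"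
      by (simp add: field_simps)
  qed simp
  have FT_shift: "cis (x * \<xi>) * FT F \<xi> = FT ?F \<xi>" for \<xi>
  proof -
    have "FT F \<xi> = (\<integral>z. cis (- ((z + x) * \<xi>)) * F (z + x) \<partial>lborel)"
      unfolding FT_def by (rule lborel_integral_translate[symmetric])
    also have "\<dots> = (\<integral>z. cis (- (x * \<xi>)) * (cis (- (z * \<xi>)) * F (z + x)) \<partial>lborel)"
      by (simp add: cis_mult distrib_right mult.assoc[symmetric] add.commute)
    also have "\<dots> = cis (- (x * \<xi>)) * FT ?F \<xi>" unfolding FT_def by (rule integral_mult_right_zero)
    finally have "cis (x * \<xi>) * FT F \<xi> = (cis (x * \<xi>) * cis (- (x * \<xi>))) * FT ?F \<xi>" by (simp only: mult.assoc)
    then show ?thesis by (simp add: cis_mult)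
  qed
  let ?b = "(opA ^^ M) (\<lambda>p. ?F (fst p) * ?v (snd p))"
  have b: "?b = (\<lambda>p. (one_plus_deriv ^^ M) ?F (fst p) * (resolvent (snd p) ^ M * ?v (snd p)))"
    by (rule opA_tensor[OF uamp_smooth[OF Fx] uamp_smooth[OF v]])
  have amp_b: "amp int_weight ?b"
    unfolding b by (rule amp_tensor_int_weight[OF amp_one_plus_deriv_power[OF Fx] v M])
  have "psdo \<tau> F x = (\<integral>\<xi>. of_real (1 / (2 * pi)) * (FT ?F \<xi> * \<tau> (x, \<xi>)) \<partial>lborel)"
    unfolding psdo_def fourier_FT FT_shift[symmetric] by (simp only: mult_ac)
  also have "\<dots> = of_real (1 / (2 * pi)) * (\<integral>\<xi>. FT ?F \<xi> * \<tau> (x, \<xi>) \<partial>lborel)"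
    by (rule integral_mult_right_zero)
  also have "(\<integral>\<xi>. FT ?F \<xi> * \<tau> (x, \<xi>) \<partial>lborel)
     = (\<integral>\<xi>. (\<integral>z. osc_exp (z, \<xi>) * ?b (z, \<xi>) \<partial>lborel) \<partial>lborel)"
  proof (rule Bochner_Integration.integral_cong[OF refl])
    fix \<xi>
    have "FT ?F \<xi> * \<tau> (x, \<xi>) = (resolvent \<xi> ^ M * \<tau> (x, \<xi>)) * FT ((one_plus_deriv ^^ M) ?F) \<xi>"
      by (subst FT_one_plus_deriv_power[OF Fx, of _ M]) (simp only: mult_ac)
    also have "\<dots> = (\<integral>z. (resolvent \<xi> ^ M * \<tau> (x, \<xi>)) * (cis (- (z * \<xi>)) * (one_plus_deriv ^^ M) ?F z) \<partial>lborel)"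
      unfolding FT_def by (rule integral_mult_right_zero[symmetric])
    also have "\<dots> = (\<integral>z. osc_exp (z, \<xi>) * ?b (z, \<xi>) \<partial>lborel)"
      unfolding b osc_exp_def fst_conv snd_conv by (simp only: mult_ac)
    finally show "FT ?F \<xi> * \<tau> (x, \<xi>) = (\<integral>z. osc_exp (z, \<xi>) * ?b (z, \<xi>) \<partial>lborel)" .
  qed
  also have "\<dots> = osc_int ?b"
    unfolding osc_int_def by (rule lborel_integral_snd[OF amp_integrable(1)[OF amp_b], symmetric])
  also have "\<dots> = osc_int ((opB ^^ 2) ?b)" using osc_int_ops[OF amp_b, of 2 0] by simp
  finally show ?thesis .
qed

lemma deriv1_power_shift:
  assumes "smooth u" shows "(deriv1 ^^ k) (\<lambda>z. u (z + x)) = (\<lambda>z. (deriv1 ^^ k) u (z + x))"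
  using iter_deriv_affine[OF assms bounded_linear_ident, of "replicate k 1" x]
  by (simp only: funpow_dir_deriv list.map_ident)

text \<open>The phase has modulus 1, and x derivatives only bring powers of the fixed
  frequencies.\<close>

lemma amp_mod_symbol_x:
  assumes "poly_symbol \<sigma>" shows "amp (\<lambda>_. 1) (\<lambda>z. mod_symbol \<sigma> ((z, 0) + p))"
proof (rule bampI)
  note sm = smooth_mod_symbol[OF poly_symbol_smooth[OF assms]]
  show "smooth (\<lambda>z. mod_symbol \<sigma> ((z, 0) + p))" by (rule smooth_affine[OF sm bounded_linear_Pair_left])
  fix w :: "real list" assume w: "set w \<subseteq> Basis"
  obtain \<rho> K where \<rho>: "(bil_dx ^^ length w) (mod_symbol \<sigma>) = mod_symbol \<rho>" "amp (\<lambda>p. poly_weight K K (snd p)) \<rho>"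
    using bil_dx_power_mod_symbol[OF assms, of "length w"] unfolding poly_symbol_def by blast
  obtain A where A: "\<And>p. cmod (\<rho> p) \<le> A * poly_weight K K (snd p)"
    using bamp_bound[OF \<rho>(2) poly_weight_nonneg] by blast
  have "cmod (iter_deriv w (\<lambda>z. mod_symbol \<sigma> ((z, 0) + p)) z) \<le> (A * poly_weight K K (snd p)) * 1" for z
    unfolding iter_deriv_real[OF w] deriv1_power_symbol_x[OF sm] \<rho>(1) unfolding mod_symbol_def norm_mult norm_cis mult_1 mult_1_right
    using A[of "(z, 0) + p"] by simp
  then show "\<exists>C. \<forall>q z. cmod (iter_deriv w (\<lambda>z. mod_symbol \<sigma> ((z, 0) + p)) z) \<le> C * 1" by blast
qed

text \<open>Multiplying by exp (i x (xi + eta)) changes exp (i (x - y) (alpha - xi - eta)) into exp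
  (i (x - y) alpha) exp (i y (xi + eta)). Modulated, the symbol is thus formally \<tau>(x, D)
  applied to the modulated \<sigma> at fixed frequencies. The origin is (x, 0) this time, since the
  frequency is not shifted.\<close>

lemma comp_symbol_mod_symbol:
  assumes \<sigma>: "poly_symbol \<sigma>" and v: "amp (\<lambda>\<omega>. (1 + \<bar>\<omega>\<bar>) ^ l) (\<lambda>\<omega>. \<tau> (x, \<omega>))" and M: "l + 2 \<le> M"
  shows "mod_symbol (comp_symbol \<tau> \<sigma>) (x, q) = of_real (1 / (2 * pi)) *
    osc_int ((opB ^^ 2) ((opA ^^ M) (\<lambda>p. mod_symbol \<sigma> ((fst p, 0) + (x, q)) * \<tau> (x, snd p))))"
proof -
  let ?s = "fst q + snd q" and ?a = "\<lambda>p. mod_symbol \<sigma> ((fst p, 0) + (x, q)) * \<tau> (x, snd p)"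
  have "amp (\<lambda>z. (1 + \<bar>z\<bar>) ^ 0) (\<lambda>z. mod_symbol \<sigma> ((z, 0) + (x, q)))"
    unfolding power_0 by (rule amp_mod_symbol_x[OF \<sigma>])
  from amp_tensor[OF this v] have a: "amp (poly_weight 0 l) ?a" .
  have "comp_integrand \<tau> \<sigma> (x, q) (p + (x, 0)) = cis (- (x * ?s)) * (osc_exp p * ?a p)" for p
  proof -
    have "cis (- (fst p * (snd p - ?s))) = cis (- (x * ?s)) * (osc_exp p * cis ((fst p + x) * ?s))"
      unfolding osc_exp_def cis_mult by (rule arg_cong[where f=cis]) (simp add: algebra_simps)
    then show ?thesis
      by (cases p; cases q) (simp add: comp_integrand_def mod_symbol_def mult_ac)
  qed
  from has_osc_integralI[OF a osc_limI[OF a _ M, of 2] this]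
  have "comp_symbol \<tau> \<sigma> (x, q) = of_real (1 / (2 * pi)) * (cis (- (x * ?s)) * osc_int ((opB ^^ 2) ((opA ^^ M) ?a)))"
    by (intro comp_symbol_eq) simp
  then have "mod_symbol (comp_symbol \<tau> \<sigma>) (x, q) = (cis (x * ?s) * cis (- (x * ?s))) *
     (of_real (1 / (2 * pi)) * osc_int ((opB ^^ 2) ((opA ^^ M) ?a)))"
    by (simp only: mod_symbol_def fst_conv snd_conv mult_ac)
  then show ?thesis by (simp add: cis_mult)
qed

text \<open>Both sides are the same absolutely convergent integral over the amplitude variables and the two
  frequencies, once the oscillatory integrals are written in their regularized form.\<close>
lemma psdo_bilinear_op:
  assumes \<sigma>: "poly_symbol \<sigma>" and \<tau>: "lin_symbol t \<tau>" and f: "f \<in> schwartz" and g: "g \<in> schwartz"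
  shows "psdo \<tau> (bilinear_op \<sigma> f g) = bilinear_op (comp_symbol \<tau> \<sigma>) f g"
proof (rule ext)
  fix x
  let ?f = "fourier f" and ?g = "fourier g" and ?v = "\<lambda>\<omega>. \<tau> (x, \<omega>)"
  note f' = fourier_schwartz[OF f] and g' = fourier_schwartz[OF g]
  let ?F = "bil_integral \<sigma> ?f ?g" and ?fg = "\<lambda>q. fourier f (fst q) * fourier g (snd q)"
  obtain l :: nat where l: "\<bar>t\<bar> \<le> real l" using real_arch_simple by blast
  define M where "M = l + 2"
  have M: "l + 2 \<le> M" by (simp add: M_def)
  have v: "amp (\<lambda>\<omega>. (1 + \<bar>\<omega>\<bar>) ^ l) ?v" using amp_lin_symbol_xi[OF \<tau> l, of x 0] by simp
  note sF = uamp_smooth[OF amp_bil_integral(1)[OF \<sigma> f' g']]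
  have sFx: "smooth (\<lambda>z. ?F (z + x))" by (rule smooth_affine[OF sF bounded_linear_ident])
  note sm = smooth_mod_symbol[OF poly_symbol_smooth[OF \<sigma>]]
  \<comment> \<open>\<open>V\<close> and \<open>R\<close> carry \<tau> and the oscillation,
    \<open>G\<close> the derivatives of the modulated symbol. Neither \<open>R\<close> nor the
    Schwartz factors couple the amplitude variables to the frequencies; only \<open>G\<close>
    does.\<close>
  define V where "V = (one_plus_deriv ^^ 2) (\<lambda>\<omega>. resolvent \<omega> ^ M * ?v \<omega>)"
  define R where "R p = osc_exp p * (resolvent (fst p) ^ 2 * V (snd p))" for p
  define G where "G p = (\<Sum>i\<le>M. of_nat (M choose i) * (bil_dx ^^ i) (mod_symbol \<sigma>) p)" for p
  have one: "(one_plus_deriv ^^ M) (\<lambda>z. mod_symbol \<sigma> ((z, 0) + (x, q))) z = G ((z, 0) + (x, q))" for z q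
  proof -
    have "smooth (\<lambda>z. mod_symbol \<sigma> ((z, 0) + (x, q)))" by (rule smooth_affine[OF sm bounded_linear_Pair_left])
    from one_plus_deriv_sum[OF this] show ?thesis unfolding deriv1_power_symbol_x[OF sm] G_def by simp
  qed
  have oneF: "(one_plus_deriv ^^ M) (\<lambda>z. ?F (z + x)) z = (\<integral>q. G (z + x, q) * ?fg q \<partial>lborel)" for z
    unfolding one_plus_deriv_sum[OF sFx] deriv1_power_shift[OF sF] amp_bil_integral(2)[OF \<sigma> f' g'] G_def sum_distrib_right
    using amp_bil_integral(3)[OF \<sigma> f' g']
    by (simp add: mult.assoc)
  have sV: "smooth V"
    unfolding V_def by (intro smooth_funpow_one_plus_deriv smooth_mult smooth_resolvent_power uamp_smooth[OF v])
  have sR: "smooth R"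
    unfolding R_def[abs_def] by (intro smooth_mult smooth_osc_exp smooth_fst smooth_snd smooth_resolvent_power sV)
  have sG: "smooth G"
    unfolding G_def[abs_def] bil_dx_def by (intro smooth_sum smooth_cmult smooth_funpow_dir_deriv sm) simp
  have opsF: "osc_int ((opB ^^ 2) ((opA ^^ M) (\<lambda>p. ?F (fst p + x) * ?v (snd p)))) = (\<integral>p. R p * (\<integral>q. G (fst p + x, q) * ?fg q \<partial>lborel) \<partial>lborel)"
    unfolding osc_int_def ops_tensor[OF sFx uamp_smooth[OF v]] oneF R_def V_def by (simp only: mult_ac)
  have opsq: "osc_int ((opB ^^ 2) ((opA ^^ M) (\<lambda>p. mod_symbol \<sigma> ((fst p, 0) + (x, q)) * ?v (snd p)))) = (\<integral>p. R p * G (fst p + x, q) \<partial>lborel)" for q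
    unfolding osc_int_def ops_tensor[OF uamp_smooth[OF amp_mod_symbol_x[OF \<sigma>]] uamp_smooth[OF v]] one R_def V_def
    by (simp add: mult_ac)
  let ?H = "\<lambda>(p, q). R p * (G (fst p + x, q) * ?fg q)"
  have int: "integrable lborel ?H"
  proof -
    have "amp int_weight (\<lambda>p. resolvent (fst p) ^ 2 * (resolvent (snd p) ^ M * ?v (snd p)))"
      by (rule amp_tensor_int_weight[OF amp_resolvent_power v M])
    moreover have "amp (\<lambda>x. 1 / (1 + \<bar>x\<bar>) ^ 2) (\<lambda>x. resolvent x ^ M * ?v x)"
    proof (rule bamp_mono[OF uamp_mult[OF amp_resolvent_power[of M] v], where B=1])
      fix x :: real
      have "(1 + \<bar>x\<bar>) ^ M = (1 + \<bar>x\<bar>) ^ l * (1 + \<bar>x\<bar>) ^ 2" by (simp add: M_def power_add power2_eq_square)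
      then show "1 / (1 + \<bar>x\<bar>) ^ M * (1 + \<bar>x\<bar>) ^ l \<le> 1 * (1 / (1 + \<bar>x\<bar>) ^ 2)" by simp
    qed simp
    then have "amp (\<lambda>x. 1 / (1 + \<bar>x\<bar>) ^ 2) V" unfolding V_def by (rule amp_one_plus_deriv_power)
    from uamp_mult[OF bamp_affine[OF amp_resolvent_power[of 2] bounded_linear_fst, of "\<lambda>_. 0"] bamp_affine[OF this bounded_linear_snd, of "\<lambda>_. 0"]]
    have "amp int_weight (\<lambda>p. resolvent (fst p) ^ 2 * V (snd p))" by (simp add: int_weight_def[abs_def])
    from bamp_bound[OF this int_weight_nonneg]
    obtain A where A: "0 \<le> A" "\<And>p. cmod (R p) \<le> A * int_weight p"
      by (auto simp: R_def norm_mult)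
    obtain B where B: "\<And>i p. cmod ((bil_dx ^^ i) (mod_symbol \<sigma>) p * ?fg (snd p)) \<le> B i * int_weight (snd p)" "\<And>i. 0 \<le> B i"
      using mod_symbol_bound[OF \<sigma> f' g'] by metis
    define D where "D = (\<Sum>i\<le>M. real (M choose i) * B i)"
    have D0: "0 \<le> D" unfolding D_def by (intro sum_nonneg mult_nonneg_nonneg B) simp
    have D: "cmod (G p * ?fg (snd p)) \<le> D * int_weight (snd p)" for p
    proof -
      have "cmod (G p * ?fg (snd p)) \<le> (\<Sum>i\<le>M. cmod (of_nat (M choose i) * ((bil_dx ^^ i) (mod_symbol \<sigma>) p * ?fg (snd p))))"
        unfolding G_def sum_distrib_right mult.assoc by (rule norm_sum)
      also have "\<dots> \<le> (\<Sum>i\<le>M. real (M choose i) * (B i * int_weight (snd p)))"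
        unfolding norm_mult[of "of_nat _"] norm_of_nat by (intro sum_mono mult_left_mono B) simp
      finally show ?thesis by (simp add: D_def sum_distrib_right mult.assoc)
    qed
    \<comment> \<open>The weight in the amplitude variables comes from the regularization, the
      weight in the frequencies from the Schwartz factors.\<close>
    have "integrable lborel (\<lambda>pq. (A * D) * (int_weight (fst pq) * int_weight (snd pq)))"
      by (intro integrable_mult_right integrable_lborel_mult_prod integrable_int_weight)
    then show ?thesis
    proof (rule Bochner_Integration.integrable_bound)
      have [measurable]: "(\<lambda>pq :: (real \<times> real) \<times> (real \<times> real). R (fst pq)) \<in> borel_measurable borel"
        by (intro borel_measurable_continuous_onI continuous_on_compose2[OF smooth_continuous[OF sR, where S=UNIV]])
           (auto intro!: continuous_intros)
      have [measurable]: "(\<lambda>pq :: (real \<times> real) \<times> (real \<times> real). G (fst (fst pq) + x, snd pq)) \<in> borel_measurable borel"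
        by (intro borel_measurable_continuous_onI continuous_on_compose2[OF smooth_continuous[OF sG, where S=UNIV]])
           (auto intro!: continuous_intros)
      have [measurable]: "(\<lambda>pq :: (real \<times> real) \<times> (real \<times> real). ?fg (snd pq)) \<in> borel_measurable borel"
        by (intro borel_measurable_continuous_onI continuous_intros
            continuous_on_compose2[OF smooth_continuous[OF smooth_schwartz[OF f'], where S=UNIV]]
            continuous_on_compose2[OF smooth_continuous[OF smooth_schwartz[OF g'], where S=UNIV]]) auto
      show "?H \<in> borel_measurable lborel" unfolding split_beta by measurable
      show "AE pq in lborel. norm (?H pq) \<le> norm ((A * D) * (int_weight (fst pq) * int_weight (snd pq)))"
      proof (rule AE_I2)
        fix pq :: "(real \<times> real) \<times> (real \<times> real)"
        have "norm (?H pq) \<le> (A * int_weight (fst pq)) * (D * int_weight (snd pq))"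
          unfolding split_beta norm_mult[of "R _"]
          using D[of "(fst (fst pq) + x, snd pq)"] A
          by (intro mult_mono mult_nonneg_nonneg int_weight_nonneg) auto
        then show "norm (?H pq) \<le> norm ((A * D) * (int_weight (fst pq) * int_weight (snd pq)))"
          by (simp add: mult_ac)
      qed
    qed
  qed
  have "psdo \<tau> (bilinear_op \<sigma> f g) x = of_real (1 / (2 * pi)) * (\<integral>p. (\<integral>q. ?H (p, q) \<partial>lborel) \<partial>lborel)"
    unfolding bilinear_op_eq psdo_osc_int[OF amp_bil_integral_decay[OF \<sigma> f' g'] v M] opsF prod.case integral_mult_right_zero ..
  also have "(\<integral>p. (\<integral>q. ?H (p, q) \<partial>lborel) \<partial>lborel) = (\<integral>q. (\<integral>p. ?H (p, q) \<partial>lborel) \<partial>lborel)"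
    using lborel_integral_fst[OF int] lborel_integral_snd[OF int] by (simp only:)
  also have "\<dots> = (\<integral>q. (\<integral>p. R p * G (fst p + x, q) \<partial>lborel) * ?fg q \<partial>lborel)"
    unfolding prod.case mult.assoc[symmetric] integral_mult_left_zero ..
  also have "of_real (1 / (2 * pi)) * \<dots> = (\<integral>q. of_real (1 / (2 * pi)) * ((\<integral>p. R p * G (fst p + x, q) \<partial>lborel) * ?fg q) \<partial>lborel)"
    by (rule integral_mult_right_zero[symmetric])
  also have "\<dots> = bil_integral (comp_symbol \<tau> \<sigma>) ?f ?g x"
    unfolding bil_integral_def comp_symbol_mod_symbol[OF \<sigma> v M] opsq by (simp only: mult.assoc)
  finally show "psdo \<tau> (bilinear_op \<sigma> f g) x = bilinear_op (comp_symbol \<tau> \<sigma>) f g x"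
    unfolding bilinear_op_eq .
qed

section \<open>From the locale to the two symbol classes\<close>

context symbol_directions
begin

text \<open>Bridge to the explicit definitions: sorted derivatives bounded by negative powers of
  \<open>U\<close> and \<open>V\<close>, against arbitrary words with one gain per letter.\<close>

lemma bil_symbol_iff:
  "bil_symbol W \<sigma> \<longleftrightarrow> smooth \<sigma> \<and> (\<forall>a b c. \<exists>C. \<forall>p.
     cmod ((dir_deriv (1, 0, 0) ^^ a) ((dir_deriv e1 ^^ b) ((dir_deriv e2 ^^ c) \<sigma>)) p)
       \<le> C * W (snd p) * U (snd p) powr (- real b) * V (snd p) powr (- real c))"
proof -
  have pow: "x powr (- real n) = (1 / x) ^ n" if "1 \<le> x" for x :: real and n
    using that by (simp add: powr_minus powr_realpow power_divide inverse_eq_divide)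
  have gain: "(\<Prod>e\<leftarrow>replicate a (1, 0, 0) @ replicate b e1 @ replicate c e2. gain e p)
     = U (snd p) powr (- real b) * V (snd p) powr (- real c)" for a b c p
    using e_neq by (simp add: prod_list_replicate pow[OF U_ge] pow[OF V_ge])
      (simp add: gain_def)
  show ?thesis
  proof (intro iffI conjI allI)
    assume \<sigma>: "bil_symbol W \<sigma>"
    then show "smooth \<sigma>" by (rule bil_symbol_smooth)
    fix a b c
    have "set (replicate a (1, 0, 0) @ replicate b e1 @ replicate c e2) \<subseteq> dirs" by auto
    from uampD[OF \<sigma>[unfolded bil_symbol_def] this]
    show "\<exists>C. \<forall>p. cmod ((dir_deriv (1, 0, 0) ^^ a) ((dir_deriv e1 ^^ b) ((dir_deriv e2 ^^ c) \<sigma>)) p)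
       \<le> C * W (snd p) * U (snd p) powr (- real b) * V (snd p) powr (- real c)"
      unfolding gain by (simp add: mult.assoc)
  next
    assume R: "smooth \<sigma> \<and> (\<forall>a b c. \<exists>C. \<forall>p.
     cmod ((dir_deriv (1, 0, 0) ^^ a) ((dir_deriv e1 ^^ b) ((dir_deriv e2 ^^ c) \<sigma>)) p)
       \<le> C * W (snd p) * U (snd p) powr (- real b) * V (snd p) powr (- real c))"
    have "uamp (set [(1, 0, 0), e1, e2]) (\<lambda>e _. gain e) (\<lambda>_::unit. \<lambda>p. W (snd p)) (\<lambda>_. \<sigma>)"
    proof (rule uamp_sortedI)
      fix n :: "real \<times> real \<times> real \<Rightarrow> nat"
      have eq: "concat (map (\<lambda>e. replicate (n e) e) [(1, 0, 0), e1, e2])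
        = replicate (n (1, 0, 0)) (1, 0, 0) @ replicate (n e1) e1 @ replicate (n e2) e2" by simp
      show "\<exists>C. \<forall>p. cmod (iter_deriv (concat (map (\<lambda>e. replicate (n e) e) [(1, 0, 0), e1, e2])) \<sigma> p)
        \<le> C * W (snd p) * (\<Prod>e\<leftarrow>concat (map (\<lambda>e. replicate (n e) e) [(1, 0, 0), e1, e2]). gain e p)"
        unfolding eq gain using R by (simp add: mult.assoc)
    qed (use R e_neq e_neq_dx in auto)
    then show "bil_symbol W \<sigma>" by (simp add: bil_symbol_def)
  qed
qed

lemma bil_symbol_poly_symbol:
  assumes "bil_symbol W \<sigma>" "\<And>p. 0 \<le> W p" "\<And>p. W p \<le> poly_weight K K p"
  shows "poly_symbol \<sigma>"
  unfolding poly_symbol_def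
  by (intro exI[of _ K] bamp_mono[OF bil_symbol_amp[OF assms(1,2)], where B=1]) (auto simp: assms)

end

text \<open>A difference of partial derivatives is a directional derivative once the function is
  differentiable; smoothness of all iterates lets the identification be repeated.\<close>

lemma smooth_funpow_bil_dba: "smooth \<sigma> \<Longrightarrow> (bil_dba ^^ k) \<sigma> = (dir_deriv (0, -1, 1) ^^ k) \<sigma>"
proof (induction k)
  case (Suc k)
  have "bil_dba \<rho> = dir_deriv (0, -1, 1) \<rho>" if "smooth \<rho>" for \<rho>
    using dir_deriv_lin[OF smooth_differentiable[OF that], of "-1" "(0, 1, 0)" "(0, 0, 1)"]
    by (simp add: bil_dba_def bil_da_def bil_db_def)
  then show ?case using Suc smooth_funpow_dir_deriv[OF Suc.prems] by simp
qed simp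

lemma smooth_funpow_bil_dab: "smooth \<sigma> \<Longrightarrow> (bil_dab ^^ k) \<sigma> = (dir_deriv (0, 1, -1) ^^ k) \<sigma>"
proof (induction k)
  case (Suc k)
  have "bil_dab \<rho> = dir_deriv (0, 1, -1) \<rho>" if "smooth \<rho>" for \<rho>
    using dir_deriv_lin[OF smooth_differentiable[OF that], of "-1" "(0, 0, 1)" "(0, 1, 0)"]
    by (simp add: bil_dab_def bil_da_def bil_db_def)
  then show ?case using Suc smooth_funpow_dir_deriv[OF Suc.prems] by simp
qed simp

lemma weight_powr_le:
  assumes "\<bar>m\<bar> \<le> real K" "1 + \<bar>x\<bar> \<le> a * b" shows "(1 + \<bar>x\<bar>) powr m \<le> a ^ K * b ^ K"
proof -
  have "(1 + \<bar>x\<bar>) powr m \<le> (1 + \<bar>x\<bar>) powr real K" using assms(1) by (intro powr_mono) auto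
  also have "\<dots> = (1 + \<bar>x\<bar>) ^ K" by (simp add: powr_realpow add_pos_nonneg)
  also have "\<dots> \<le> (a * b) ^ K" using assms(2) by (intro power_mono) auto
  finally show ?thesis by (simp add: power_mult_distrib)
qed

lemma ex_poly_weight_bound:
  "\<exists>K. \<forall>p. (1 + \<bar>fst p + snd p\<bar>) powr m1 * (1 + \<bar>snd p\<bar>) powr m2 \<le> poly_weight K K p"
  "\<exists>K. \<forall>p. (1 + \<bar>fst p\<bar>) powr m1 * (1 + \<bar>fst p + snd p\<bar>) powr m2 \<le> poly_weight K K p"
proof -
  obtain K :: nat where "max \<bar>m1\<bar> \<bar>m2\<bar> \<le> real K" using real_arch_simple by blast
  then have K: "\<bar>m1\<bar> \<le> real K" "\<bar>m2\<bar> \<le> real K" by auto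
  have s: "1 + \<bar>x + y\<bar> \<le> (1 + \<bar>x\<bar>) * (1 + \<bar>y\<bar>)" "1 + \<bar>x\<bar> \<le> (1 + \<bar>x\<bar>) * (1 + \<bar>y\<bar>)" "1 + \<bar>y\<bar> \<le> (1 + \<bar>x\<bar>) * (1 + \<bar>y\<bar>)" for x y :: real
    unfolding distrib_left distrib_right mult_1 mult_1_right
    using abs_triangle_ineq[of x y] mult_nonneg_nonneg[OF abs_ge_zero[of x] abs_ge_zero[of y]] by linarith+
  \<comment> \<open>Both powers are estimated by the same product, hence the exponent 2 K.\<close>
  have eq: "(a ^ K * b ^ K) * (a ^ K * b ^ K) = a ^ (2 * K) * b ^ (2 * K)" for a b :: real
    unfolding mult_2 power_add by (simp only: mult_ac)
  have "(1 + \<bar>fst p + snd p\<bar>) powr m1 * (1 + \<bar>snd p\<bar>) powr m2 \<le> poly_weight (2 * K) (2 * K) p" for p :: "real \<times> real"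
    unfolding poly_weight_def eq[symmetric] by (intro mult_mono weight_powr_le K s) auto
  then show "\<exists>K. \<forall>p. (1 + \<bar>fst p + snd p\<bar>) powr m1 * (1 + \<bar>snd p\<bar>) powr m2 \<le> poly_weight K K p" by blast
  have "(1 + \<bar>fst p\<bar>) powr m1 * (1 + \<bar>fst p + snd p\<bar>) powr m2 \<le> poly_weight (2 * K) (2 * K) p" for p :: "real \<times> real"
    unfolding poly_weight_def eq[symmetric] by (intro mult_mono weight_powr_le K s) auto
  then show "\<exists>K. \<forall>p. (1 + \<bar>fst p\<bar>) powr m1 * (1 + \<bar>fst p + snd p\<bar>) powr m2 \<le> poly_weight K K p" by blast
qed

text \<open>The direction (0, 1, 0) moves alpha + beta at unit speed, and the minimum in its gain
  contains |alpha + beta|; (0, -1, 1) leaves alpha + beta fixed.\<close>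

lemma symbol_directions_BS1:
  "symbol_directions (0, 1, 0) (0, -1, 1)
     (\<lambda>p. 1 + min \<bar>fst p + snd p\<bar> \<bar>snd p - tan \<theta> * fst p\<bar>) (\<lambda>p. 1 + min \<bar>snd p\<bar> \<bar>snd p - tan \<theta> * fst p\<bar>)"
proof
  let ?E = "{(1, 0, 0), (0, 1, 0), (0, -1, 1)} :: (real \<times> real \<times> real) set"
  have "(0, 1, 0) + (0, -1, 1) \<in> span ?E" by (intro span_add span_base) auto
  then show "(Basis :: (real \<times> real \<times> real) set) \<subseteq> span ?E"
    unfolding Basis_prod_real3 by (auto intro: span_base)
qed auto

text \<open>The roles are exchanged: (0, 1, -1) leaves alpha + beta fixed and (0, 0, 1) moves it, so
  here |alpha + beta| sits in the second gain.\<close>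

lemma symbol_directions_BS2:
  "symbol_directions (0, 1, -1) (0, 0, 1)
     (\<lambda>p. 1 + min \<bar>fst p\<bar> \<bar>snd p - tan \<theta> * fst p\<bar>) (\<lambda>p. 1 + min \<bar>fst p + snd p\<bar> \<bar>snd p - tan \<theta> * fst p\<bar>)"
proof
  let ?E = "{(1, 0, 0), (0, 1, -1), (0, 0, 1)} :: (real \<times> real \<times> real) set"
  have "(0, 1, -1) + (0, 0, 1) \<in> span ?E" by (intro span_add span_base) auto
  then show "(Basis :: (real \<times> real \<times> real) set) \<subseteq> span ?E"
    unfolding Basis_prod_real3 by (auto intro: span_base)
qed auto

context symbol_directions
begin

lemma composition:
  assumes \<sigma>: "bil_symbol W \<sigma>" and W: "\<And>p. 0 \<le> W p" "continuous_on UNIV W" "\<exists>K. \<forall>p. W p \<le> poly_weight K K p"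
    and \<tau>: "lin_symbol t \<tau>"
  shows "(\<forall>p. \<exists>I. has_osc_integral (comp_integrand \<tau> \<sigma> p) I) \<and>
    bil_symbol (\<lambda>p. W p * (1 + \<bar>fst p + snd p\<bar>) powr t) (comp_symbol \<tau> \<sigma>) \<and>
    (\<forall>f \<in> schwartz. \<forall>g \<in> schwartz. psdo \<tau> (bilinear_op \<sigma> f g) = bilinear_op (comp_symbol \<tau> \<sigma>) f g) \<and>
    (\<forall>N. bil_symbol (\<lambda>p. W p * (1 + \<bar>fst p + snd p\<bar>) powr (t - real N))
       (\<lambda>p. comp_symbol \<tau> \<sigma> p - comp_expansion N \<tau> \<sigma> p))"
proof -
  obtain K where "\<And>p. W p \<le> poly_weight K K p" using W(3) by blast
  then have "poly_symbol \<sigma>" by (rule bil_symbol_poly_symbol[OF \<sigma> W(1)])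
  then show ?thesis
    using ex_has_osc_integral[OF \<sigma> W(1) \<tau>] bil_symbol_comp_symbol[OF \<sigma> W(1,2) \<tau>]
      psdo_bilinear_op[OF _ \<tau>] bil_symbol_remainder[OF \<sigma> W(1,2) \<tau>] by blast
qed

end

theorem theorem3p8:
  fixes \<theta> m1 m2 t :: real
    and \<tau> :: "real \<times> real \<Rightarrow> complex"
  assumes "- pi / 2 < \<theta>" and "\<theta> < pi / 2"
    and "\<tau> \<in> S_class t"
  shows
    "(\<forall>\<sigma> \<in> BS1 m1 m2 \<theta>.
        (\<forall>p. \<exists>I. has_osc_integral (comp_integrand \<tau> \<sigma> p) I) \<and>
        comp_symbol \<tau> \<sigma> \<in> BS1 (m1 + t) m2 \<theta> \<and>
        (\<forall>f \<in> schwartz. \<forall>g \<in> schwartz.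
           psdo \<tau> (bilinear_op \<sigma> f g) = bilinear_op (comp_symbol \<tau> \<sigma>) f g) \<and>
        (\<forall>N. (\<lambda>p. comp_symbol \<tau> \<sigma> p - comp_expansion N \<tau> \<sigma> p)
                \<in> BS1 (m1 + t - real N) m2 \<theta>))
     \<and>
     (\<forall>\<sigma> \<in> BS2 m1 m2 \<theta>.
        (\<forall>p. \<exists>I. has_osc_integral (comp_integrand \<tau> \<sigma> p) I) \<and>
        comp_symbol \<tau> \<sigma> \<in> BS2 m1 (m2 + t) \<theta> \<and>
        (\<forall>f \<in> schwartz. \<forall>g \<in> schwartz.
           psdo \<tau> (bilinear_op \<sigma> f g) = bilinear_op (comp_symbol \<tau> \<sigma>) f g) \<and>
        (\<forall>N. (\<lambda>p. comp_symbol \<tau> \<sigma> p - comp_expansion N \<tau> \<sigma> p)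
                \<in> BS2 m1 (m2 + t - real N) \<theta>))"
proof -
  note \<tau> = S_class_lin_symbol[OF assms(3)]
  let ?W1 = "\<lambda>m1 m2 p. (1 + \<bar>fst p + snd p\<bar>) powr m1 * (1 + \<bar>snd p\<bar>) powr m2"
  let ?W2 = "\<lambda>m1 m2 p. (1 + \<bar>fst p\<bar>) powr m1 * (1 + \<bar>fst p + snd p\<bar>) powr m2"
  interpret one: symbol_directions "(0, 1, 0)" "(0, -1, 1)"
    "\<lambda>p. 1 + min \<bar>fst p + snd p\<bar> \<bar>snd p - tan \<theta> * fst p\<bar>" "\<lambda>p. 1 + min \<bar>snd p\<bar> \<bar>snd p - tan \<theta> * fst p\<bar>"
    by (rule symbol_directions_BS1)
  interpret two: symbol_directions "(0, 1, -1)" "(0, 0, 1)"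
    "\<lambda>p. 1 + min \<bar>fst p\<bar> \<bar>snd p - tan \<theta> * fst p\<bar>" "\<lambda>p. 1 + min \<bar>fst p + snd p\<bar> \<bar>snd p - tan \<theta> * fst p\<bar>"
    by (rule symbol_directions_BS2)
  \<comment> \<open>The smoothness clause of the class lets the iterated \<open>bil_dba\<close> be
    read as a directional derivative.\<close>
  have B1: "\<sigma> \<in> BS1 m1 m2 \<theta> \<longleftrightarrow> one.bil_symbol (?W1 m1 m2) \<sigma>" for \<sigma> m1 m2
    unfolding BS1_def one.bil_symbol_iff
    by (auto simp: smooth_funpow_bil_dba bil_dx_def bil_da_def mult.assoc)
  have B2: "\<sigma> \<in> BS2 m1 m2 \<theta> \<longleftrightarrow> two.bil_symbol (?W2 m1 m2) \<sigma>" for \<sigma> m1 m2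
    unfolding BS2_def two.bil_symbol_iff
    by (auto simp: smooth_funpow_bil_dab smooth_funpow_dir_deriv bil_dx_def bil_db_def mult.assoc)
  \<comment> \<open>The new factor merges with the power of 1 + |alpha + beta|, which carries the
    first order here and the second order in \<open>W2\<close>.\<close>
  have W1: "(\<lambda>p. ?W1 m1 m2 p * (1 + \<bar>fst p + snd p\<bar>) powr s) = ?W1 (m1 + s) m2" for s
    by (simp add: powr_add mult_ac)
  have W2: "(\<lambda>p. ?W2 m1 m2 p * (1 + \<bar>fst p + snd p\<bar>) powr s) = ?W2 m1 (m2 + s)" for s
    by (simp add: powr_add mult_ac)
  have C: "continuous_on UNIV (?W1 m1 m2)" "continuous_on UNIV (?W2 m1 m2)"
    by (auto intro!: continuous_intros)
  have N: "0 \<le> ?W1 m1 m2 p" "0 \<le> ?W2 m1 m2 p" for p by auto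
  have eq: "a + (t - real N) = a + t - real N" for a N by simp
  show ?thesis
    unfolding Ball_def B1 B2
    using one.composition[OF _ N(1) C(1) ex_poly_weight_bound(1) \<tau>]
      two.composition[OF _ N(2) C(2) ex_poly_weight_bound(2) \<tau>]
    unfolding Ball_def W1 W2 eq by blast
qed

end
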